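(* Let $n\ge1$, $s>0$, $\lambda>1$, $1\le p\le\infty$, and let $f\in L^p(\mathbb R^n)$. Suppose that $u\in\mathcal S'(\mathbb R^n)$ is a distributional solution of $$(\lambda I-\Delta)^{s+\ln}u=f\qquad\text{in }\mathbb R^n .$$ Then $u\in\mathcal L^{p}_{s+\ln,\lambda}(\mathbb R^n)$ and $$\|u\|_{\mathcal L^{p}_{s+\ln,\lambda}(\mathbb R^n)}=\|f\|_{L^p(\mathbb R^n)}.$$ Moreover, the solution is uniquely determined and is given by the logarithmic Bessel potential $$u=(\lambda I-\Delta)^{-(s+\ln)}f=K^{\lambda}_{s+\ln}*f.$$
   Context: The Fourier transform is $\mathcal F u(\xi)=\widehat u(\xi)=\int_{\mathbb{R}^n}u(x)e^{-2\pi i x\cdot\xi}\,dx$, extended to tempered distributions $\mathcal S'(\mathbb R^n)$. For $s>0$, $\lambda>1$, the operators $(\lambda I-\Delta)^{\pm(s+\ln)}$ on $\mathcal S'(\mathbb R^n)$ are the Fourier multipliers with (smooth, polynomially bounded) symbols $\bigl[(\lambda+4\pi^2|\xi|^2)^s\ln(\lambda+4\pi^2|\xi|^2)\bigr]^{\pm1}$, i.e. $\mathcal F\bigl((\lambda I-\Delta)^{\pm(s+\ln)}u\bigr)=\bigl[(\lambda+4\pi^2|\xi|^2)^s\ln(\lambda+4\pi^2|\xi|^2)\bigr]^{\pm1}\widehat u$. The logarithmic Bessel kernel $K^\lambda_{s+\ln}$ is the tempered distribution (in fact an $L^1(\mathbb R^n)$ function) with Fourier transform $\bigl[(\lambda+4\pi^2|\xi|^2)^s\ln(\lambda+4\pi^2|\xi|^2)\bigr]^{-1}$.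 The logarithmic Bessel space is $$\mathcal L^{p}_{s+\ln,\lambda}(\mathbb R^n)=\{u\in\mathcal S'(\mathbb R^n):(\lambda I-\Delta)^{s+\ln}u\in L^p(\mathbb R^n)\},\qquad \|u\|_{\mathcal L^{p}_{s+\ln,\lambda}(\mathbb R^n)}=\|(\lambda I-\Delta)^{s+\ln}u\|_{L^p(\mathbb R^n)}.$$ A distributional solution is a $u\in\mathcal S'(\mathbb R^n)$ for which the equation holds in $\mathcal S'(\mathbb R^n)$. *)

theory Defs
  imports "HOL-Analysis.Analysis" "HOL-Library.FuncSet" "HOL-Probability.Essential_Supremum"
begin

section \<open>Schwartz functions and tempered distributions\<close>

definition partial_deriv :: "'n \<Rightarrow> (real^'n \<Rightarrow> complex) \<Rightarrow> real^'n \<Rightarrow> complex" where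
  "partial_deriv i \<phi> x = frechet_derivative \<phi> (at x) (axis i 1)"

text \<open>A list of coordinate indices plays the role of a multi-index; its length is the order of the
  derivative.\<close>

definition iter_deriv :: "'n list \<Rightarrow> (real^'n \<Rightarrow> complex) \<Rightarrow> real^'n \<Rightarrow> complex" where
  "iter_deriv is \<phi> = foldr partial_deriv is \<phi>"

definition smooth :: "(real^'n \<Rightarrow> complex) \<Rightarrow> bool" where
  "smooth \<phi> \<longleftrightarrow> (\<forall>is x. iter_deriv is \<phi> differentiable (at x))"

definition schwartz_space :: "(real^'n \<Rightarrow> complex) set" where
  "schwartz_space = {\<phi>. smooth \<phi> \<and>
     (\<forall>k is. bdd_above (range (\<lambda>x. (1 + norm x) ^ k * norm (iter_deriv is \<phi> x))))}"

definition schwartz_seminorm :: "nat \<Rightarrow> 'n list \<Rightarrow> (real^'n \<Rightarrow> complex) \<Rightarrow> real" where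
  "schwartz_seminorm k is \<phi> = (SUP x. (1 + norm x) ^ k * norm (iter_deriv is \<phi> x))"

definition schwartz_topology :: "(real^'n \<Rightarrow> complex) topology" where
  "schwartz_topology = topology_generated_by
     {{\<psi> \<in> schwartz_space. schwartz_seminorm k is (\<lambda>x. \<psi> x - \<phi> x) < \<epsilon>} | k is \<phi> \<epsilon>.
        \<phi> \<in> schwartz_space \<and> \<epsilon> > 0}"

text \<open>Distributions are taken to be extensional on the Schwartz space, so that HOL equality of
  functionals is equality of distributions.\<close>

type_synonym 'n functional = "(real^'n \<Rightarrow> complex) \<Rightarrow> complex"

definition tempered_distributions :: "('n::finite) functional set" where
  "tempered_distributions = {T. T \<in> extensional schwartz_space \<and>
     (\<forall>\<phi>\<in>schwartz_space. \<forall>\<psi>\<in>schwartz_space. T (\<lambda>x. \<phi> x + \<psi> x) = T \<phi> + T \<psi>) \<and>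
     (\<forall>c. \<forall>\<phi>\<in>schwartz_space. T (\<lambda>x. c * \<phi> x) = c * T \<phi>) \<and>
     continuous_map schwartz_topology euclidean T}"

definition regular_dist :: "(real^'n \<Rightarrow> complex) \<Rightarrow> ('n::finite) functional" where
  "regular_dist g = (\<lambda>\<phi>\<in>schwartz_space. LINT x|lebesgue. g x * \<phi> x)"

definition mult_dist :: "(real^'n \<Rightarrow> real) \<Rightarrow> ('n::finite) functional \<Rightarrow> ('n::finite) functional" where
  "mult_dist a T = (\<lambda>\<phi>\<in>schwartz_space. T (\<lambda>\<xi>. complex_of_real (a \<xi>) * \<phi> \<xi>))"

section \<open>Fourier transform and Fourier multipliers\<close>

definition fourier :: "(real^'n \<Rightarrow> complex) \<Rightarrow> real^'n \<Rightarrow> complex" where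
  "fourier \<phi> \<xi> = (LINT x|lebesgue. \<phi> x * exp (- 2 * complex_of_real pi * \<i> * complex_of_real (x \<bullet> \<xi>)))"

definition fourier_dist :: "('n::finite) functional \<Rightarrow> ('n::finite) functional" where
  "fourier_dist T = (\<lambda>\<phi>\<in>schwartz_space. T (fourier \<phi>))"

definition fourier_multiplier :: "(real^'n \<Rightarrow> real) \<Rightarrow> ('n::finite) functional \<Rightarrow> ('n::finite) functional" where
  "fourier_multiplier a T =
     (THE v. v \<in> tempered_distributions \<and> fourier_dist v = mult_dist a (fourier_dist T))"

section \<open>Lebesgue spaces\<close>

definition Lp_space :: "ennreal \<Rightarrow> (real^'n \<Rightarrow> complex) set" where
  "Lp_space p = {g \<in> borel_measurable lebesgue.
     if p = \<infinity> then esssup lebesgue (\<lambda>x. ennreal (norm (g x))) < \<infinity>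
     else integrable lebesgue (\<lambda>x. norm (g x) powr enn2real p)}"

definition Lp_norm :: "ennreal \<Rightarrow> (real^'n \<Rightarrow> complex) \<Rightarrow> real" where
  "Lp_norm p g =
     (if p = \<infinity> then enn2real (esssup lebesgue (\<lambda>x. ennreal (norm (g x))))
      else (LINT x|lebesgue. norm (g x) powr enn2real p) powr (1 / enn2real p))"

definition Lp_dist :: "ennreal \<Rightarrow> ('n::finite) functional set" where
  "Lp_dist p = regular_dist ` Lp_space p"

text \<open>The representing function is unique up to null sets, so the choice is immaterial.\<close>

definition Lp_dist_norm :: "ennreal \<Rightarrow> ('n::finite) functional \<Rightarrow> real" where
  "Lp_dist_norm p T = Lp_norm p (SOME g. g \<in> Lp_space p \<and> regular_dist g = T)"

definition convolve :: "(real^'n \<Rightarrow> complex) \<Rightarrow> (real^'n \<Rightarrow> complex) \<Rightarrow> real^'n \<Rightarrow> complex" where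
  "convolve k g x = (LINT y|lebesgue. k (x - y) * g y)"

section \<open>Logarithmic Bessel operators, kernels and spaces\<close>

definition log_bessel_symbol :: "real \<Rightarrow> real \<Rightarrow> real^'n \<Rightarrow> real" where
  "log_bessel_symbol s lam \<xi> =
     (lam + 4 * pi\<^sup>2 * (norm \<xi>)\<^sup>2) powr s * ln (lam + 4 * pi\<^sup>2 * (norm \<xi>)\<^sup>2)"

definition log_bessel_op :: "real \<Rightarrow> real \<Rightarrow> ('n::finite) functional \<Rightarrow> ('n::finite) functional" where
  "log_bessel_op s lam = fourier_multiplier (log_bessel_symbol s lam)"

definition log_bessel_inv_op :: "real \<Rightarrow> real \<Rightarrow> ('n::finite) functional \<Rightarrow> ('n::finite) functional" where
  "log_bessel_inv_op s lam = fourier_multiplier (\<lambda>\<xi>. inverse (log_bessel_symbol s lam \<xi>))"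

definition log_bessel_kernel :: "real \<Rightarrow> real \<Rightarrow> ('n::finite) functional" where
  "log_bessel_kernel s lam =
     (THE K. K \<in> tempered_distributions \<and>
        fourier_dist K = regular_dist (\<lambda>\<xi>. complex_of_real (inverse (log_bessel_symbol s lam \<xi>))))"

definition log_bessel_space :: "ennreal \<Rightarrow> real \<Rightarrow> real \<Rightarrow> ('n::finite) functional set" where
  "log_bessel_space p s lam = {u \<in> tempered_distributions. log_bessel_op s lam u \<in> Lp_dist p}"

definition log_bessel_norm :: "ennreal \<Rightarrow> real \<Rightarrow> real \<Rightarrow> ('n::finite) functional \<Rightarrow> real" where
  "log_bessel_norm p s lam u = Lp_dist_norm p (log_bessel_op s lam u)"

end

theory Submission
  imports Defs "HOL-Probability.Probability"
begin

text \<open>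
  Write \<open>a \<xi> = w powr s * ln w\<close> with \<open>w = lam + 4 \<pi>\<^sup>2 \<bar>\<xi>\<bar>\<^sup>2\<close>.  On the Fourier side the equation reads
  \<open>a \<cdot> F u = F f\<close>.  Since \<open>w \<ge> lam > 1\<close>, both \<open>a\<close> and \<open>1 / a\<close> are smooth with derivatives of polynomial
  growth, so multiplication by either of them is a continuous operator on the Schwartz space; and \<open>F\<close> is
  a bijection of that space.  Hence the equation can be divided by \<open>a\<close>: \<open>u\<close> is the only solution, and it
  is the multiplier \<open>1 / a\<close> applied to \<open>f\<close>.  Membership in the Bessel space is immediate, and the
  norm identity rests on the fact that an \<open>L\<^sup>p\<close> function is determined almost everywhere by the distribution it
  defines (\<open>regular_dist_inj_AE\<close>), which is proved by testing with Gaussians.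

  For this the operators in question are shown to be continuous on the Schwartz space:
  multiplication by slowly increasing functions (\<open>schwartz_operator_mult\<close>) and the Fourier transform
  (\<open>schwartz_operator_fourier\<close>), the latter by exchanging derivatives and powers.  Inversion
  (\<open>fourier_inversion\<close>) yields \<open>F\<^sup>4 = id\<close>, so that \<open>F\<^sup>3\<close> is a continuous inverse; this makes
  Fourier multipliers of tempered distributions well defined (\<open>fourier_dist_fourier_multiplier\<close>).

  The kernel is found by subordination.  From \<open>w powr - \<tau> = (\<integral>\<^sub>0\<^sup>\<infinity> t powr (\<tau> - 1) e\<^sup>-\<^sup>t\<^sup>w dt) / \<Gamma>(\<tau>)\<close>,
  integrated over \<open>\<tau> \<ge> s\<close>, one obtains \<open>1 / a = \<integral>\<^sub>0\<^sup>\<infinity> \<rho>(t) e\<^sup>-\<^sup>t\<^sup>w dt\<close> with the nonnegative weight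
  \<open>\<rho>(t) = \<integral> t powr (\<tau> - 1) / \<Gamma>(\<tau>) d\<tau>\<close> over \<open>\<tau> \<ge> s\<close> (\<open>log_weight_laplace\<close>).  The factor
  \<open>exp (- 4 \<pi>\<^sup>2 t \<bar>\<xi>\<bar>\<^sup>2)\<close> of the integrand is the transform of the heat kernel, a probability density.  Therefore
  \<open>k = \<integral>\<^sub>0\<^sup>\<infinity> \<rho>(t) exp (- lam t) heat_kernel t dt\<close> is an integrable function with transform \<open>1 / a\<close>
  (\<open>fourier_bessel_density\<close>), and Fubini's theorem identifies its convolution with \<open>f\<close> as the
  solution (\<open>convolution_fourier\<close>).
\<close>

section \<open>Iterated derivatives and the Schwartz space\<close>

lemma partial_deriv_eqI:
  assumes "(\<phi> has_derivative D) (at x)"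
  shows "partial_deriv i \<phi> x = D (axis i 1)"
  using frechet_derivative_at[OF assms] by (simp add: partial_deriv_def)

lemma partial_deriv_add:
  fixes \<phi> \<psi> :: "real^'n \<Rightarrow> complex"
  assumes "\<And>x. \<phi> differentiable (at x)" "\<And>x. \<psi> differentiable (at x)"
  shows "partial_deriv i (\<lambda>x. \<phi> x + \<psi> x) = (\<lambda>x. partial_deriv i \<phi> x + partial_deriv i \<psi> x)"
proof
  fix x
  have "((\<lambda>x. \<phi> x + \<psi> x) has_derivative
      (\<lambda>h. frechet_derivative \<phi> (at x) h + frechet_derivative \<psi> (at x) h)) (at x)"
    using assms frechet_derivative_works by (intro has_derivative_add) blast+
  from partial_deriv_eqI[OF this]
  show "partial_deriv i (\<lambda>x. \<phi> x + \<psi> x) x = partial_deriv i \<phi> x + partial_deriv i \<psi> x"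
    by (simp add: partial_deriv_def)
qed

lemma partial_deriv_mult:
  fixes \<phi> \<psi> :: "real^'n \<Rightarrow> complex"
  assumes "\<And>x. \<phi> differentiable (at x)" "\<And>x. \<psi> differentiable (at x)"
  shows "partial_deriv i (\<lambda>x. \<phi> x * \<psi> x)
    = (\<lambda>x. partial_deriv i \<phi> x * \<psi> x + \<phi> x * partial_deriv i \<psi> x)"
proof
  fix x
  have "((\<lambda>x. \<phi> x * \<psi> x) has_derivative
      (\<lambda>h. \<phi> x * frechet_derivative \<psi> (at x) h + frechet_derivative \<phi> (at x) h * \<psi> x)) (at x)"
    using assms frechet_derivative_works by (intro has_derivative_mult) blast+
  from partial_deriv_eqI[OF this]
  show "partial_deriv i (\<lambda>x. \<phi> x * \<psi> x) x
      = partial_deriv i \<phi> x * \<psi> x + \<phi> x * partial_deriv i \<psi> x"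
    by (simp add: partial_deriv_def)
qed

lemma partial_deriv_const: "partial_deriv i (\<lambda>x. c) = (\<lambda>x. 0)"
  by (rule ext, subst partial_deriv_eqI[where D = "\<lambda>_. 0"]) (auto intro: derivative_intros)

lemma iter_deriv_Nil [simp]: "iter_deriv [] \<phi> = \<phi>"
  by (simp add: iter_deriv_def)

lemma iter_deriv_Cons: "iter_deriv (i # js) \<phi> = partial_deriv i (iter_deriv js \<phi>)"
  by (simp add: iter_deriv_def)

lemma iter_deriv_partial_deriv: "iter_deriv js (partial_deriv i \<phi>) = iter_deriv (js @ [i]) \<phi>"
  by (simp add: iter_deriv_def)

lemma smooth_iter_deriv_differentiable: "smooth \<phi> \<Longrightarrow> iter_deriv js \<phi> differentiable (at x)"
  by (simp add: smooth_def)

lemma smooth_differentiable: "smooth \<phi> \<Longrightarrow> \<phi> differentiable (at x)"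
  using smooth_iter_deriv_differentiable[of \<phi> "[]"] by simp

lemma smooth_partial_deriv: "smooth \<phi> \<Longrightarrow> smooth (partial_deriv i \<phi>)"
  by (simp add: smooth_def iter_deriv_partial_deriv)

lemma smooth_has_derivative:
  "smooth \<phi> \<Longrightarrow> (\<phi> has_derivative frechet_derivative \<phi> (at x)) (at x)"
  using smooth_differentiable frechet_derivative_works by blast

lemma smooth_continuous_on: "smooth \<phi> \<Longrightarrow> continuous_on A \<phi>"
  by (meson continuous_at_imp_continuous_on differentiable_imp_continuous_within smooth_differentiable)

lemma smooth_borel_measurable: "smooth \<phi> \<Longrightarrow> \<phi> \<in> borel_measurable borel"
  by (simp add: borel_measurable_continuous_onI smooth_continuous_on)

lemma iter_deriv_add:
  fixes \<phi> \<psi> :: "real^'n \<Rightarrow> complex"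
  assumes "smooth \<phi>" "smooth \<psi>"
  shows "iter_deriv js (\<lambda>x. \<phi> x + \<psi> x) = (\<lambda>x. iter_deriv js \<phi> x + iter_deriv js \<psi> x)"
  by (induction js) (auto simp: iter_deriv_Cons partial_deriv_add assms smooth_iter_deriv_differentiable)

lemma smooth_add:
  fixes \<phi> \<psi> :: "real^'n \<Rightarrow> complex"
  assumes "smooth \<phi>" "smooth \<psi>"
  shows "smooth (\<lambda>x. \<phi> x + \<psi> x)"
  using assms by (auto simp: smooth_def iter_deriv_add[OF assms] intro!: differentiable_add)

text \<open>Each letter of the word \<open>js\<close> falls on one of the two factors, so a derivative of a product is a sum over
  pairs of subwords.  The list of pairs is chosen before the factors: the norm estimates below must be uniform in
  one of them.\<close>

lemma iter_deriv_mult: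
  fixes js :: "'n::finite list"
  shows "\<exists>ps :: ('n list \<times> 'n list) list. \<forall>\<phi> \<psi> :: real^'n \<Rightarrow> complex. smooth \<phi> \<longrightarrow> smooth \<psi> \<longrightarrow>
      iter_deriv js (\<lambda>x. \<phi> x * \<psi> x) = (\<lambda>x. \<Sum>p\<leftarrow>ps. iter_deriv (fst p) \<phi> x * iter_deriv (snd p) \<psi> x)"
proof -
  have diff: "(\<lambda>x. \<Sum>p\<leftarrow>ps. iter_deriv (fst p) \<phi> x * iter_deriv (snd p) \<psi> x) differentiable (at y)"
    if "smooth \<phi>" "smooth \<psi>" for ps :: "('n list \<times> 'n list) list" and \<phi> \<psi> :: "real^'n \<Rightarrow> complex" and y
    by (induction ps)
      (auto intro!: differentiable_add differentiable_mult smooth_iter_deriv_differentiable that)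
  show ?thesis
  proof (induction js)
    case Nil
    show ?case by (rule exI[of _ "[([], [])]"]) simp
  next
    case (Cons i js)
    then obtain ps where ps: "\<And>\<phi> \<psi> :: real^'n \<Rightarrow> complex. smooth \<phi> \<Longrightarrow> smooth \<psi> \<Longrightarrow>
      iter_deriv js (\<lambda>x. \<phi> x * \<psi> x) = (\<lambda>x. \<Sum>p\<leftarrow>ps. iter_deriv (fst p) \<phi> x * iter_deriv (snd p) \<psi> x)"
      by blast
    let ?step = "\<lambda>p. [(i # fst p, snd p), (fst p, i # snd p)]"
    have step: "partial_deriv i (\<lambda>x. \<Sum>p\<leftarrow>qs. iter_deriv (fst p) \<phi> x * iter_deriv (snd p) \<psi> x)
        = (\<lambda>x. \<Sum>p\<leftarrow>concat (map ?step qs). iter_deriv (fst p) \<phi> x * iter_deriv (snd p) \<psi> x)"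
      if "smooth \<phi>" "smooth \<psi>" for qs and \<phi> \<psi> :: "real^'n \<Rightarrow> complex"
    proof (induction qs)
      case Nil
      show ?case by (simp add: partial_deriv_const)
    next
      case (Cons q qs)
      have "partial_deriv i (\<lambda>x. iter_deriv (fst q) \<phi> x * iter_deriv (snd q) \<psi> x
          + (\<Sum>p\<leftarrow>qs. iter_deriv (fst p) \<phi> x * iter_deriv (snd p) \<psi> x))
        = (\<lambda>x. partial_deriv i (\<lambda>x. iter_deriv (fst q) \<phi> x * iter_deriv (snd q) \<psi> x) x
          + partial_deriv i (\<lambda>x. \<Sum>p\<leftarrow>qs. iter_deriv (fst p) \<phi> x * iter_deriv (snd p) \<psi> x) x)"
        by (intro partial_deriv_add diff that differentiable_mult smooth_iter_deriv_differentiable)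
      also have "partial_deriv i (\<lambda>x. iter_deriv (fst q) \<phi> x * iter_deriv (snd q) \<psi> x)
        = (\<lambda>x. partial_deriv i (iter_deriv (fst q) \<phi>) x * iter_deriv (snd q) \<psi> x
            + iter_deriv (fst q) \<phi> x * partial_deriv i (iter_deriv (snd q) \<psi>) x)"
        by (intro partial_deriv_mult that smooth_iter_deriv_differentiable)
      finally show ?case by (simp add: Cons.IH iter_deriv_Cons add.assoc)
    qed
    show ?case
      by (rule exI[of _ "concat (map ?step ps)"]) (simp add: iter_deriv_Cons ps step)
  qed
qed

lemma smooth_mult:
  fixes \<phi> \<psi> :: "real^'n \<Rightarrow> complex"
  assumes "smooth \<phi>" "smooth \<psi>"
  shows "smooth (\<lambda>x. \<phi> x * \<psi> x)"
proof -
  have "iter_deriv js (\<lambda>x. \<phi> x * \<psi> x) differentiable (at y)" for js y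
  proof -
    obtain ps where "\<forall>\<phi> \<psi> :: real^'n \<Rightarrow> complex. smooth \<phi> \<longrightarrow> smooth \<psi> \<longrightarrow>
        iter_deriv js (\<lambda>x. \<phi> x * \<psi> x) = (\<lambda>x. \<Sum>p\<leftarrow>ps. iter_deriv (fst p) \<phi> x * iter_deriv (snd p) \<psi> x)"
      using iter_deriv_mult[of js] ..
    with assms have ps: "iter_deriv js (\<lambda>x. \<phi> x * \<psi> x)
        = (\<lambda>x. \<Sum>p\<leftarrow>ps. iter_deriv (fst p) \<phi> x * iter_deriv (snd p) \<psi> x)" by simp
    have "(\<lambda>x. \<Sum>p\<leftarrow>ps. iter_deriv (fst p) \<phi> x * iter_deriv (snd p) \<psi> x) differentiable (at y)"
      by (induction ps)
        (auto intro!: differentiable_add differentiable_mult smooth_iter_deriv_differentiable assms)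
    then show ?thesis by (simp add: ps)
  qed
  then show ?thesis by (simp add: smooth_def)
qed

text \<open>All explicit functions below are shown to be smooth by exhibiting a class of differentiable functions,
  described by formulas, that is closed under partial derivatives.\<close>

lemma derivation_closed_iter_deriv:
  assumes "\<phi> \<in> A" and "\<And>\<psi> i. \<psi> \<in> A \<Longrightarrow> partial_deriv i \<psi> \<in> A"
  shows "iter_deriv js \<phi> \<in> A"
  by (induction js) (auto simp: iter_deriv_Cons assms)

lemma derivation_closed_smooth:
  assumes "\<phi> \<in> A" and "\<And>\<psi> i. \<psi> \<in> A \<Longrightarrow> partial_deriv i \<psi> \<in> A"
    and "\<And>\<psi> x. \<psi> \<in> A \<Longrightarrow> \<psi> differentiable (at x)"
  shows "smooth \<phi>"
  unfolding smooth_def by (intro allI assms(3) derivation_closed_iter_deriv[of \<phi> A] assms(1,2))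

lemma smooth_const: "smooth (\<lambda>x. c)"
  by (rule derivation_closed_smooth[of _ "range (\<lambda>c x. c)"]) (auto simp: partial_deriv_const)

lemma iter_deriv_cmult:
  fixes \<phi> :: "real^'n \<Rightarrow> complex"
  assumes "smooth \<phi>"
  shows "iter_deriv js (\<lambda>x. c * \<phi> x) = (\<lambda>x. c * iter_deriv js \<phi> x)"
proof (induction js)
  case (Cons i js)
  have "partial_deriv i (\<lambda>x. c * iter_deriv js \<phi> x) = (\<lambda>x. c * partial_deriv i (iter_deriv js \<phi>) x)"
    by (subst partial_deriv_mult) (auto simp: assms smooth_iter_deriv_differentiable partial_deriv_const)
  then show ?case by (simp add: iter_deriv_Cons Cons.IH)
qed simp

subsection \<open>Seminorms and continuity\<close>

lemma schwartz_spaceI: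
  assumes "smooth \<phi>" and "\<And>k js. \<exists>C. \<forall>x. (1 + norm x) ^ k * norm (iter_deriv js \<phi> x) \<le> C"
  shows "\<phi> \<in> schwartz_space"
  using assms unfolding schwartz_space_def bdd_above_def by auto

lemma schwartz_space_smooth: "\<phi> \<in> schwartz_space \<Longrightarrow> smooth \<phi>"
  by (simp add: schwartz_space_def)

lemma schwartz_seminorm_upper:
  assumes "\<phi> \<in> schwartz_space"
  shows "(1 + norm x) ^ k * norm (iter_deriv js \<phi> x) \<le> schwartz_seminorm k js \<phi>"
  using assms unfolding schwartz_seminorm_def schwartz_space_def by (intro cSUP_upper) auto

lemma schwartz_seminorm_least:
  assumes "\<And>x. (1 + norm x) ^ k * norm (iter_deriv js \<phi> x) \<le> C"
  shows "schwartz_seminorm k js \<phi> \<le> C"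
  unfolding schwartz_seminorm_def by (rule cSUP_least) (use assms in auto)

lemma schwartz_seminorm_nonneg: "\<phi> \<in> schwartz_space \<Longrightarrow> 0 \<le> schwartz_seminorm k js \<phi>"
  by (rule order_trans[OF _ schwartz_seminorm_upper[of \<phi> 0]]) auto

lemma schwartz_space_add:
  fixes \<phi> \<psi> :: "real^'n \<Rightarrow> complex"
  assumes "\<phi> \<in> schwartz_space" "\<psi> \<in> schwartz_space"
  shows "(\<lambda>x. \<phi> x + \<psi> x) \<in> schwartz_space"
proof (rule schwartz_spaceI)
  show "smooth (\<lambda>x. \<phi> x + \<psi> x)" using assms by (intro smooth_add schwartz_space_smooth)
  fix k js
  have "(1 + norm x) ^ k * norm (iter_deriv js (\<lambda>x. \<phi> x + \<psi> x) x)
      \<le> schwartz_seminorm k js \<phi> + schwartz_seminorm k js \<psi>" for x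
  proof -
    have "(1 + norm x) ^ k * norm (iter_deriv js (\<lambda>x. \<phi> x + \<psi> x) x)
      \<le> (1 + norm x) ^ k * (norm (iter_deriv js \<phi> x) + norm (iter_deriv js \<psi> x))"
      using assms by (intro mult_left_mono)
        (auto simp: iter_deriv_add schwartz_space_smooth norm_triangle_ineq)
    then show ?thesis
      using schwartz_seminorm_upper[OF assms(1), of x k js] schwartz_seminorm_upper[OF assms(2), of x k js]
      by (simp add: algebra_simps)
  qed
  then show "\<exists>C. \<forall>x. (1 + norm x) ^ k * norm (iter_deriv js (\<lambda>x. \<phi> x + \<psi> x) x) \<le> C" by blast
qed

lemma schwartz_space_cmult:
  fixes \<phi> :: "real^'n \<Rightarrow> complex"
  assumes "\<phi> \<in> schwartz_space"
  shows "(\<lambda>x. c * \<phi> x) \<in> schwartz_space"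
proof (rule schwartz_spaceI)
  show "smooth (\<lambda>x. c * \<phi> x)" using assms by (intro smooth_mult smooth_const schwartz_space_smooth)
  fix k js
  have "(1 + norm x) ^ k * norm (iter_deriv js (\<lambda>x. c * \<phi> x) x) \<le> norm c * schwartz_seminorm k js \<phi>" for x
    using mult_left_mono[OF schwartz_seminorm_upper[OF assms, of x k js], of "norm c"] assms
    by (simp add: iter_deriv_cmult schwartz_space_smooth norm_mult algebra_simps)
  then show "\<exists>C. \<forall>x. (1 + norm x) ^ k * norm (iter_deriv js (\<lambda>x. c * \<phi> x) x) \<le> C" by blast
qed

lemma schwartz_space_diff:
  fixes \<phi> \<psi> :: "real^'n \<Rightarrow> complex"
  assumes "\<phi> \<in> schwartz_space" "\<psi> \<in> schwartz_space"
  shows "(\<lambda>x. \<phi> x - \<psi> x) \<in> schwartz_space"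
  using schwartz_space_add[OF assms(1) schwartz_space_cmult[OF assms(2), of "-1"]] by simp

lemma iter_deriv_diff:
  fixes \<phi> \<psi> :: "real^'n \<Rightarrow> complex"
  assumes "\<phi> \<in> schwartz_space" "\<psi> \<in> schwartz_space"
  shows "iter_deriv js (\<lambda>x. \<phi> x - \<psi> x) = (\<lambda>x. iter_deriv js \<phi> x - iter_deriv js \<psi> x)"
proof -
  have sm: "smooth \<phi>" "smooth \<psi>" "smooth (\<lambda>x. (-1) * \<psi> x)"
    using assms schwartz_space_cmult[OF assms(2), of "-1"] by (auto intro: schwartz_space_smooth)
  have "iter_deriv js (\<lambda>x. \<phi> x + (-1) * \<psi> x) = (\<lambda>x. iter_deriv js \<phi> x + (-1) * iter_deriv js \<psi> x)"
    by (simp only: iter_deriv_add[OF sm(1,3)] iter_deriv_cmult[OF sm(2)])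
  then show ?thesis by simp
qed

lemma schwartz_seminorm_triangle:
  fixes \<phi> \<psi> \<eta> :: "real^'n \<Rightarrow> complex"
  assumes "\<phi> \<in> schwartz_space" "\<psi> \<in> schwartz_space" "\<eta> \<in> schwartz_space"
  shows "schwartz_seminorm k js (\<lambda>x. \<phi> x - \<eta> x)
    \<le> schwartz_seminorm k js (\<lambda>x. \<phi> x - \<psi> x) + schwartz_seminorm k js (\<lambda>x. \<psi> x - \<eta> x)"
proof (rule schwartz_seminorm_least)
  fix x
  have "norm (iter_deriv js (\<lambda>x. \<phi> x - \<eta> x) x)
      \<le> norm (iter_deriv js (\<lambda>x. \<phi> x - \<psi> x) x) + norm (iter_deriv js (\<lambda>x. \<psi> x - \<eta> x) x)"
    using norm_triangle_ineq[of "iter_deriv js \<phi> x - iter_deriv js \<psi> x" "iter_deriv js \<psi> x - iter_deriv js \<eta> x"]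
    by (simp add: iter_deriv_diff assms)
  then have "(1 + norm x) ^ k * norm (iter_deriv js (\<lambda>x. \<phi> x - \<eta> x) x)
      \<le> (1 + norm x) ^ k * (norm (iter_deriv js (\<lambda>x. \<phi> x - \<psi> x) x) + norm (iter_deriv js (\<lambda>x. \<psi> x - \<eta> x) x))"
    by (intro mult_left_mono) auto
  then show "(1 + norm x) ^ k * norm (iter_deriv js (\<lambda>x. \<phi> x - \<eta> x) x)
      \<le> schwartz_seminorm k js (\<lambda>x. \<phi> x - \<psi> x) + schwartz_seminorm k js (\<lambda>x. \<psi> x - \<eta> x)"
    using schwartz_seminorm_upper[OF schwartz_space_diff[OF assms(1,2)], of x k js]
      schwartz_seminorm_upper[OF schwartz_space_diff[OF assms(2,3)], of x k js]
    by (simp add: algebra_simps)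
qed

text \<open>An increasing sequence of norms that generates the same topology as the seminorms, but is
  indexed by a single number.\<close>

definition schwartz_norm :: "nat \<Rightarrow> (real^'n \<Rightarrow> complex) \<Rightarrow> real" where
  "schwartz_norm m \<phi> = (\<Sum>(k, js)\<in>{..m} \<times> {js :: 'n list. length js \<le> m}. schwartz_seminorm k js \<phi>)"

lemma finite_words: "finite {js :: 'n::finite list. length js \<le> m}"
  using finite_lists_length_le[of "UNIV :: 'n set" m] by simp

lemma schwartz_norm_upper:
  fixes \<phi> :: "real^'n::finite \<Rightarrow> complex"
  assumes "\<phi> \<in> schwartz_space" "k \<le> m" "length js \<le> m"
  shows "(1 + norm x) ^ k * norm (iter_deriv js \<phi> x) \<le> schwartz_norm m \<phi>"
proof -
  have "schwartz_seminorm k js \<phi> \<le> schwartz_norm m \<phi>"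
    unfolding schwartz_norm_def
    using assms member_le_sum[of "(k, js)" "{..m} \<times> {js :: 'n list. length js \<le> m}"
        "\<lambda>(k, js). schwartz_seminorm k js \<phi>"]
    by (auto simp: finite_words schwartz_seminorm_nonneg)
  then show ?thesis using schwartz_seminorm_upper[OF assms(1), of x k js] by linarith
qed

lemma schwartz_norm_nonneg: "\<phi> \<in> schwartz_space \<Longrightarrow> 0 \<le> schwartz_norm m \<phi>"
  unfolding schwartz_norm_def by (intro sum_nonneg) (auto simp: schwartz_seminorm_nonneg)

lemma schwartz_norm_mono:
  fixes \<phi> :: "real^'n::finite \<Rightarrow> complex"
  shows "\<phi> \<in> schwartz_space \<Longrightarrow> m \<le> m' \<Longrightarrow> schwartz_norm m \<phi> \<le> schwartz_norm m' \<phi>"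
  unfolding schwartz_norm_def
  by (rule sum_mono2) (auto simp: schwartz_seminorm_nonneg finite_words intro!: finite_cartesian_product)

lemma topspace_schwartz_topology [simp]: "topspace schwartz_topology = schwartz_space"
proof -
  have "\<phi> \<in> \<Union> {{\<psi> \<in> schwartz_space. schwartz_seminorm k js (\<lambda>x. \<psi> x - \<phi> x) < \<epsilon>} | k js \<phi> \<epsilon>.
        \<phi> \<in> schwartz_space \<and> \<epsilon> > 0}" if "\<phi> \<in> schwartz_space" for \<phi> :: "real^'n \<Rightarrow> complex"
  proof -
    have "schwartz_seminorm 0 [] (\<lambda>x. \<phi> x - \<phi> x) < 1"
      using schwartz_seminorm_least[of 0 "[]" "\<lambda>x. \<phi> x - \<phi> x" 0] by simp
    then show ?thesis using that
      by (intro UnionI[of "{\<psi> \<in> schwartz_space. schwartz_seminorm 0 [] (\<lambda>x. \<psi> x - \<phi> x) < 1}"] CollectI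
          exI[of _ "0::nat"] exI[of _ "[]"] exI[of _ \<phi>] exI[of _ "1::real"] conjI refl) auto
  qed
  then show ?thesis unfolding schwartz_topology_def by auto
qed

text \<open>A ball of \<open>schwartz_norm m\<close> around a point contains a finite intersection of subbasic sets centred
  at that point, so it suffices to fit such a ball into the set around each of its points.\<close>

lemma openin_schwartz_topologyI:
  fixes A :: "(real^'n::finite \<Rightarrow> complex) set"
  assumes sub: "A \<subseteq> schwartz_space"
    and ball: "\<And>\<phi>. \<phi> \<in> A \<Longrightarrow> \<exists>m \<epsilon>. 0 < \<epsilon> \<and>
      (\<forall>\<psi>\<in>schwartz_space. schwartz_norm m (\<lambda>x. \<psi> x - \<phi> x) < \<epsilon> \<longrightarrow> \<psi> \<in> A)"
  shows "openin schwartz_topology A"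
proof (subst openin_subopen, intro ballI)
  fix \<phi> assume \<phi>: "\<phi> \<in> A"
  with sub have S: "\<phi> \<in> schwartz_space" by blast
  from ball[OF \<phi>] obtain m \<epsilon> where \<epsilon>: "0 < \<epsilon>"
    "\<And>\<psi>. \<psi> \<in> schwartz_space \<Longrightarrow> schwartz_norm m (\<lambda>x. \<psi> x - \<phi> x) < \<epsilon> \<Longrightarrow> \<psi> \<in> A"
    by blast
  let ?I = "{..m} \<times> {js :: 'n list. length js \<le> m}"
  have fin: "finite ?I" by (intro finite_cartesian_product finite_words finite_atMost)
  have pos: "0 < card ?I" using fin by (auto simp: card_gt_0_iff intro!: exI[of _ "[]"])
  define B where "B = (\<lambda>(k, js). {\<psi> \<in> schwartz_space.
      schwartz_seminorm k js (\<lambda>x. \<psi> x - \<phi> x) < \<epsilon> / real (card ?I)})"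
  have "openin schwartz_topology (B i)" for i
    unfolding B_def schwartz_topology_def using S \<epsilon>(1) pos
    by (cases i, simp, intro topology_generated_by_Basis) (auto intro!: exI divide_pos_pos)
  then have "openin schwartz_topology (\<Inter>i\<in>?I. B i)"
    using fin by (intro openin_INT2) (auto intro: exI[of _ "[]"])
  moreover have "\<phi> \<in> (\<Inter>i\<in>?I. B i)"
  proof (intro INT_I)
    fix i assume "i \<in> ?I"
    obtain k js where i: "i = (k, js)" by (cases i)
    have "iter_deriv js (\<lambda>x. \<phi> x - \<phi> x) = (\<lambda>x. 0)"
      using iter_deriv_diff[OF S S, of js] by simp
    then have "schwartz_seminorm k js (\<lambda>x. \<phi> x - \<phi> x) \<le> 0"
      by (intro schwartz_seminorm_least) (metis mult_zero_right norm_zero order_refl)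
    also have "0 < \<epsilon> / real (card ?I)" using \<epsilon>(1) pos by simp
    finally show "\<phi> \<in> B i" using S by (simp add: B_def i)
  qed
  moreover have "(\<Inter>i\<in>?I. B i) \<subseteq> A"
  proof
    fix \<psi> assume \<psi>: "\<psi> \<in> (\<Inter>i\<in>?I. B i)"
    have ne: "(0, []) \<in> ?I" by simp
    then have "\<psi> \<in> B (0, [])" using \<psi> by blast
    then have S': "\<psi> \<in> schwartz_space" by (simp add: B_def)
    have "schwartz_norm m (\<lambda>x. \<psi> x - \<phi> x) < (\<Sum>i\<in>?I. \<epsilon> / real (card ?I))"
      unfolding schwartz_norm_def
    proof (rule sum_strict_mono)
      fix i assume "i \<in> ?I"
      then have "\<psi> \<in> B i" using \<psi> by blast
      then show "(case i of (k, js) \<Rightarrow> schwartz_seminorm k js (\<lambda>x. \<psi> x - \<phi> x)) < \<epsilon> / real (card ?I)"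
        by (auto simp: B_def split: prod.splits)
    qed (use fin in \<open>auto intro: exI[of _ "[]"]\<close>)
    also have "\<dots> = \<epsilon>" using pos by simp
    finally show "\<psi> \<in> A" using \<epsilon>(2) S' by blast
  qed
  ultimately show "\<exists>T. openin schwartz_topology T \<and> \<phi> \<in> T \<and> T \<subseteq> A" by blast
qed

text \<open>Continuity is stated as a family of norm estimates, because these compose and can be checked
  pointwise; \<open>schwartz_operator_continuous\<close> translates them into continuity for the topology.\<close>

definition schwartz_operator :: "((real^'n \<Rightarrow> complex) \<Rightarrow> (real^'n \<Rightarrow> complex)) \<Rightarrow> bool" where
  "schwartz_operator L \<longleftrightarrow>
    (\<forall>\<phi>\<in>schwartz_space. \<forall>\<psi>\<in>schwartz_space. L (\<lambda>x. \<phi> x + \<psi> x) = (\<lambda>x. L \<phi> x + L \<psi> x)) \<and>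
    (\<forall>c. \<forall>\<phi>\<in>schwartz_space. L (\<lambda>x. c * \<phi> x) = (\<lambda>x. c * L \<phi> x)) \<and>
    (\<forall>\<phi>\<in>schwartz_space. L \<phi> \<in> schwartz_space) \<and>
    (\<forall>m. \<exists>C\<ge>0. \<exists>m'. \<forall>\<phi>\<in>schwartz_space. schwartz_norm m (L \<phi>) \<le> C * schwartz_norm m' \<phi>)"

lemma schwartz_operator_add:
  "schwartz_operator L \<Longrightarrow> \<phi> \<in> schwartz_space \<Longrightarrow> \<psi> \<in> schwartz_space \<Longrightarrow>
    L (\<lambda>x. \<phi> x + \<psi> x) = (\<lambda>x. L \<phi> x + L \<psi> x)"
  by (simp add: schwartz_operator_def)

lemma schwartz_operator_cmult:
  "schwartz_operator L \<Longrightarrow> \<phi> \<in> schwartz_space \<Longrightarrow> L (\<lambda>x. c * \<phi> x) = (\<lambda>x. c * L \<phi> x)"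
  by (simp add: schwartz_operator_def)

lemma schwartz_operator_closed:
  "schwartz_operator L \<Longrightarrow> \<phi> \<in> schwartz_space \<Longrightarrow> L \<phi> \<in> schwartz_space"
  by (simp add: schwartz_operator_def)

lemma schwartz_operator_bound:
  assumes "schwartz_operator L"
  obtains C m' where "0 \<le> C"
    "\<And>\<phi>. \<phi> \<in> schwartz_space \<Longrightarrow> schwartz_norm m (L \<phi>) \<le> C * schwartz_norm m' \<phi>"
  using assms unfolding schwartz_operator_def by metis

lemma schwartz_operator_diff:
  fixes L :: "(real^'n \<Rightarrow> complex) \<Rightarrow> (real^'n \<Rightarrow> complex)"
  assumes "schwartz_operator L" "\<phi> \<in> schwartz_space" "\<psi> \<in> schwartz_space"
  shows "L (\<lambda>x. \<phi> x - \<psi> x) = (\<lambda>x. L \<phi> x - L \<psi> x)"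
proof -
  have "L (\<lambda>x. \<phi> x + (-1) * \<psi> x) = (\<lambda>x. L \<phi> x + (-1) * L \<psi> x)"
    by (simp only: schwartz_operator_add[OF assms(1,2) schwartz_space_cmult[OF assms(3)]]
        schwartz_operator_cmult[OF assms(1,3)])
  then show ?thesis by simp
qed

lemma schwartz_operator_comp:
  assumes "schwartz_operator L" "schwartz_operator M"
  shows "schwartz_operator (\<lambda>\<phi>. L (M \<phi>))"
proof -
  have "\<exists>C\<ge>0. \<exists>m'. \<forall>\<phi>\<in>schwartz_space. schwartz_norm m (L (M \<phi>)) \<le> C * schwartz_norm m' \<phi>" for m
  proof -
    obtain C m1 where C: "0 \<le> C"
      "\<And>\<phi>. \<phi> \<in> schwartz_space \<Longrightarrow> schwartz_norm m (L \<phi>) \<le> C * schwartz_norm m1 \<phi>"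
      using schwartz_operator_bound[OF assms(1)] by blast
    obtain D m2 where D: "0 \<le> D"
      "\<And>\<phi>. \<phi> \<in> schwartz_space \<Longrightarrow> schwartz_norm m1 (M \<phi>) \<le> D * schwartz_norm m2 \<phi>"
      using schwartz_operator_bound[OF assms(2)] by blast
    have "schwartz_norm m (L (M \<phi>)) \<le> (C * D) * schwartz_norm m2 \<phi>" if "\<phi> \<in> schwartz_space" for \<phi>
      using C(2)[OF schwartz_operator_closed[OF assms(2) that]] mult_left_mono[OF D(2)[OF that] C(1)]
      by (simp add: mult.assoc)
    then show ?thesis using C(1) D(1) by (intro exI[of _ "C * D"]) auto
  qed
  then show ?thesis
    using assms unfolding schwartz_operator_def[of "\<lambda>\<phi>. L (M \<phi>)"]
    by (simp add: schwartz_operator_add schwartz_operator_cmult schwartz_operator_closed)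
qed

lemma schwartz_operatorI:
  fixes L :: "(real^'n::finite \<Rightarrow> complex) \<Rightarrow> (real^'n \<Rightarrow> complex)"
  assumes add: "\<And>\<phi> \<psi>. \<phi> \<in> schwartz_space \<Longrightarrow> \<psi> \<in> schwartz_space \<Longrightarrow> L (\<lambda>x. \<phi> x + \<psi> x) = (\<lambda>x. L \<phi> x + L \<psi> x)"
    and cmult: "\<And>c \<phi>. \<phi> \<in> schwartz_space \<Longrightarrow> L (\<lambda>x. c * \<phi> x) = (\<lambda>x. c * L \<phi> x)"
    and smooth: "\<And>\<phi>. \<phi> \<in> schwartz_space \<Longrightarrow> smooth (L \<phi>)"
    and bound: "\<And>k js. \<exists>C\<ge>0. \<exists>m. \<forall>\<phi>\<in>schwartz_space. \<forall>x.
      (1 + norm x) ^ k * norm (iter_deriv js (L \<phi>) x) \<le> C * schwartz_norm m \<phi>"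
  shows "schwartz_operator L"
proof -
  have S: "L \<phi> \<in> schwartz_space" if "\<phi> \<in> schwartz_space" for \<phi>
  proof (rule schwartz_spaceI[OF smooth[OF that]])
    fix k js
    show "\<exists>C. \<forall>x. (1 + norm x) ^ k * norm (iter_deriv js (L \<phi>) x) \<le> C"
      using bound[of k js] that by blast
  qed
  have "\<exists>C\<ge>0. \<exists>m'. \<forall>\<phi>\<in>schwartz_space. schwartz_norm m (L \<phi>) \<le> C * schwartz_norm m' \<phi>" for m
  proof -
    let ?I = "{..m} \<times> {js :: 'n list. length js \<le> m}"
    have fin: "finite ?I" by (intro finite_cartesian_product finite_words finite_atMost)
    obtain C M where CM: "\<And>k (js :: 'n list). 0 \<le> C k js" "\<And>k js \<phi> x. \<phi> \<in> schwartz_space \<Longrightarrow>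
        (1 + norm x) ^ k * norm (iter_deriv js (L \<phi>) x) \<le> C k js * schwartz_norm (M k js) \<phi>"
      using bound by metis
    define m' where "m' = Max ((\<lambda>(k, js :: 'n list). M k js) ` ?I)"
    have m': "M k js \<le> m'" if "(k, js) \<in> ?I" for k and js :: "'n list"
      unfolding m'_def using fin that by (intro Max_ge) (auto intro!: image_eqI[of _ _ "(k, js)"])
    have "schwartz_norm m (L \<phi>) \<le> (\<Sum>(k, js)\<in>?I. C k (js :: 'n list)) * schwartz_norm m' \<phi>"
      if \<phi>: "\<phi> \<in> schwartz_space" for \<phi>
    proof -
      have "schwartz_norm m (L \<phi>) \<le> (\<Sum>(k, js)\<in>?I. C k (js :: 'n list) * schwartz_norm m' \<phi>)"
        unfolding schwartz_norm_def[of m "L \<phi>"]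
      proof (rule sum_mono, clarsimp)
        fix k and js :: "'n list" assume "k \<le> m" "length js \<le> m"
        then have "C k js * schwartz_norm (M k js) \<phi> \<le> C k js * schwartz_norm m' \<phi>"
          by (intro mult_left_mono schwartz_norm_mono[OF \<phi>] m' CM(1)) auto
        then show "schwartz_seminorm k js (L \<phi>) \<le> C k js * schwartz_norm m' \<phi>"
          using CM(2)[OF \<phi>] by (intro schwartz_seminorm_least) (meson order_trans)
      qed
      then show ?thesis by (simp add: sum_distrib_right case_prod_unfold)
    qed
    then show ?thesis
      using CM(1) by (intro exI[of _ "\<Sum>(k, js)\<in>?I. C k (js :: 'n list)"]) (auto intro!: sum_nonneg)
  qed
  then show ?thesis using S add cmult by (simp add: schwartz_operator_def)
qed

lemma schwartz_operator_continuous: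
  fixes L :: "(real^'n::finite \<Rightarrow> complex) \<Rightarrow> (real^'n \<Rightarrow> complex)"
  assumes L: "schwartz_operator L"
  shows "continuous_map schwartz_topology schwartz_topology L"
proof (subst (2) schwartz_topology_def, rule continuous_on_generated_topo)
  fix U assume "U \<in> {{\<psi> \<in> schwartz_space. schwartz_seminorm k js (\<lambda>x. \<psi> x - \<phi> x) < \<epsilon>} | k js \<phi> \<epsilon>.
        \<phi> \<in> (schwartz_space :: (real^'n \<Rightarrow> complex) set) \<and> \<epsilon> > 0}"
  then obtain k and js :: "'n list" and \<phi> \<epsilon> where U: "U = {\<psi> \<in> schwartz_space. schwartz_seminorm k js (\<lambda>x. \<psi> x - \<phi> x) < \<epsilon>}"
    and \<phi>: "\<phi> \<in> schwartz_space" and "0 < \<epsilon>" by blast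
  \<comment> \<open>the smallest index whose norm dominates the seminorm that defines \<open>U\<close>\<close>
  define m where "m = max k (length js)"
  obtain C m' where C: "0 \<le> C"
      "\<And>\<phi>. \<phi> \<in> schwartz_space \<Longrightarrow> schwartz_norm m (L \<phi>) \<le> C * schwartz_norm m' \<phi>"
    using schwartz_operator_bound[OF L] by blast
  show "openin schwartz_topology (L -` U \<inter> topspace schwartz_topology)"
  proof (rule openin_schwartz_topologyI)
    fix \<psi> assume "\<psi> \<in> L -` U \<inter> topspace schwartz_topology"
    then have \<psi>: "\<psi> \<in> schwartz_space" "schwartz_seminorm k js (\<lambda>x. L \<psi> x - \<phi> x) < \<epsilon>"
      by (auto simp: U)
    define \<delta> where "\<delta> = (\<epsilon> - schwartz_seminorm k js (\<lambda>x. L \<psi> x - \<phi> x)) / (C + 1)"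
    have \<delta>: "0 < \<delta>" using \<psi>(2) C(1) by (simp add: \<delta>_def)
    have "\<eta> \<in> L -` U \<inter> topspace schwartz_topology"
      if \<eta>: "\<eta> \<in> schwartz_space" and less: "schwartz_norm m' (\<lambda>x. \<eta> x - \<psi> x) < \<delta>" for \<eta>
    proof -
      note cl = schwartz_operator_closed[OF L]
      note d = schwartz_space_diff[OF \<eta> \<psi>(1)]
      have "schwartz_seminorm k js (\<lambda>x. L \<eta> x - L \<psi> x) \<le> schwartz_norm m (\<lambda>x. L \<eta> x - L \<psi> x)"
        by (intro schwartz_seminorm_least schwartz_norm_upper schwartz_space_diff cl \<eta> \<psi>) (auto simp: m_def)
      also have "\<dots> = schwartz_norm m (L (\<lambda>x. \<eta> x - \<psi> x))"
        using schwartz_operator_diff[OF L \<eta> \<psi>(1)] by simp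
      also have "\<dots> \<le> C * schwartz_norm m' (\<lambda>x. \<eta> x - \<psi> x)" by (rule C(2)[OF d])
      also have "\<dots> \<le> C * \<delta>" using less C(1) by (intro mult_left_mono) auto
      also have "\<dots> < (C + 1) * \<delta>" using \<delta> by (simp add: algebra_simps)
      also have "\<dots> = \<epsilon> - schwartz_seminorm k js (\<lambda>x. L \<psi> x - \<phi> x)"
        using C(1) by (simp add: \<delta>_def)
      finally have "schwartz_seminorm k js (\<lambda>x. L \<eta> x - \<phi> x) < \<epsilon>"
        using schwartz_seminorm_triangle[OF cl[OF \<eta>] cl[OF \<psi>(1)] \<phi>, of k js] by linarith
      then show ?thesis using \<eta> cl by (simp add: U)
    qed
    with \<delta> show "\<exists>m \<epsilon>. 0 < \<epsilon> \<and> (\<forall>\<eta>\<in>schwartz_space. schwartz_norm m (\<lambda>x. \<eta> x - \<psi> x) < \<epsilon>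
        \<longrightarrow> \<eta> \<in> L -` U \<inter> topspace schwartz_topology)" by blast
  qed simp
next
  have "\<Union> {{\<psi> \<in> schwartz_space. schwartz_seminorm k js (\<lambda>x. \<psi> x - \<phi> x) < \<epsilon>} | k js \<phi> \<epsilon>.
        \<phi> \<in> (schwartz_space :: (real^'n \<Rightarrow> complex) set) \<and> \<epsilon> > 0} = schwartz_space"
    using topspace_schwartz_topology[where 'a='n] unfolding schwartz_topology_def by simp
  then show "L ` topspace schwartz_topology \<subseteq> \<Union> {{\<psi> \<in> schwartz_space.
      schwartz_seminorm k js (\<lambda>x. \<psi> x - \<phi> x) < \<epsilon>} | k js \<phi> \<epsilon>.
        \<phi> \<in> (schwartz_space :: (real^'n \<Rightarrow> complex) set) \<and> \<epsilon> > 0}"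
    using schwartz_operator_closed[OF L] by auto
qed

text \<open>Operators act on distributions by duality: multiplication by a function and the Fourier transform
  on distributions are both of this form.\<close>

lemma tempered_distribution_transpose:
  fixes T :: "('n::finite) functional"
  assumes T: "T \<in> tempered_distributions" and L: "schwartz_operator L"
  shows "(\<lambda>\<phi>\<in>schwartz_space. T (L \<phi>)) \<in> tempered_distributions"
proof -
  have "continuous_map schwartz_topology euclidean (T \<circ> L)"
    using T by (intro continuous_map_compose[OF schwartz_operator_continuous[OF L]])
      (simp add: tempered_distributions_def)
  then have "continuous_map schwartz_topology euclidean (\<lambda>\<phi>\<in>schwartz_space. T (L \<phi>))"
    by (rule continuous_map_eq) simp
  then show ?thesis
    using T schwartz_operator_closed[OF L] schwartz_operator_add[OF L] schwartz_operator_cmult[OF L]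
    unfolding tempered_distributions_def by (simp add: schwartz_space_add schwartz_space_cmult)
qed

lemma tempered_distributionI:
  fixes T :: "('n::finite) functional"
  assumes ext: "T \<in> extensional schwartz_space"
    and add: "\<And>\<phi> \<psi>. \<phi> \<in> schwartz_space \<Longrightarrow> \<psi> \<in> schwartz_space \<Longrightarrow> T (\<lambda>x. \<phi> x + \<psi> x) = T \<phi> + T \<psi>"
    and cmult: "\<And>c \<phi>. \<phi> \<in> schwartz_space \<Longrightarrow> T (\<lambda>x. c * \<phi> x) = c * T \<phi>"
    and C: "0 \<le> C" and bound: "\<And>\<phi>. \<phi> \<in> schwartz_space \<Longrightarrow> norm (T \<phi>) \<le> C * schwartz_norm m \<phi>"
  shows "T \<in> tempered_distributions"
proof -
  have diff: "T (\<lambda>x. \<phi> x - \<psi> x) = T \<phi> - T \<psi>" if "\<phi> \<in> schwartz_space" "\<psi> \<in> schwartz_space" for \<phi> \<psi>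
  proof -
    have "T (\<lambda>x. \<phi> x + (-1) * \<psi> x) = T \<phi> + (-1) * T \<psi>"
      by (simp only: add[OF that(1) schwartz_space_cmult[OF that(2)]] cmult[OF that(2)])
    then show ?thesis by simp
  qed
  have "continuous_map schwartz_topology euclidean T"
  proof (subst continuous_map, intro conjI allI impI)
    fix U :: "complex set" assume "openin euclidean U"
    then have U: "open U" by simp
    show "openin schwartz_topology {\<phi> \<in> topspace schwartz_topology. T \<phi> \<in> U}"
    proof (rule openin_schwartz_topologyI)
      fix \<phi> assume "\<phi> \<in> {\<phi> \<in> topspace schwartz_topology. T \<phi> \<in> U}"
      then have \<phi>: "\<phi> \<in> schwartz_space" "T \<phi> \<in> U" by auto
      then obtain e where e: "0 < e" "ball (T \<phi>) e \<subseteq> U" using U openE by blast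
      have "T \<psi> \<in> U" if \<psi>: "\<psi> \<in> schwartz_space" and less: "schwartz_norm m (\<lambda>x. \<psi> x - \<phi> x) < e / (C + 1)" for \<psi>
      proof -
        have "norm (T \<psi> - T \<phi>) \<le> C * schwartz_norm m (\<lambda>x. \<psi> x - \<phi> x)"
          using bound[OF schwartz_space_diff[OF \<psi> \<phi>(1)]] by (simp add: diff \<psi> \<phi>)
        also have "\<dots> \<le> C * (e / (C + 1))" using less C by (intro mult_left_mono) auto
        also have "\<dots> < (C + 1) * (e / (C + 1))" using C e(1) by (intro mult_strict_right_mono) auto
        also have "\<dots> = e" using C by simp
        finally have "T \<psi> \<in> ball (T \<phi>) e" by (simp add: dist_norm norm_minus_commute)
        then show ?thesis using e(2) by blast
      qed
      then show "\<exists>m \<epsilon>. 0 < \<epsilon> \<and> (\<forall>\<psi>\<in>schwartz_space. schwartz_norm m (\<lambda>x. \<psi> x - \<phi> x) < \<epsilon>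
          \<longrightarrow> \<psi> \<in> {\<phi> \<in> topspace schwartz_topology. T \<phi> \<in> U})"
        using e(1) C by (intro exI[of _ m] exI[of _ "e / (C + 1)"]) auto
    qed simp
  qed simp
  then show ?thesis
    using ext add cmult by (simp add: tempered_distributions_def)
qed

section \<open>Slowly increasing multipliers\<close>

definition polynomially_bounded :: "(real^'n \<Rightarrow> complex) \<Rightarrow> bool" where
  "polynomially_bounded f \<longleftrightarrow> (\<exists>C\<ge>0. \<exists>k. \<forall>x. norm (f x) \<le> C * (1 + norm x) ^ k)"

lemma polynomially_boundedI: "(\<And>x. norm (f x) \<le> C * (1 + norm x) ^ k) \<Longrightarrow> polynomially_bounded f"
  unfolding polynomially_bounded_def
  by (intro exI[of _ "\<bar>C\<bar>"] conjI exI[of _ k] allI order_trans[OF _ mult_right_mono[OF abs_ge_self]])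
    auto

lemma polynomially_bounded_const: "polynomially_bounded (\<lambda>x. c)"
  by (rule polynomially_boundedI[of _ "norm c" 0]) simp

lemma polynomially_bounded_add:
  assumes "polynomially_bounded f" "polynomially_bounded g"
  shows "polynomially_bounded (\<lambda>x. f x + g x)"
proof -
  obtain C k where C: "0 \<le> C" "\<And>x. norm (f x) \<le> C * (1 + norm x) ^ k"
    using assms(1) unfolding polynomially_bounded_def by blast
  obtain D l where D: "0 \<le> D" "\<And>x. norm (g x) \<le> D * (1 + norm x) ^ l"
    using assms(2) unfolding polynomially_bounded_def by blast
  have "norm (f x + g x) \<le> (C + D) * (1 + norm x) ^ max k l" for x
  proof -
    have "C * (1 + norm x) ^ k \<le> C * (1 + norm x) ^ max k l"
      "D * (1 + norm x) ^ l \<le> D * (1 + norm x) ^ max k l"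
      using C(1) D(1) by (auto intro!: mult_left_mono power_increasing)
    then show ?thesis using C(2)[of x] D(2)[of x] norm_triangle_ineq[of "f x" "g x"]
      by (simp add: distrib_right)
  qed
  then show ?thesis by (rule polynomially_boundedI)
qed

lemma polynomially_bounded_mult:
  assumes "polynomially_bounded f" "polynomially_bounded g"
  shows "polynomially_bounded (\<lambda>x. f x * g x)"
proof -
  obtain C k where C: "0 \<le> C" "\<And>x. norm (f x) \<le> C * (1 + norm x) ^ k"
    using assms(1) unfolding polynomially_bounded_def by blast
  obtain D l where D: "0 \<le> D" "\<And>x. norm (g x) \<le> D * (1 + norm x) ^ l"
    using assms(2) unfolding polynomially_bounded_def by blast
  have "norm (f x * g x) \<le> (C * D) * (1 + norm x) ^ (k + l)" for x
    using mult_mono[OF C(2)[of x] D(2)[of x]] C(1) by (simp add: norm_mult power_add mult_ac)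
  then show ?thesis by (rule polynomially_boundedI)
qed

definition slowly_increasing :: "(real^'n \<Rightarrow> complex) \<Rightarrow> bool" where
  "slowly_increasing a \<longleftrightarrow> smooth a \<and> (\<forall>js. polynomially_bounded (iter_deriv js a))"

text \<open>By the product rule each derivative of \<open>a \<phi>\<close> is a finite sum of products, and the polynomial growth
  of the factor that falls on \<open>a\<close> is absorbed by a higher power of \<open>1 + \<bar>x\<bar>\<close> in the norm of \<open>\<phi>\<close>.\<close>

lemma schwartz_operator_mult:
  fixes a :: "real^'n::finite \<Rightarrow> complex"
  assumes a: "slowly_increasing a"
  shows "schwartz_operator (\<lambda>\<phi> x. a x * \<phi> x)"
proof (rule schwartz_operatorI)
  have sm: "smooth a" using a by (simp add: slowly_increasing_def)
  show "smooth (\<lambda>x. a x * \<phi> x)" if "\<phi> \<in> schwartz_space" for \<phi>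
    by (intro smooth_mult sm schwartz_space_smooth that)
  fix k and js :: "'n list"
  obtain ps where ps: "\<forall>\<phi> \<psi> :: real^'n \<Rightarrow> complex. smooth \<phi> \<longrightarrow> smooth \<psi> \<longrightarrow>
      iter_deriv js (\<lambda>x. \<phi> x * \<psi> x) = (\<lambda>x. \<Sum>p\<leftarrow>ps. iter_deriv (fst p) \<phi> x * iter_deriv (snd p) \<psi> x)"
    using iter_deriv_mult[of js] ..
  have "\<exists>C\<ge>0. \<exists>m. \<forall>\<phi>\<in>schwartz_space. \<forall>x. (1 + norm x) ^ k *
      norm (\<Sum>p\<leftarrow>qs. iter_deriv (fst p) a x * iter_deriv (snd p) \<phi> x) \<le> C * schwartz_norm m \<phi>"
    for qs :: "('n list \<times> 'n list) list"
  proof (induction qs)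
    case Nil
    show ?case by (rule exI[of _ 0]) simp
  next
    case (Cons q qs)
    then obtain C m where C: "0 \<le> C" "\<And>\<phi> x. \<phi> \<in> schwartz_space \<Longrightarrow> (1 + norm x) ^ k *
      norm (\<Sum>p\<leftarrow>qs. iter_deriv (fst p) a x * iter_deriv (snd p) \<phi> x) \<le> C * schwartz_norm m \<phi>"
      by blast
    obtain D l where D: "0 \<le> D" "\<And>x. norm (iter_deriv (fst q) a x) \<le> D * (1 + norm x) ^ l"
      using a unfolding slowly_increasing_def polynomially_bounded_def by blast
    define M where "M = max m (max (k + l) (length (snd q)))"
    have "(1 + norm x) ^ k * norm (\<Sum>p\<leftarrow>q # qs. iter_deriv (fst p) a x * iter_deriv (snd p) \<phi> x)
        \<le> (D + C) * schwartz_norm M \<phi>" if \<phi>: "\<phi> \<in> schwartz_space" for \<phi> x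
    proof -
      let ?s = "\<Sum>p\<leftarrow>qs. iter_deriv (fst p) a x * iter_deriv (snd p) \<phi> x"
      let ?d = "norm (iter_deriv (snd q) \<phi> x)"
      have "norm (iter_deriv (fst q) a x * iter_deriv (snd q) \<phi> x + ?s)
          \<le> D * (1 + norm x) ^ l * ?d + norm ?s"
        using norm_triangle_ineq[of "iter_deriv (fst q) a x * iter_deriv (snd q) \<phi> x" ?s]
          mult_right_mono[OF D(2)[of x], of ?d]
        by (simp add: norm_mult)
      then have "(1 + norm x) ^ k * norm (iter_deriv (fst q) a x * iter_deriv (snd q) \<phi> x + ?s)
          \<le> (1 + norm x) ^ k * (D * (1 + norm x) ^ l * ?d + norm ?s)"
        by (intro mult_left_mono) auto
      also have "\<dots> = D * ((1 + norm x) ^ (k + l) * ?d) + (1 + norm x) ^ k * norm ?s"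
        by (simp add: algebra_simps power_add)
      also have "\<dots> \<le> D * schwartz_norm M \<phi> + C * schwartz_norm M \<phi>"
      proof (intro add_mono mult_left_mono)
        show "(1 + norm x) ^ (k + l) * ?d \<le> schwartz_norm M \<phi>"
          by (rule schwartz_norm_upper[OF \<phi>]) (auto simp: M_def)
        have "C * schwartz_norm m \<phi> \<le> C * schwartz_norm M \<phi>"
          by (intro mult_left_mono schwartz_norm_mono \<phi> C) (simp add: M_def)
        with C(2)[OF \<phi>, of x] show "(1 + norm x) ^ k * norm ?s \<le> C * schwartz_norm M \<phi>" by linarith
      qed (rule D)
      finally show ?thesis by (simp add: algebra_simps)
    qed
    with C(1) D(1) show ?case by (intro exI[of _ "D + C"] conjI exI[of _ M]) auto
  qed
  from this[of ps] show "\<exists>C\<ge>0. \<exists>m. \<forall>\<phi>\<in>schwartz_space. \<forall>x.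
      (1 + norm x) ^ k * norm (iter_deriv js (\<lambda>x. a x * \<phi> x) x) \<le> C * schwartz_norm m \<phi>"
    using ps sm by (simp add: schwartz_space_smooth)
qed (simp_all add: algebra_simps)

lemma slowly_increasingI:
  assumes "a \<in> A" and "\<And>\<psi> i. \<psi> \<in> A \<Longrightarrow> partial_deriv i \<psi> \<in> A"
    and "\<And>\<psi> x. \<psi> \<in> A \<Longrightarrow> \<psi> differentiable (at x)"
    and "\<And>\<psi>. \<psi> \<in> A \<Longrightarrow> polynomially_bounded \<psi>"
  shows "slowly_increasing a"
  unfolding slowly_increasing_def
  by (intro conjI allI derivation_closed_smooth[of a A] assms(4) derivation_closed_iter_deriv[of a A] assms(1-3))

subsection \<open>The symbol and its reciprocal\<close>

definition quad_symbol :: "real \<Rightarrow> real^'n \<Rightarrow> real" where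
  "quad_symbol lam \<xi> = lam + 4 * pi\<^sup>2 * (norm \<xi>)\<^sup>2"

lemma quad_symbol_ge: "lam \<le> quad_symbol lam \<xi>"
  by (simp add: quad_symbol_def)

lemma quad_symbol_derivative:
  "(quad_symbol lam has_derivative (\<lambda>h. 8 * pi\<^sup>2 * (x \<bullet> h))) (at x)"
proof -
  have "((\<lambda>x. lam + 4 * pi\<^sup>2 * (x \<bullet> x)) has_derivative (\<lambda>h. 8 * pi\<^sup>2 * (x \<bullet> h))) (at x)"
    by (auto intro!: derivative_eq_intros simp: inner_commute)
  then show ?thesis by (simp add: quad_symbol_def [abs_def] power2_norm_eq_inner)
qed

lemma has_derivative_of_real_comp:
  fixes g :: "'a::real_normed_vector \<Rightarrow> real"
  assumes "(g has_derivative D) (at x)"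
  shows "((\<lambda>x. complex_of_real (g x)) has_derivative (\<lambda>h. complex_of_real (D h))) (at x)"
  using has_derivative_of_real[OF assms] .

text \<open>A class of functions that contains the symbol and its reciprocal and is visibly closed under
  partial derivatives; each of its generators has polynomial growth.\<close>

inductive_set symbol_class :: "real \<Rightarrow> (real^'n \<Rightarrow> complex) set" for lam :: real where
  const: "(\<lambda>x. c) \<in> symbol_class lam"
| coord: "(\<lambda>x. complex_of_real (x $ i)) \<in> symbol_class lam"
| power: "(\<lambda>x. complex_of_real (quad_symbol lam x powr r)) \<in> symbol_class lam"
| log: "(\<lambda>x. complex_of_real (ln (quad_symbol lam x))) \<in> symbol_class lam"
| inverse_log: "(\<lambda>x. complex_of_real (inverse (ln (quad_symbol lam x)))) \<in> symbol_class lam"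
| add: "a \<in> symbol_class lam \<Longrightarrow> b \<in> symbol_class lam \<Longrightarrow> (\<lambda>x. a x + b x) \<in> symbol_class lam"
| mult: "a \<in> symbol_class lam \<Longrightarrow> b \<in> symbol_class lam \<Longrightarrow> (\<lambda>x. a x * b x) \<in> symbol_class lam"

lemma symbol_class_radial_deriv:
  fixes g' :: "real^'n \<Rightarrow> real"
  assumes "(\<lambda>x. complex_of_real (g' x)) \<in> symbol_class lam"
  shows "(\<lambda>x. complex_of_real (g' x * (8 * pi\<^sup>2 * (x \<bullet> axis i 1)))) \<in> symbol_class lam"
proof -
  have "(\<lambda>x. complex_of_real (g' x * (8 * pi\<^sup>2 * (x \<bullet> axis i 1))))
      = (\<lambda>x. complex_of_real (g' x) * (complex_of_real (8 * pi\<^sup>2) * complex_of_real (x $ i)))"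
    by (simp add: inner_axis)
  then show ?thesis by (simp only:) (intro symbol_class.intros assms)
qed

lemma symbol_class_closed:
  fixes a :: "real^'n::finite \<Rightarrow> complex"
  assumes "a \<in> symbol_class lam" and lam: "1 < lam"
  shows "(\<forall>x. a differentiable (at x)) \<and> (\<forall>i. partial_deriv i a \<in> symbol_class lam)
    \<and> polynomially_bounded a"
  using assms(1)
proof induction
  note w1 = less_le_trans[OF lam quad_symbol_ge]
  {
    (* the chain rule, shared by the three generators that are functions of the quadratic symbol *)
    fix g g' :: "real \<Rightarrow> real"
    assume g: "\<And>t. 1 < t \<Longrightarrow> (g has_real_derivative g' t) (at t)"
      and g': "(\<lambda>x :: real^'n. complex_of_real (g' (quad_symbol lam x))) \<in> symbol_class lam"
    have D: "((\<lambda>x. complex_of_real (g (quad_symbol lam x))) has_derivative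
        (\<lambda>h. complex_of_real (g' (quad_symbol lam x) * (8 * pi\<^sup>2 * (x \<bullet> h))))) (at x)" for x :: "real^'n"
      using has_derivative_of_real_comp[OF DERIV_compose_FDERIV[OF g[OF w1] quad_symbol_derivative]]
      by (simp add: mult_ac)
    have "partial_deriv i (\<lambda>x. complex_of_real (g (quad_symbol lam x)))
       = (\<lambda>x. complex_of_real (g' (quad_symbol lam x) * (8 * pi\<^sup>2 * (x \<bullet> axis i 1))))" for i :: 'n
      using partial_deriv_eqI[OF D] by blast
    then have "partial_deriv i (\<lambda>x. complex_of_real (g (quad_symbol lam x))) \<in> symbol_class lam" for i :: 'n
      using symbol_class_radial_deriv[OF g', of i] by simp
    with D have "(\<forall>x. (\<lambda>x. complex_of_real (g (quad_symbol lam x))) differentiable (at (x :: real^'n)))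
      \<and> (\<forall>i :: 'n. partial_deriv i (\<lambda>x. complex_of_real (g (quad_symbol lam x))) \<in> symbol_class lam)"
      by (auto simp: differentiable_def simp del: of_real_mult)
  } note radial = this
  have w_bound: "quad_symbol lam x \<le> (lam + 4 * pi\<^sup>2) * (1 + norm x)\<^sup>2" for x :: "real^'n"
    using lam by (simp add: quad_symbol_def power2_eq_square algebra_simps)
  {
    case (const c)
    then show ?case by (simp add: partial_deriv_const polynomially_bounded_const symbol_class.const)
  next
    case (coord i)
    have D: "((\<lambda>x. complex_of_real (x $ i)) has_derivative (\<lambda>h. complex_of_real (h $ i))) (at x)" for x :: "real^'n"
      by (intro has_derivative_of_real_comp bounded_linear_imp_has_derivative bounded_linear_vec_nth)
    have "partial_deriv j (\<lambda>x. complex_of_real (x $ i)) = (\<lambda>x. complex_of_real (axis j 1 $ i))" for j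
      using partial_deriv_eqI[OF D] by blast
    moreover have "norm (complex_of_real (x $ i)) \<le> 1 * (1 + norm x) ^ 1" for x :: "real^'n"
      using component_le_norm_cart[of x i] by simp
    then have "polynomially_bounded (\<lambda>x :: real^'n. complex_of_real (x $ i))"
      by (rule polynomially_boundedI)
    ultimately show ?case using D by (auto simp: differentiable_def intro: symbol_class.const)
  next
    case (power r)
    have "norm (complex_of_real (quad_symbol lam x powr r))
        \<le> (lam + 4 * pi\<^sup>2) ^ nat \<lceil>\<bar>r\<bar>\<rceil> * (1 + norm x) ^ (2 * nat \<lceil>\<bar>r\<bar>\<rceil>)" for x :: "real^'n"
    proof -
      have "quad_symbol lam x powr r \<le> quad_symbol lam x powr real (nat \<lceil>\<bar>r\<bar>\<rceil>)"
        using w1[of x] by (intro powr_mono) linarith+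
      also have "\<dots> = quad_symbol lam x ^ nat \<lceil>\<bar>r\<bar>\<rceil>" using w1[of x] by (intro powr_realpow) simp
      also have "\<dots> \<le> ((lam + 4 * pi\<^sup>2) * (1 + norm x)\<^sup>2) ^ nat \<lceil>\<bar>r\<bar>\<rceil>"
        using w1[of x] by (intro power_mono w_bound) auto
      finally show ?thesis by (simp add: power_mult_distrib power_mult)
    qed
    then have "polynomially_bounded (\<lambda>x :: real^'n. complex_of_real (quad_symbol lam x powr r))"
      by (rule polynomially_boundedI)
    moreover have "((\<lambda>t. t powr r) has_real_derivative r * t powr (r - 1)) (at t)" if "1 < t" for t :: real
      using that by (intro has_real_derivative_powr) simp
    moreover have "(\<lambda>x :: real^'n. complex_of_real (r * quad_symbol lam x powr (r - 1))) \<in> symbol_class lam"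
      using symbol_class.mult[OF symbol_class.const[of "complex_of_real r"] symbol_class.power[of lam "r - 1"]]
      by simp
    ultimately show ?case using radial[of "\<lambda>t. t powr r" "\<lambda>t. r * t powr (r - 1)"] by blast
  next
    case log
    have "norm (complex_of_real (ln (quad_symbol lam x))) \<le> (lam + 4 * pi\<^sup>2) * (1 + norm x) ^ 2" for x :: "real^'n"
      using w1[of x] ln_bound[of "quad_symbol lam x"] w_bound[of x] by simp
    then have "polynomially_bounded (\<lambda>x :: real^'n. complex_of_real (ln (quad_symbol lam x)))"
      by (rule polynomially_boundedI)
    moreover have "(ln has_real_derivative t powr - 1) (at t)" if "1 < t" for t :: real
      using that by (auto intro!: derivative_eq_intros simp: powr_minus_divide)
    ultimately show ?case using radial[of ln "\<lambda>t. t powr - 1"] symbol_class.power[of lam "- 1"] by blast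
  next
    case inverse_log
    have "norm (complex_of_real (inverse (ln (quad_symbol lam x)))) \<le> inverse (ln lam) * (1 + norm x) ^ 0"
      for x :: "real^'n"
    proof -
      have "0 < ln lam" "ln lam \<le> ln (quad_symbol lam x)"
        using lam quad_symbol_ge[of lam x] by auto
      then show ?thesis unfolding norm_of_real by (simp add: le_imp_inverse_le)
    qed
    then have "polynomially_bounded (\<lambda>x :: real^'n. complex_of_real (inverse (ln (quad_symbol lam x))))"
      by (rule polynomially_boundedI)
    moreover have "((\<lambda>t. inverse (ln t)) has_real_derivative
        - 1 * (t powr - 1 * (inverse (ln t) * inverse (ln t)))) (at t)" if "1 < t" for t :: real
      using that by (auto intro!: derivative_eq_intros simp: powr_minus_divide field_simps)
    moreover have "(\<lambda>x :: real^'n. complex_of_real (- 1 * (quad_symbol lam x powr - 1 *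
        (inverse (ln (quad_symbol lam x)) * inverse (ln (quad_symbol lam x)))))) \<in> symbol_class lam"
      unfolding of_real_mult by (intro symbol_class.intros)
    ultimately show ?case
      using radial[of "\<lambda>t. inverse (ln t)" "\<lambda>t. - 1 * (t powr - 1 * (inverse (ln t) * inverse (ln t)))"]
      by blast
  next
    case (add a b)
    then show ?case
      by (auto simp: partial_deriv_add intro!: differentiable_add polynomially_bounded_add symbol_class.add)
  next
    case (mult a b)
    then show ?case
      by (auto simp: partial_deriv_mult
          intro!: differentiable_mult polynomially_bounded_mult symbol_class.add symbol_class.mult)
  }
qed

lemma symbol_class_slowly_increasing:
  fixes a :: "real^'n::finite \<Rightarrow> complex"
  assumes "a \<in> symbol_class lam" "1 < lam"
  shows "slowly_increasing a"
  using symbol_class_closed[OF _ assms(2)]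
  by (intro slowly_increasingI[of a "symbol_class lam"] assms(1)) auto

lemma log_bessel_symbol_eq:
  "log_bessel_symbol s lam \<xi> = quad_symbol lam \<xi> powr s * ln (quad_symbol lam \<xi>)"
  by (simp add: log_bessel_symbol_def quad_symbol_def)

lemma log_bessel_symbol_pos:
  assumes "1 < lam"
  shows "0 < log_bessel_symbol s lam \<xi>"
  using less_le_trans[OF assms quad_symbol_ge[of lam \<xi>]] by (simp add: log_bessel_symbol_eq)

lemma slowly_increasing_log_bessel_symbol:
  assumes "1 < lam"
  shows "slowly_increasing (\<lambda>\<xi> :: real^'n::finite. complex_of_real (log_bessel_symbol s lam \<xi>))"
  unfolding log_bessel_symbol_eq of_real_mult
  by (intro symbol_class_slowly_increasing[OF _ assms] symbol_class.intros)

lemma slowly_increasing_inverse_log_bessel_symbol: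
  assumes "1 < lam"
  shows "slowly_increasing (\<lambda>\<xi> :: real^'n::finite. complex_of_real (inverse (log_bessel_symbol s lam \<xi>)))"
proof -
  have "inverse (log_bessel_symbol s lam \<xi>) = quad_symbol lam \<xi> powr - s * inverse (ln (quad_symbol lam \<xi>))"
    for \<xi> :: "real^'n"
    by (simp add: log_bessel_symbol_eq powr_minus)
  then show ?thesis
    unfolding of_real_mult[symmetric]
    by (simp only: of_real_mult) (intro symbol_class_slowly_increasing[OF _ assms] symbol_class.intros)
qed

subsection \<open>Gaussians are Schwartz functions\<close>

text \<open>This follows from \<open>1 + r \<le> e\<^sup>r\<close> and \<open>k r - r\<^sup>2 \<le> k\<^sup>2\<close>.\<close>

lemma power_times_gaussian_bounded:
  assumes "0 \<le> (r :: real)"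
  shows "(1 + r) ^ k * exp (- r\<^sup>2) \<le> exp ((real k)\<^sup>2)"
proof -
  have "(1 + r) ^ k \<le> exp r ^ k"
    using assms exp_ge_add_one_self[of r] by (intro power_mono) auto
  then have "(1 + r) ^ k * exp (- r\<^sup>2) \<le> exp r ^ k * exp (- r\<^sup>2)"
    by (intro mult_right_mono) auto
  also have "\<dots> = exp (real k * r - r\<^sup>2)"
    by (simp add: exp_of_nat_mult[symmetric] exp_diff exp_minus field_simps)
  also have "real k * r - r\<^sup>2 \<le> (real k)\<^sup>2"
  proof -
    have "0 \<le> (real k - r)\<^sup>2 + real k * r" using assms by auto
    then show ?thesis by (simp add: power2_eq_square algebra_simps)
  qed
  finally show ?thesis by simp
qed

text \<open>The products of such a Gaussian with the functions of \<open>symbol_class\<close> are closed under partial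
  derivatives.  The two centres serve different purposes in the uniqueness argument: the factor centred
  at the origin makes \<open>L\<^sup>p\<close> functions integrable, the one centred at \<open>y\<close> concentrates at \<open>y\<close> for large \<open>t\<close>.\<close>

lemma gaussian_schwartz:
  fixes y :: "real^'n::finite"
  assumes t: "0 \<le> t"
  shows "(\<lambda>x. complex_of_real (exp (- (norm x)\<^sup>2 - t * (norm (x - y))\<^sup>2))) \<in> schwartz_space"
proof -
  define g where "g x = complex_of_real (exp (- (norm x)\<^sup>2 - t * (norm (x - y))\<^sup>2))" for x
  define A where "A = {\<lambda>x. a x * g x | a. a \<in> symbol_class 2}"
  note cls = symbol_class_closed[of _ 2, simplified]
  have D: "(g has_derivative (\<lambda>h. complex_of_real (- 2 * (x \<bullet> h) - 2 * t * ((x - y) \<bullet> h)) * g x)) (at x)" for x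
  proof -
    have "((\<lambda>x. exp (- (x \<bullet> x) - t * ((x - y) \<bullet> (x - y)))) has_derivative
        (\<lambda>h. (- 2 * (x \<bullet> h) - 2 * t * ((x - y) \<bullet> h)) * exp (- (x \<bullet> x) - t * ((x - y) \<bullet> (x - y))))) (at x)"
      by (auto intro!: derivative_eq_intros simp: inner_commute algebra_simps)
    from has_derivative_of_real_comp[OF this] show ?thesis
      by (simp add: g_def [abs_def] power2_norm_eq_inner)
  qed
  have g_diff: "g differentiable (at x)" for x using D by (auto simp: differentiable_def)
  have g_part: "partial_deriv i g = (\<lambda>x. (complex_of_real (- 2 - 2 * t) * complex_of_real (x $ i)
      + complex_of_real (2 * t * y $ i)) * g x)" for i
    using partial_deriv_eqI[OF D] by (auto simp: inner_axis algebra_simps)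
  have closed: "partial_deriv i \<psi> \<in> A" if \<psi>: "\<psi> \<in> A" for \<psi> i
  proof -
    obtain a where a: "a \<in> symbol_class 2" "\<psi> = (\<lambda>x. a x * g x)" using \<psi> by (auto simp: A_def)
    let ?b = "\<lambda>x. partial_deriv i a x + a x * (complex_of_real (- 2 - 2 * t) * complex_of_real (x $ i)
      + complex_of_real (2 * t * y $ i))"
    have "?b \<in> symbol_class 2" using cls[OF a(1)] by (intro symbol_class.intros a(1)) auto
    moreover have "partial_deriv i \<psi> = (\<lambda>x. ?b x * g x)"
      using cls[OF a(1)] by (simp add: a(2) partial_deriv_mult g_diff g_part algebra_simps)
    ultimately show ?thesis unfolding A_def by (intro CollectI exI[of _ ?b] conjI)
  qed
  have diff: "\<psi> differentiable (at x)" if "\<psi> \<in> A" for \<psi> x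
    using that cls g_diff by (auto simp: A_def intro!: differentiable_mult)
  have gA: "g \<in> A"
    unfolding A_def by (intro CollectI exI[of _ "\<lambda>x. 1"] conjI symbol_class.const) simp
  have "g \<in> schwartz_space"
  proof (rule schwartz_spaceI)
    show "smooth g" using gA closed diff by (rule derivation_closed_smooth)
    fix k js
    have "iter_deriv js g \<in> A" using gA closed by (rule derivation_closed_iter_deriv)
    then obtain a where a: "a \<in> symbol_class 2" "iter_deriv js g = (\<lambda>x. a x * g x)" by (auto simp: A_def)
    then obtain C l where C: "0 \<le> C" "\<And>x. norm (a x) \<le> C * (1 + norm x) ^ l"
      using cls[OF a(1)] unfolding polynomially_bounded_def by blast
    have "(1 + norm x) ^ k * norm (iter_deriv js g x) \<le> C * exp ((real (k + l))\<^sup>2)" for x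
    proof -
      have g_le: "norm (g x) \<le> exp (- (norm x)\<^sup>2)" using t by (simp add: g_def)
      have "norm (a x * g x) \<le> (C * (1 + norm x) ^ l) * exp (- (norm x)\<^sup>2)"
        unfolding norm_mult using C g_le by (intro mult_mono) auto
      then have "(1 + norm x) ^ k * norm (a x * g x) \<le> (1 + norm x) ^ k * (C * (1 + norm x) ^ l * exp (- (norm x)\<^sup>2))"
        by (intro mult_left_mono) auto
      also have "\<dots> = C * ((1 + norm x) ^ (k + l) * exp (- (norm x)\<^sup>2))" by (simp add: power_add)
      also have "\<dots> \<le> C * exp ((real (k + l))\<^sup>2)"
        by (intro mult_left_mono power_times_gaussian_bounded C) auto
      finally show ?thesis by (simp add: a(2))
    qed
    then show "\<exists>C. \<forall>x. (1 + norm x) ^ k * norm (iter_deriv js g x) \<le> C" by blast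
  qed
  then show ?thesis by (simp add: g_def [abs_def])
qed

section \<open>Integrals over Euclidean space\<close>

lemma
  fixes f :: "'a::euclidean_space \<Rightarrow> real \<Rightarrow> 'b::{real_normed_field, banach, second_countable_topology}"
  assumes "\<And>b. b \<in> Basis \<Longrightarrow> integrable lborel (f b)"
  shows integrable_lborel_prod: "integrable lborel (\<lambda>x. \<Prod>b\<in>Basis. f b (x \<bullet> b))"
    and integral_lborel_prod: "(LINT x|lborel. (\<Prod>b\<in>Basis. f b (x \<bullet> b))) = (\<Prod>b\<in>Basis. LINT x|lborel. f b x)"
proof -
  interpret product_sigma_finite "\<lambda>_ :: 'a. lborel :: real measure" ..
  have [measurable]: "f b \<in> borel_measurable borel" if "b \<in> Basis" for b
    using assms[OF that] by (auto dest: borel_measurable_integrable)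
  show "integrable lborel (\<lambda>x. \<Prod>b\<in>Basis. f b (x \<bullet> b))"
    by (subst lborel_eq, subst integrable_distr_eq) (auto intro!: product_integrable_prod assms)
  have "(LINT x|lborel. (\<Prod>b\<in>Basis. f b (x \<bullet> b))) = (LINT x|Pi\<^sub>M Basis (\<lambda>_. lborel). (\<Prod>b\<in>Basis. f b (x b)))"
    by (subst lborel_eq, subst integral_distr) auto
  also have "\<dots> = (\<Prod>b\<in>Basis. LINT x|lborel. f b x)"
    by (intro product_integral_prod assms) auto
  finally show "(LINT x|lborel. (\<Prod>b\<in>Basis. f b (x \<bullet> b))) = (\<Prod>b\<in>Basis. LINT x|lborel. f b x)" .
qed

lemma
  fixes f :: "'a::euclidean_space \<Rightarrow> 'b::{banach, second_countable_topology}"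
  assumes [measurable]: "f \<in> borel_measurable borel" and c: "c \<noteq> 0"
  shows integrable_lborel_affine_iff: "integrable lborel (\<lambda>x. f (t + c *\<^sub>R x)) \<longleftrightarrow> integrable lborel f"
    and integral_lborel_affine: "(LINT x|lborel. f x) = \<bar>c\<bar> ^ DIM('a) *\<^sub>R (LINT x|lborel. f (t + c *\<^sub>R x))"
proof -
  show "integrable lborel (\<lambda>x. f (t + c *\<^sub>R x)) \<longleftrightarrow> integrable lborel f"
  proof -
    have "integrable lborel f \<longleftrightarrow> integrable lborel (\<lambda>x. \<bar>c\<bar> ^ DIM('a) *\<^sub>R f (t + c *\<^sub>R x))"
      by (subst lborel_affine[OF c, of t], subst integrable_density) (auto simp: integrable_distr_eq)
    moreover have "integrable lborel (\<lambda>x. f (t + c *\<^sub>R x))"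
      if "integrable lborel (\<lambda>x. \<bar>c\<bar> ^ DIM('a) *\<^sub>R f (t + c *\<^sub>R x))"
      using integrable_scaleR_right[OF that, of "inverse (\<bar>c\<bar> ^ DIM('a))"] c by simp
    ultimately show ?thesis by auto
  qed
  show "(LINT x|lborel. f x) = \<bar>c\<bar> ^ DIM('a) *\<^sub>R (LINT x|lborel. f (t + c *\<^sub>R x))"
    using c by (subst lborel_affine[OF c, of t], subst integral_density)
      (auto simp: integral_distr)
qed

lemma
  fixes f :: "'a::euclidean_space \<Rightarrow> 'b::{banach, second_countable_topology}"
  assumes "f \<in> borel_measurable borel"
  shows integrable_lborel_translation: "integrable lborel (\<lambda>x. f (t + x)) \<longleftrightarrow> integrable lborel f"
    and integral_lborel_translation: "(LINT x|lborel. f (t + x)) = (LINT x|lborel. f x)"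
    and integrable_lborel_reflection: "integrable lborel (\<lambda>x. f (t - x)) \<longleftrightarrow> integrable lborel f"
    and integral_lborel_reflection: "(LINT x|lborel. f (t - x)) = (LINT x|lborel. f x)"
  using integrable_lborel_affine_iff[OF assms, of 1 t] integral_lborel_affine[OF assms, of 1 t]
    integrable_lborel_affine_iff[OF assms, of "-1" t] integral_lborel_affine[OF assms, of "-1" t]
  by simp_all

lemma integrable_inverse_one_plus_square: "integrable lborel (\<lambda>x :: real. inverse (1 + x\<^sup>2))"
proof -
  have "set_integrable lborel (einterval (- \<infinity>) \<infinity>) (\<lambda>x. inverse (1 + x\<^sup>2))"
  proof (rule interval_integral_FTC_nonneg[where F = arctan and A = "- pi / 2" and B = "pi / 2"])
    show "((arctan \<circ> real_of_ereal) \<longlongrightarrow> - pi / 2) (at_right (- \<infinity>))"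
      using tendsto_arctan_at_bot unfolding ereal_tendsto_simps1 by simp
    show "((arctan \<circ> real_of_ereal) \<longlongrightarrow> pi / 2) (at_left \<infinity>)"
      using tendsto_arctan_at_top unfolding ereal_tendsto_simps1 by simp
    show "isCont (\<lambda>x :: real. inverse (1 + x\<^sup>2)) x" for x
      by (intro continuous_intros) (metis add_nonneg_pos zero_less_one zero_le_power2 add.commute less_irrefl)
  qed (auto intro!: derivative_eq_intros AE_I2)
  then show ?thesis by (simp add: set_integrable_def)
qed

text \<open>The integrand is dominated by a product of functions of one variable, since
  \<open>\<Prod> (1 + x\<^sub>b\<^sup>2) \<le> (1 + \<bar>x\<bar>)\<^sup>2\<^sup>d\<close>, where \<open>d\<close> is the dimension.\<close>

lemma integrable_one_plus_norm_powr:
  "integrable lborel (\<lambda>x :: 'a::euclidean_space. inverse ((1 + norm x) ^ (2 * DIM('a))))"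
proof (rule Bochner_Integration.integrable_bound)
  show "integrable lborel (\<lambda>x :: 'a. \<Prod>b\<in>Basis. inverse (1 + (x \<bullet> b)\<^sup>2))"
    by (rule integrable_lborel_prod) (rule integrable_inverse_one_plus_square)
  show "AE x :: 'a in lborel. norm (inverse ((1 + norm x) ^ (2 * DIM('a)))) \<le> norm (\<Prod>b\<in>Basis. inverse (1 + (x \<bullet> b)\<^sup>2))"
  proof (rule AE_I2)
    fix x :: 'a
    have "(\<Prod>b\<in>Basis. 1 + (x \<bullet> b)\<^sup>2) \<le> (\<Prod>b\<in>(Basis :: 'a set). (1 + norm x)\<^sup>2)"
    proof (rule prod_mono, safe)
      fix b :: 'a assume "b \<in> Basis"
      then have "\<bar>x \<bullet> b\<bar> \<le> norm x" by (rule Basis_le_norm)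
      then have "(x \<bullet> b)\<^sup>2 \<le> (norm x)\<^sup>2" by (simp add: abs_le_square_iff[symmetric])
      then show "1 + (x \<bullet> b)\<^sup>2 \<le> (1 + norm x)\<^sup>2"
        unfolding power2_sum by (simp add: add_increasing2)
    qed (auto intro: add_nonneg_nonneg)
    also have "\<dots> = (1 + norm x) ^ (2 * DIM('a))" by (simp add: power_mult)
    finally have le: "(\<Prod>b\<in>Basis. 1 + (x \<bullet> b)\<^sup>2) \<le> (1 + norm x) ^ (2 * DIM('a))" .
    have pos: "0 < (\<Prod>b\<in>Basis. 1 + (x \<bullet> b)\<^sup>2)" by (intro prod_pos) (auto intro: add_pos_nonneg)
    from le_imp_inverse_le[OF le pos]
    show "norm (inverse ((1 + norm x) ^ (2 * DIM('a)))) \<le> norm (\<Prod>b\<in>Basis. inverse (1 + (x \<bullet> b)\<^sup>2))"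
      using pos by (simp add: prod_inversef[symmetric])
  qed
qed measurable

subsection \<open>The Fourier transform of a Gaussian\<close>

definition fourier_char :: "'a::real_inner \<Rightarrow> 'a \<Rightarrow> complex" where
  "fourier_char x \<xi> = exp (- 2 * complex_of_real pi * \<i> * complex_of_real (x \<bullet> \<xi>))"

lemma fourier_char_iexp: "fourier_char x \<xi> = iexp (- 2 * pi * (x \<bullet> \<xi>))"
  by (simp add: fourier_char_def mult_ac)

lemma norm_fourier_char [simp]: "norm (fourier_char x \<xi>) = 1"
  unfolding fourier_char_iexp by (rule norm_exp_i_times)

lemma fourier_char_commute: "fourier_char x \<xi> = fourier_char \<xi> x"
  by (simp add: fourier_char_def inner_commute)

lemma fourier_char_add: "fourier_char (x + y) \<xi> = fourier_char x \<xi> * fourier_char y \<xi>"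
  by (simp add: fourier_char_def inner_add_left algebra_simps flip: exp_add)

lemma fourier_char_zero [simp]: "fourier_char 0 \<xi> = 1" "fourier_char x 0 = 1"
  by (simp_all add: fourier_char_def)

lemma fourier_char_measurable [measurable]:
  fixes f g :: "'b \<Rightarrow> 'a::euclidean_space"
  assumes [measurable]: "f \<in> borel_measurable M" "g \<in> borel_measurable M"
  shows "(\<lambda>x. fourier_char (f x) (g x)) \<in> borel_measurable M"
  unfolding fourier_char_iexp by measurable

text \<open>The characteristic function of the standard normal distribution after the change of variable
  \<open>x \<mapsto> c x\<close> with \<open>c\<^sup>2 = 2 \<alpha>\<close>.\<close>

lemma fourier_gaussian_1d:
  fixes \<alpha> v :: real
  assumes \<alpha>: "0 < \<alpha>"
  shows "integrable lborel (\<lambda>x :: real. complex_of_real (exp (- \<alpha> * x\<^sup>2)) * fourier_char x v)"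
    and "(LINT x|lborel. complex_of_real (exp (- \<alpha> * x\<^sup>2)) * fourier_char x v)
      = complex_of_real (sqrt (pi / \<alpha>) * exp (- pi\<^sup>2 * v\<^sup>2 / \<alpha>))"
proof -
  define c where "c = sqrt (2 * \<alpha>)"
  have c: "0 < c" "c\<^sup>2 = 2 * \<alpha>" using \<alpha> by (auto simp: c_def)
  define t where "t = - 2 * pi * v / c"
  let ?G = "\<lambda>x. complex_of_real (std_normal_density x) * iexp (t * x)"
  have int: "integrable lborel ?G"
    by (rule Bochner_Integration.integrable_bound[of _ std_normal_density])
      (auto simp: norm_mult)
  have val: "(LINT x|lborel. ?G x) = complex_of_real (exp (- t\<^sup>2 / 2))"
  proof -
    have "char std_normal_distribution t = (LINT x|lborel. ?G x)"
      unfolding char_def by (subst integral_density) (auto simp: scaleR_conv_of_real)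
    then show ?thesis by (simp add: char_std_normal_distribution)
  qed
  have eq: "complex_of_real (exp (- \<alpha> * x\<^sup>2)) * fourier_char x v
      = complex_of_real (sqrt (2 * pi)) * ?G (0 + c * x)" for x
  proof -
    have "(c * x)\<^sup>2 / 2 = \<alpha> * x\<^sup>2" using c by (simp add: power_mult_distrib)
    moreover have "t * (c * x) = - 2 * pi * (x \<bullet> v)" using c by (simp add: t_def)
    ultimately show ?thesis
      by (simp add: fourier_char_iexp std_normal_density_def del: of_real_mult)
  qed
  show "integrable lborel (\<lambda>x :: real. complex_of_real (exp (- \<alpha> * x\<^sup>2)) * fourier_char x v)"
    unfolding eq using c int by (intro integrable_mult_right lborel_integrable_real_affine) auto
  have "(LINT x|lborel. ?G x) = \<bar>c\<bar> *\<^sub>R (LINT x|lborel. ?G (0 + c * x))"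
    using c by (intro lborel_integral_real_affine) simp
  then have I: "(LINT x|lborel. ?G (0 + c * x)) = complex_of_real (exp (- t\<^sup>2 / 2) / c)"
    using c unfolding val by (simp only: scaleR_conv_of_real) (simp add: field_simps)
  have "sqrt (2 * pi) / c = sqrt (pi / \<alpha>)" using \<alpha> by (simp add: c_def real_sqrt_divide real_sqrt_mult)
  moreover have "- t\<^sup>2 / 2 = - pi\<^sup>2 * v\<^sup>2 / \<alpha>"
    using c \<alpha> by (simp add: t_def power_divide power_mult_distrib)
  ultimately have "sqrt (2 * pi) * (exp (- t\<^sup>2 / 2) / c) = sqrt (pi / \<alpha>) * exp (- pi\<^sup>2 * v\<^sup>2 / \<alpha>)"
    by (metis times_divide_eq_left times_divide_eq_right)
  then show "(LINT x|lborel. complex_of_real (exp (- \<alpha> * x\<^sup>2)) * fourier_char x v)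
      = complex_of_real (sqrt (pi / \<alpha>) * exp (- pi\<^sup>2 * v\<^sup>2 / \<alpha>))"
    unfolding eq integral_mult_right_zero I by (simp only: flip: of_real_mult)
qed

lemma norm_square_Basis: "(norm (x :: 'a::euclidean_space))\<^sup>2 = (\<Sum>b\<in>Basis. (x \<bullet> b)\<^sup>2)"
  unfolding power2_norm_eq_inner by (subst euclidean_inner) (simp add: power2_eq_square)

lemma
  fixes \<xi> :: "'a::euclidean_space"
  assumes \<alpha>: "0 < \<alpha>"
  shows integrable_fourier_gaussian:
      "integrable lborel (\<lambda>x. complex_of_real (exp (- \<alpha> * (norm x)\<^sup>2)) * fourier_char x \<xi>)"
    and fourier_gaussian: "(LINT x|lborel. complex_of_real (exp (- \<alpha> * (norm x)\<^sup>2)) * fourier_char x \<xi>)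
      = complex_of_real (sqrt (pi / \<alpha>) ^ DIM('a) * exp (- pi\<^sup>2 * (norm \<xi>)\<^sup>2 / \<alpha>))"
proof -
  have eq: "complex_of_real (exp (- \<alpha> * (norm x)\<^sup>2)) * fourier_char x \<xi>
    = (\<Prod>b\<in>Basis. complex_of_real (exp (- \<alpha> * (x \<bullet> b)\<^sup>2)) * fourier_char (x \<bullet> b) (\<xi> \<bullet> b))" for x :: 'a
  proof -
    have "fourier_char x \<xi> = (\<Prod>b\<in>Basis. fourier_char (x \<bullet> b) (\<xi> \<bullet> b))"
      by (simp add: fourier_char_def euclidean_inner[of x \<xi>] sum_distrib_left flip: exp_sum)
    then show ?thesis
      by (simp add: norm_square_Basis prod.distrib sum_distrib_left exp_sum flip: sum_negf)
  qed
  show "integrable lborel (\<lambda>x. complex_of_real (exp (- \<alpha> * (norm x)\<^sup>2)) * fourier_char x \<xi>)"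
    unfolding eq by (intro integrable_lborel_prod fourier_gaussian_1d \<alpha>)
  have "(LINT x|lborel. complex_of_real (exp (- \<alpha> * (norm x)\<^sup>2)) * fourier_char x \<xi>)
      = (\<Prod>b\<in>Basis. complex_of_real (sqrt (pi / \<alpha>) * exp (- pi\<^sup>2 * (\<xi> \<bullet> b)\<^sup>2 / \<alpha>)))"
    unfolding eq
    by (subst integral_lborel_prod, rule fourier_gaussian_1d(1)[OF \<alpha>]) (simp only: fourier_gaussian_1d(2)[OF \<alpha>])
  also have "\<dots> = complex_of_real (sqrt (pi / \<alpha>) ^ DIM('a) * exp (- pi\<^sup>2 * (norm \<xi>)\<^sup>2 / \<alpha>))"
    by (simp add: prod.distrib norm_square_Basis sum_distrib_left sum_divide_distrib exp_sum flip: sum_negf)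
  finally show "(LINT x|lborel. complex_of_real (exp (- \<alpha> * (norm x)\<^sup>2)) * fourier_char x \<xi>)
      = complex_of_real (sqrt (pi / \<alpha>) ^ DIM('a) * exp (- pi\<^sup>2 * (norm \<xi>)\<^sup>2 / \<alpha>))" .
qed

lemma
  assumes \<alpha>: "0 < \<alpha>"
  shows integrable_gaussian: "integrable lborel (\<lambda>x :: 'a::euclidean_space. exp (- \<alpha> * (norm x)\<^sup>2))"
    and integral_gaussian: "(LINT x :: 'a|lborel. exp (- \<alpha> * (norm x)\<^sup>2)) = sqrt (pi / \<alpha>) ^ DIM('a)"
proof -
  have "integrable lborel (\<lambda>x :: 'a. complex_of_real (exp (- \<alpha> * (norm x)\<^sup>2)))"
    using integrable_fourier_gaussian[OF \<alpha>, of "0 :: 'a"] by simp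
  then show "integrable lborel (\<lambda>x :: 'a. exp (- \<alpha> * (norm x)\<^sup>2))"
    by (simp only: complex_of_real_integrable_eq)
  have "complex_of_real (LINT x :: 'a|lborel. exp (- \<alpha> * (norm x)\<^sup>2)) = complex_of_real (sqrt (pi / \<alpha>) ^ DIM('a))"
    using fourier_gaussian[OF \<alpha>, of "0 :: 'a"] by (simp flip: integral_complex_of_real)
  then show "(LINT x :: 'a|lborel. exp (- \<alpha> * (norm x)\<^sup>2)) = sqrt (pi / \<alpha>) ^ DIM('a)"
    by (simp only: of_real_eq_iff)
qed

section \<open>The Fourier transform on the Schwartz space\<close>

lemma fourier_lborel:
  fixes \<phi> :: "real^'n \<Rightarrow> complex"
  assumes [measurable]: "\<phi> \<in> borel_measurable borel"
  shows "fourier \<phi> \<xi> = (LINT x|lborel. \<phi> x * fourier_char x \<xi>)"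
  unfolding fourier_def fourier_char_def[symmetric] by (subst integral_completion) auto

lemma schwartz_borel_measurable: "\<phi> \<in> schwartz_space \<Longrightarrow> \<phi> \<in> borel_measurable borel"
  by (intro smooth_borel_measurable schwartz_space_smooth)

lemma schwartz_norm_decay:
  fixes \<phi> :: "real^'n::finite \<Rightarrow> complex"
  assumes "\<phi> \<in> schwartz_space" "length js \<le> m"
  shows "norm (iter_deriv js \<phi> x) \<le> schwartz_norm m \<phi> * inverse ((1 + norm x) ^ m)"
proof -
  have pos: "0 < (1 + norm x) ^ m" by (simp add: add_pos_nonneg)
  show ?thesis
    using schwartz_norm_upper[OF assms(1) order_refl assms(2), of x] pos
    by (simp add: field_simps)
qed

lemma schwartz_moment_integrable:
  fixes \<phi> :: "real^'n::finite \<Rightarrow> complex"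
  assumes "\<phi> \<in> schwartz_space"
  shows "integrable lborel (\<lambda>x. (1 + norm x) ^ k * norm (\<phi> x))"
proof (rule Bochner_Integration.integrable_bound)
  let ?N = "2 * DIM(real^'n)"
  show "integrable lborel (\<lambda>x :: real^'n. schwartz_norm (k + ?N) \<phi> * inverse ((1 + norm x) ^ ?N))"
    by (intro integrable_mult_right integrable_one_plus_norm_powr)
  show "AE x in lborel. norm ((1 + norm x) ^ k * norm (\<phi> x))
      \<le> norm (schwartz_norm (k + ?N) \<phi> * inverse ((1 + norm x) ^ ?N))"
  proof (rule AE_I2)
    fix x :: "real^'n"
    have pos: "0 < 1 + norm x" by (simp add: add_pos_nonneg)
    have "(1 + norm x) ^ k * norm (\<phi> x)
        \<le> (1 + norm x) ^ k * (schwartz_norm (k + ?N) \<phi> * inverse ((1 + norm x) ^ (k + ?N)))"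
      using schwartz_norm_decay[OF assms, of "[]" "k + ?N" x] by (intro mult_left_mono) auto
    also have "\<dots> = schwartz_norm (k + ?N) \<phi> * inverse ((1 + norm x) ^ ?N)"
      using pos by (simp add: power_add field_simps)
    finally show "norm ((1 + norm x) ^ k * norm (\<phi> x))
      \<le> norm (schwartz_norm (k + ?N) \<phi> * inverse ((1 + norm x) ^ ?N))"
      using schwartz_norm_nonneg[OF assms, of "k + ?N"] by simp
  qed
  note [measurable] = schwartz_borel_measurable[OF assms]
  show "(\<lambda>x. (1 + norm x) ^ k * norm (\<phi> x)) \<in> borel_measurable lborel" by measurable
qed

lemma schwartz_integrable:
  fixes \<phi> :: "real^'n::finite \<Rightarrow> complex"
  assumes "\<phi> \<in> schwartz_space"
  shows "integrable lborel \<phi>"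
  using schwartz_moment_integrable[OF assms, of 0] schwartz_borel_measurable[OF assms]
  by (simp add: integrable_norm_iff)

lemma schwartz_norm_L1:
  obtains C m where "0 \<le> C" "\<And>\<phi> :: real^'n::finite \<Rightarrow> complex. \<phi> \<in> schwartz_space \<Longrightarrow>
      (LINT x|lborel. norm (\<phi> x)) \<le> C * schwartz_norm m \<phi>"
proof (rule that)
  let ?N = "2 * DIM(real^'n)"
  let ?I = "LINT x|lborel. inverse ((1 + norm (x :: real^'n)) ^ ?N)"
  show "0 \<le> ?I" by (intro integral_nonneg_AE AE_I2) (simp add: add_nonneg_nonneg)
  fix \<phi> :: "real^'n \<Rightarrow> complex" assume \<phi>: "\<phi> \<in> schwartz_space"
  have "(LINT x|lborel. norm (\<phi> x)) \<le> (LINT x|lborel. schwartz_norm ?N \<phi> * inverse ((1 + norm (x :: real^'n)) ^ ?N))"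
  proof (rule integral_mono)
    show "norm (\<phi> x) \<le> schwartz_norm ?N \<phi> * inverse ((1 + norm x) ^ ?N)" for x
      using schwartz_norm_decay[OF \<phi>, of "[]" ?N x] by simp
  qed (intro integrable_mult_right integrable_one_plus_norm_powr integrable_norm schwartz_integrable \<phi>)+
  then show "(LINT x|lborel. norm (\<phi> x)) \<le> ?I * schwartz_norm ?N \<phi>" by (simp add: mult.commute)
qed

lemma integrable_mult_fourier_char:
  fixes f :: "real^'n::finite \<Rightarrow> complex"
  assumes "integrable lborel f"
  shows "integrable lborel (\<lambda>x. f x * fourier_char x \<xi>)"
proof (rule Bochner_Integration.integrable_bound[OF assms])
  note [measurable] = borel_measurable_integrable[OF assms]
  show "(\<lambda>x. f x * fourier_char x \<xi>) \<in> borel_measurable lborel" by measurable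
qed (simp add: norm_mult)

lemma norm_fourier_le:
  fixes f :: "real^'n::finite \<Rightarrow> complex"
  assumes "integrable lborel f"
  shows "norm (fourier f \<xi>) \<le> (LINT x|lborel. norm (f x))"
proof -
  have "norm (LINT x|lborel. f x * fourier_char x \<xi>) \<le> (LINT x|lborel. norm (f x * fourier_char x \<xi>))"
    by (rule integral_norm_bound)
  then show ?thesis
    using borel_measurable_integrable[OF assms] by (simp add: fourier_lborel norm_mult)
qed

lemma fourier_add:
  fixes f g :: "real^'n::finite \<Rightarrow> complex"
  assumes "integrable lborel f" "integrable lborel g"
  shows "fourier (\<lambda>x. f x + g x) \<xi> = fourier f \<xi> + fourier g \<xi>"
  using assms[THEN borel_measurable_integrable] assms[THEN integrable_mult_fourier_char]
  by (simp add: fourier_lborel distrib_right)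

lemma fourier_cmult:
  fixes f :: "real^'n::finite \<Rightarrow> complex"
  assumes "integrable lborel f"
  shows "fourier (\<lambda>x. c * f x) \<xi> = c * fourier f \<xi>"
  using assms[THEN borel_measurable_integrable] by (simp add: fourier_lborel mult.assoc)

subsection \<open>Derivatives of the transform\<close>

lemma has_derivative_quadratic_remainder:
  fixes f :: "'a::real_normed_vector \<Rightarrow> 'b::real_normed_vector"
  assumes "bounded_linear D" and bound: "\<And>h. norm (f (x + h) - f x - D h) \<le> C * (norm h)\<^sup>2"
  shows "(f has_derivative D) (at x)"
  unfolding has_derivative_at
proof (intro conjI assms(1), rule Lim_null_comparison)
  show "\<forall>\<^sub>F h in at 0. norm (norm (f (x + h) - f x - D h) / norm h) \<le> C * norm h"
    using bound by (auto simp: eventually_at_filter field_simps power2_eq_square)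
  show "((\<lambda>h. C * norm h) \<longlongrightarrow> 0) (at 0)"
    by (rule tendsto_eq_intros | simp)+
qed

text \<open>The operator that corresponds to \<open>\<partial>\<^sub>i\<close> on the other side of the Fourier transform.\<close>

definition fourier_weight :: "'n \<Rightarrow> (real^'n \<Rightarrow> complex) \<Rightarrow> real^'n \<Rightarrow> complex" where
  "fourier_weight i \<phi> = (\<lambda>x. (- 2 * complex_of_real pi * \<i>) * complex_of_real (x $ i) * \<phi> x)"

lemma schwartz_operator_fourier_weight: "schwartz_operator (fourier_weight (i :: 'n::finite))"
proof -
  have "slowly_increasing (\<lambda>x :: real^'n. (- 2 * complex_of_real pi * \<i>) * complex_of_real (x $ i))"
    by (rule symbol_class_slowly_increasing[of _ 2])
      (intro symbol_class.mult symbol_class.const symbol_class.coord, simp)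
  from schwartz_operator_mult[OF this] show ?thesis
    unfolding fourier_weight_def [abs_def] .
qed

text \<open>Differentiation under the integral sign; the remainder is quadratic because
  \<open>\<bar>e\<^sup>i\<^sup>\<theta> - 1 - i\<theta>\<bar> \<le> \<theta>\<^sup>2 / 2\<close> and \<open>\<bar>x\<bar>\<^sup>2 \<phi>\<close> is integrable.\<close>

lemma fourier_has_derivative:
  fixes \<phi> :: "real^'n::finite \<Rightarrow> complex"
  assumes \<phi>: "\<phi> \<in> schwartz_space"
  defines "D \<equiv> \<lambda>\<xi> h. LINT x|lborel. (- 2 * complex_of_real pi * \<i>) * complex_of_real (x \<bullet> h) * (\<phi> x * fourier_char x \<xi>)"
  shows "(fourier \<phi> has_derivative D \<xi>) (at \<xi>)"
proof (rule has_derivative_quadratic_remainder)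
  note [measurable] = schwartz_borel_measurable[OF \<phi>]
  let ?k = "\<lambda>h x. (- 2 * complex_of_real pi * \<i>) * complex_of_real (x \<bullet> h) * (\<phi> x * fourier_char x \<xi>)"
  have nk: "norm (?k h x) \<le> 2 * pi * norm h * ((1 + norm x) ^ 1 * norm (\<phi> x))" for h x
  proof -
    have "\<bar>x \<bullet> h\<bar> \<le> (1 + norm x) * norm h"
      using Cauchy_Schwarz_ineq2[of x h] by (simp add: algebra_simps add_increasing)
    then have le: "(2 * pi * norm (\<phi> x)) * \<bar>x \<bullet> h\<bar> \<le> (2 * pi * norm (\<phi> x)) * ((1 + norm x) * norm h)"
      by (intro mult_left_mono) auto
    have eq: "norm (?k h x) = (2 * pi * norm (\<phi> x)) * \<bar>x \<bullet> h\<bar>" by (simp add: norm_mult)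
    show ?thesis unfolding eq by (rule order_trans[OF le]) (simp add: algebra_simps)
  qed
  have ik: "integrable lborel (?k h)" for h
    by (rule Bochner_Integration.integrable_bound[OF integrable_mult_right[OF schwartz_moment_integrable[OF \<phi>, of 1], of "2 * pi * norm h"]])
      (use nk in \<open>auto intro: order_trans[OF _ abs_ge_self]\<close>)
  show "bounded_linear (D \<xi>)"
  proof (rule bounded_linear_intro)
    show "D \<xi> (g + h) = D \<xi> g + D \<xi> h" for g h
      unfolding D_def by (subst Bochner_Integration.integral_add[symmetric, OF ik ik])
        (simp add: inner_add_right algebra_simps)
    show "D \<xi> (r *\<^sub>R h) = r *\<^sub>R D \<xi> h" for r h
    proof -
      have "?k (r *\<^sub>R h) x = r *\<^sub>R ?k h x" for x
        unfolding inner_scaleR_right of_real_mult scaleR_conv_of_real[where 'a=complex] by (simp only: mult_ac)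
      then show ?thesis unfolding D_def by (simp only: integral_scaleR_right)
    qed
    show "norm (D \<xi> h) \<le> norm h * (2 * pi * (LINT x|lborel. (1 + norm x) ^ 1 * norm (\<phi> x)))" for h
    proof -
      have "norm (D \<xi> h) \<le> (LINT x|lborel. norm (?k h x))" unfolding D_def by (rule integral_norm_bound)
      also have "\<dots> \<le> (LINT x|lborel. 2 * pi * norm h * ((1 + norm x) ^ 1 * norm (\<phi> x)))"
        by (intro integral_mono integrable_norm ik integrable_mult_right schwartz_moment_integrable \<phi> nk)
      also have "\<dots> = 2 * pi * norm h * (LINT x|lborel. (1 + norm x) ^ 1 * norm (\<phi> x))"
        by (rule integral_mult_right_zero)
      finally show ?thesis by (simp only: mult_ac)
    qed
  qed
  fix h
  let ?r = "\<lambda>x. \<phi> x * fourier_char x (\<xi> + h) - \<phi> x * fourier_char x \<xi> - ?k h x"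
  have nr: "norm (?r x) \<le> 2 * pi\<^sup>2 * (norm h)\<^sup>2 * ((1 + norm x) ^ 2 * norm (\<phi> x))" for x
  proof -
    define \<theta> where "\<theta> = - 2 * pi * (x \<bullet> h)"
    have "?r x = (\<phi> x * fourier_char x \<xi>) * (iexp \<theta> - (\<Sum>k\<le>1. (\<i> * \<theta>) ^ k / fact k))"
      by (simp add: fourier_char_commute[of x] fourier_char_add, simp add: fourier_char_iexp \<theta>_def algebra_simps inner_commute)
    then have "norm (?r x) = norm (\<phi> x) * norm (iexp \<theta> - (\<Sum>k\<le>1. (\<i> * \<theta>) ^ k / fact k))"
      by (simp only: norm_mult norm_fourier_char mult_1_right)
    also have "norm (iexp \<theta> - (\<Sum>k\<le>1. (\<i> * \<theta>) ^ k / fact k)) \<le> \<bar>\<theta>\<bar> ^ 2 / 2"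
      using iexp_approx1[of \<theta> 1] by (simp add: numeral_2_eq_2)
    finally have le: "norm (?r x) \<le> norm (\<phi> x) * (\<bar>\<theta>\<bar> ^ 2 / 2)"
      by (simp add: mult_left_mono)
    have "\<bar>\<theta>\<bar> ^ 2 \<le> (2 * pi * (norm h * (1 + norm x))) ^ 2"
    proof (rule power_mono)
      have "\<bar>x \<bullet> h\<bar> \<le> norm h * (1 + norm x)"
        using Cauchy_Schwarz_ineq2[of x h] by (simp add: algebra_simps add_increasing)
      then show "\<bar>\<theta>\<bar> \<le> 2 * pi * (norm h * (1 + norm x))" by (simp add: \<theta>_def abs_mult)
    qed simp
    then have "norm (\<phi> x) * (\<bar>\<theta>\<bar> ^ 2 / 2) \<le> norm (\<phi> x) * ((2 * pi * (norm h * (1 + norm x))) ^ 2 / 2)"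
      by (intro mult_left_mono divide_right_mono) auto
    also have "\<dots> = 2 * pi\<^sup>2 * (norm h)\<^sup>2 * ((1 + norm x) ^ 2 * norm (\<phi> x))"
      by (simp add: power_mult_distrib)
    finally show ?thesis using le by (rule order_trans[rotated])
  qed
  have i1: "integrable lborel (\<lambda>x. \<phi> x * fourier_char x \<eta>)" for \<eta>
    by (intro integrable_mult_fourier_char schwartz_integrable \<phi>)
  have ir: "integrable lborel ?r" by (intro Bochner_Integration.integrable_diff i1 ik)
  have eq: "fourier \<phi> (\<xi> + h) - fourier \<phi> \<xi> - D \<xi> h = (LINT x|lborel. ?r x)"
    unfolding D_def fourier_lborel[OF schwartz_borel_measurable[OF \<phi>]]
    by (simp only: Bochner_Integration.integral_diff[OF Bochner_Integration.integrable_diff[OF i1 i1] ik]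
        Bochner_Integration.integral_diff[OF i1 i1])
  have "norm (LINT x|lborel. ?r x) \<le> (LINT x|lborel. norm (?r x))" by (rule integral_norm_bound)
  also have "\<dots> \<le> (LINT x|lborel. 2 * pi\<^sup>2 * (norm h)\<^sup>2 * ((1 + norm x) ^ 2 * norm (\<phi> x)))"
    by (intro integral_mono integrable_norm ir integrable_mult_right schwartz_moment_integrable \<phi> nr)
  also have "\<dots> = (2 * pi\<^sup>2 * (LINT x|lborel. (1 + norm x) ^ 2 * norm (\<phi> x))) * (norm h)\<^sup>2"
    by (subst integral_mult_right_zero) (simp only: mult_ac)
  finally show "norm (fourier \<phi> (\<xi> + h) - fourier \<phi> \<xi> - D \<xi> h)
      \<le> (2 * pi\<^sup>2 * (LINT x|lborel. (1 + norm x) ^ 2 * norm (\<phi> x))) * (norm h)\<^sup>2"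
    unfolding eq .
qed

lemma partial_deriv_fourier:
  fixes \<phi> :: "real^'n::finite \<Rightarrow> complex"
  assumes \<phi>: "\<phi> \<in> schwartz_space"
  shows "partial_deriv i (fourier \<phi>) = fourier (fourier_weight i \<phi>)"
proof
  fix \<xi>
  have S: "fourier_weight i \<phi> \<in> schwartz_space"
    by (rule schwartz_operator_closed[OF schwartz_operator_fourier_weight \<phi>])
  show "partial_deriv i (fourier \<phi>) \<xi> = fourier (fourier_weight i \<phi>) \<xi>"
    unfolding partial_deriv_eqI[OF fourier_has_derivative[OF \<phi>]]
      fourier_lborel[OF schwartz_borel_measurable[OF S]]
    by (simp add: fourier_weight_def inner_axis mult_ac)
qed

lemma smooth_fourier:
  fixes \<phi> :: "real^'n::finite \<Rightarrow> complex"
  assumes "\<phi> \<in> schwartz_space"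
  shows "smooth (fourier \<phi>)"
proof (rule derivation_closed_smooth)
  show "fourier \<phi> \<in> fourier ` schwartz_space" using assms by blast
  show "partial_deriv i \<psi> \<in> fourier ` schwartz_space" if "\<psi> \<in> fourier ` schwartz_space" for \<psi> i
    using that partial_deriv_fourier schwartz_operator_closed[OF schwartz_operator_fourier_weight] by blast
  show "\<psi> differentiable (at x)" if "\<psi> \<in> fourier ` schwartz_space" for \<psi> x
    using that fourier_has_derivative by (auto simp: differentiable_def)
qed

lemma iter_deriv_fourier:
  obtains W where "schwartz_operator W"
    "\<And>\<phi> :: real^'n::finite \<Rightarrow> complex. \<phi> \<in> schwartz_space \<Longrightarrow> iter_deriv js (fourier \<phi>) = fourier (W \<phi>)"
proof -
  have "\<exists>W. schwartz_operator W \<and> (\<forall>\<phi>\<in>schwartz_space. iter_deriv js (fourier \<phi>) = fourier (W \<phi>))"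
  proof (induction js)
    case Nil
    have "schwartz_operator (\<lambda>\<phi>. \<phi>)"
      unfolding schwartz_operator_def by (auto intro!: exI[of _ "1::real"])
    then show ?case by (intro exI[of _ "\<lambda>\<phi>. \<phi>"]) simp
  next
    case (Cons i js)
    then obtain W where W: "schwartz_operator W"
      "\<And>\<phi>. \<phi> \<in> schwartz_space \<Longrightarrow> iter_deriv js (fourier \<phi>) = fourier (W \<phi>)" by blast
    then show ?case
      by (intro exI[of _ "\<lambda>\<phi>. fourier_weight i (W \<phi>)"])
        (simp add: iter_deriv_Cons partial_deriv_fourier schwartz_operator_closed
          schwartz_operator_comp[OF schwartz_operator_fourier_weight])
  qed
  then show thesis using that by blast
qed

subsection \<open>Transform of a derivative\<close>

lemma has_derivative_difference_quotient:
  fixes f :: "'a::real_normed_vector \<Rightarrow> 'b::real_normed_vector"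
  assumes "(f has_derivative D) (at x)" and e: "norm e = 1"
  shows "(\<lambda>n. (f (x + inverse (real (Suc n)) *\<^sub>R e) - f x) /\<^sub>R inverse (real (Suc n))) \<longlonglongrightarrow> D e"
proof -
  define r where "r n = inverse (real (Suc n))" for n
  have r: "0 < r n" for n by (simp add: r_def)
  have "r \<longlonglongrightarrow> 0" unfolding r_def by (rule LIMSEQ_inverse_real_of_nat)
  then have "(\<lambda>n. r n *\<^sub>R e) \<longlonglongrightarrow> 0 *\<^sub>R e" by (intro tendsto_scaleR tendsto_const)
  then have "filterlim (\<lambda>n. r n *\<^sub>R e) (at 0) sequentially"
    using r e by (auto simp: filterlim_at intro!: always_eventually)
      (metis less_irrefl norm_zero zero_neq_one)
  moreover have "bounded_linear D" "(\<lambda>h. norm (f (x + h) - f x - D h) / norm h) \<midarrow>0\<rightarrow> 0"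
    using assms(1) by (auto simp: has_derivative_at)
  ultimately have "(\<lambda>n. norm (f (x + r n *\<^sub>R e) - f x - D (r n *\<^sub>R e)) / norm (r n *\<^sub>R e)) \<longlonglongrightarrow> 0"
    using filterlim_compose by blast
  moreover have "norm (f (x + r n *\<^sub>R e) - f x - D (r n *\<^sub>R e)) / norm (r n *\<^sub>R e)
      = norm ((f (x + r n *\<^sub>R e) - f x) /\<^sub>R r n - D e)" for n
  proof -
    have "(f (x + r n *\<^sub>R e) - f x) /\<^sub>R r n - D e = (f (x + r n *\<^sub>R e) - f x - D (r n *\<^sub>R e)) /\<^sub>R r n"
      using r[of n] \<open>bounded_linear D\<close> by (simp add: bounded_linear.linear linear_scale scaleR_diff_right)
    then show ?thesis using r[of n] e by (simp add: divide_inverse mult.commute)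
  qed
  ultimately have "(\<lambda>n. norm ((f (x + r n *\<^sub>R e) - f x) /\<^sub>R r n - D e)) \<longlonglongrightarrow> 0" by simp
  then have "(\<lambda>n. (f (x + r n *\<^sub>R e) - f x) /\<^sub>R r n) \<longlonglongrightarrow> D e"
    by (simp only: tendsto_norm_zero_iff LIM_zero_iff)
  then show ?thesis by (simp only: r_def)
qed

text \<open>The mean value inequality along a segment of length at most 1; on it \<open>1 + \<bar>x\<bar>\<close> changes by at most a factor
  of 2.  This majorant of the difference quotients is used for dominated convergence.\<close>

lemma schwartz_difference_bound:
  fixes \<phi> :: "real^'n::finite \<Rightarrow> complex"
  assumes \<phi>: "\<phi> \<in> schwartz_space" and h: "0 < h" "h \<le> 1" and m: "1 \<le> m"
  shows "norm ((\<phi> (x + h *\<^sub>R axis i 1) - \<phi> x) /\<^sub>R h)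
    \<le> 2 ^ m * schwartz_norm m \<phi> * inverse ((1 + norm x) ^ m)"
proof -
  let ?e = "axis i 1 :: real^'n"
  let ?B = "2 ^ m * schwartz_norm m \<phi> * inverse ((1 + norm x) ^ m)"
  have pos: "0 < 1 + norm x" by (simp add: add_pos_nonneg)
  have "norm (\<phi> (x + h *\<^sub>R ?e) - \<phi> (x + 0 *\<^sub>R ?e)) \<le> ?B * norm (h - 0)"
  proof (rule differentiable_bound[of "{0..h}"])
    fix t assume t: "t \<in> {0..h}"
    show "((\<lambda>t. \<phi> (x + t *\<^sub>R ?e)) has_derivative (\<lambda>s. frechet_derivative \<phi> (at (x + t *\<^sub>R ?e)) (s *\<^sub>R ?e)))
        (at t within {0..h})"
    proof (rule has_derivative_compose[of "\<lambda>t. x + t *\<^sub>R ?e"])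
      show "((\<lambda>t. x + t *\<^sub>R ?e) has_derivative (\<lambda>s. s *\<^sub>R ?e)) (at t within {0..h})"
        by (auto intro!: derivative_eq_intros)
    qed (rule smooth_has_derivative[OF schwartz_space_smooth[OF \<phi>]])
    have lin: "linear (frechet_derivative \<phi> (at (x + t *\<^sub>R ?e)))"
      by (intro linear_frechet_derivative smooth_differentiable schwartz_space_smooth \<phi>)
    show "onorm (\<lambda>s. frechet_derivative \<phi> (at (x + t *\<^sub>R ?e)) (s *\<^sub>R ?e)) \<le> ?B"
    proof (rule onorm_le)
      fix s :: real
      have "norm x \<le> norm (x + t *\<^sub>R ?e) + norm (t *\<^sub>R ?e)"
        by (metis add_diff_cancel_right' norm_triangle_ineq4)
      moreover have "norm (t *\<^sub>R ?e) \<le> 1" using t h by simp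
      ultimately have "1 + norm x \<le> 2 * (1 + norm (x + t *\<^sub>R ?e))"
        using norm_ge_zero[of "x + t *\<^sub>R ?e"] by argo
      then have "(1 + norm x) ^ m \<le> 2 ^ m * (1 + norm (x + t *\<^sub>R ?e)) ^ m"
        using power_mono[of "1 + norm x" "2 * (1 + norm (x + t *\<^sub>R ?e))" m] pos
        unfolding power_mult_distrib by linarith
      then have le: "inverse ((1 + norm (x + t *\<^sub>R ?e)) ^ m) \<le> 2 ^ m * inverse ((1 + norm x) ^ m)"
        using pos by (simp add: field_simps add_pos_nonneg)
      have "norm (frechet_derivative \<phi> (at (x + t *\<^sub>R ?e)) ?e)
          \<le> schwartz_norm m \<phi> * inverse ((1 + norm (x + t *\<^sub>R ?e)) ^ m)"
        using schwartz_norm_decay[OF \<phi>, of "[i]" m "x + t *\<^sub>R ?e"] m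
        by (simp add: iter_deriv_Cons partial_deriv_def)
      also have "\<dots> \<le> schwartz_norm m \<phi> * (2 ^ m * inverse ((1 + norm x) ^ m))"
        by (intro mult_left_mono le schwartz_norm_nonneg \<phi>)
      finally have "norm (frechet_derivative \<phi> (at (x + t *\<^sub>R ?e)) ?e) \<le> ?B" by (simp add: mult_ac)
      then show "norm (frechet_derivative \<phi> (at (x + t *\<^sub>R ?e)) (s *\<^sub>R ?e)) \<le> ?B * norm s"
        using lin by (simp add: linear_scale mult.commute mult_left_mono)
    qed
  qed (use h in auto)
  then have "norm (\<phi> (x + h *\<^sub>R ?e) - \<phi> x) \<le> ?B * h" using h by simp
  then have "inverse h * norm (\<phi> (x + h *\<^sub>R ?e) - \<phi> x) \<le> inverse h * (?B * h)"
    using h by (intro mult_left_mono) auto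
  also have "\<dots> = ?B" using h by simp
  finally show ?thesis using h by simp
qed

text \<open>Integration by parts, obtained by differentiating the effect of a translation on the transform.\<close>

lemma fourier_partial_deriv:
  fixes \<phi> :: "real^'n::finite \<Rightarrow> complex"
  assumes \<phi>: "\<phi> \<in> schwartz_space"
  shows "fourier (partial_deriv i \<phi>) \<xi> = 2 * complex_of_real pi * \<i> * complex_of_real (\<xi> $ i) * fourier \<phi> \<xi>"
proof -
  let ?e = "axis i 1 :: real^'n"
  let ?N = "2 * DIM(real^'n)"
  define r where "r n = inverse (real (Suc n))" for n
  have r: "0 < r n" "r n \<le> 1" for n by (auto simp: r_def inverse_le_1_iff)
  define g where "g n x = (\<phi> (x + r n *\<^sub>R ?e) - \<phi> x) /\<^sub>R r n" for n x
  note [measurable] = schwartz_borel_measurable[OF \<phi>]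
  have [measurable]: "partial_deriv i \<phi> \<in> borel_measurable borel"
    by (intro smooth_borel_measurable smooth_partial_deriv schwartz_space_smooth \<phi>)
  have N: "1 \<le> ?N" using DIM_positive[where 'a="real^'n"] by linarith
  have lim1: "(\<lambda>n. LINT x|lborel. g n x * fourier_char x \<xi>) \<longlonglongrightarrow> fourier (partial_deriv i \<phi>) \<xi>"
    unfolding fourier_lborel[OF \<open>partial_deriv i \<phi> \<in> borel_measurable borel\<close>]
  proof (rule integral_dominated_convergence)
    show "integrable lborel (\<lambda>x :: real^'n. 2 ^ ?N * schwartz_norm ?N \<phi> * inverse ((1 + norm x) ^ ?N))"
      by (intro integrable_mult_right integrable_one_plus_norm_powr)
    show "AE x in lborel. (\<lambda>n. g n x * fourier_char x \<xi>) \<longlonglongrightarrow> partial_deriv i \<phi> x * fourier_char x \<xi>"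
      using has_derivative_difference_quotient[OF smooth_has_derivative[OF schwartz_space_smooth[OF \<phi>]], of ?e]
      by (intro AE_I2 tendsto_mult tendsto_const) (simp add: g_def r_def partial_deriv_def)
    show "AE x in lborel. norm (g n x * fourier_char x \<xi>) \<le> 2 ^ ?N * schwartz_norm ?N \<phi> * inverse ((1 + norm x) ^ ?N)" for n
      using schwartz_difference_bound[OF \<phi> r N] by (intro AE_I2) (simp only: g_def norm_mult norm_fourier_char mult_1_right)
  qed (auto simp: g_def)
  have "(LINT x|lborel. g n x * fourier_char x \<xi>)
      = ((fourier_char (- (0 + r n *\<^sub>R ?e)) \<xi> - fourier_char (- 0) \<xi>) /\<^sub>R r n) * fourier \<phi> \<xi>" for n
  proof -
    have i1: "integrable lborel (\<lambda>x. \<phi> x * fourier_char x \<xi>)"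
      by (intro integrable_mult_fourier_char schwartz_integrable \<phi>)
    have eq: "\<phi> (x + r n *\<^sub>R ?e) * fourier_char x \<xi>
        = fourier_char (- (r n *\<^sub>R ?e)) \<xi> * (\<phi> (r n *\<^sub>R ?e + x) * fourier_char (r n *\<^sub>R ?e + x) \<xi>)" for x
    proof -
      have "fourier_char x \<xi> = fourier_char (- (r n *\<^sub>R ?e) + (r n *\<^sub>R ?e + x)) \<xi>" by simp
      then show ?thesis by (simp only: fourier_char_add[of "- (r n *\<^sub>R ?e)"]) (simp add: add.commute)
    qed
    have i2: "integrable lborel (\<lambda>x. \<phi> (x + r n *\<^sub>R ?e) * fourier_char x \<xi>)"
      unfolding eq using i1
      by (intro integrable_mult_right)
        (subst integrable_lborel_translation[of "\<lambda>x. \<phi> x * fourier_char x \<xi>" "r n *\<^sub>R ?e"], auto)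
    have "(LINT x|lborel. \<phi> (x + r n *\<^sub>R ?e) * fourier_char x \<xi>) = fourier_char (- (r n *\<^sub>R ?e)) \<xi> * fourier \<phi> \<xi>"
      unfolding eq integral_mult_right_zero
      by (subst integral_lborel_translation[of "\<lambda>x. \<phi> x * fourier_char x \<xi>" "r n *\<^sub>R ?e"])
        (auto simp: fourier_lborel)
    then have "(LINT x|lborel. \<phi> (x + r n *\<^sub>R ?e) * fourier_char x \<xi> - \<phi> x * fourier_char x \<xi>)
        = (fourier_char (- (r n *\<^sub>R ?e)) \<xi> - 1) * fourier \<phi> \<xi>"
      using i1 i2 by (simp add: fourier_lborel left_diff_distrib)
    moreover have "g n x * fourier_char x \<xi>
        = (\<phi> (x + r n *\<^sub>R ?e) * fourier_char x \<xi> - \<phi> x * fourier_char x \<xi>) /\<^sub>R r n" for x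
      by (simp add: g_def left_diff_distrib)
    ultimately show ?thesis by (simp only: integral_scaleR_right) simp
  qed
  moreover have "((\<lambda>y. fourier_char (- y) \<xi>) has_derivative
      (\<lambda>h. 2 * complex_of_real pi * \<i> * complex_of_real (h \<bullet> \<xi>))) (at 0)"
  proof -
    have "((\<lambda>y. 2 * complex_of_real pi * \<i> * complex_of_real (y \<bullet> \<xi>)) has_derivative
        (\<lambda>h. 2 * complex_of_real pi * \<i> * complex_of_real (h \<bullet> \<xi>))) (at 0)"
      by (intro has_derivative_mult_right has_derivative_of_real has_derivative_inner_left has_derivative_ident)
    from has_derivative_compose[OF this has_field_derivative_imp_has_derivative[OF DERIV_exp]]
    show ?thesis by (simp add: fourier_char_def)
  qed
  from has_derivative_difference_quotient[OF this, of ?e]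
  have "(\<lambda>n. (fourier_char (- (0 + r n *\<^sub>R ?e)) \<xi> - fourier_char (- 0) \<xi>) /\<^sub>R r n)
      \<longlonglongrightarrow> 2 * complex_of_real pi * \<i> * complex_of_real (\<xi> $ i)"
    by (simp add: r_def inner_axis')
  ultimately have lim2: "(\<lambda>n. LINT x|lborel. g n x * fourier_char x \<xi>)
      \<longlonglongrightarrow> 2 * complex_of_real pi * \<i> * complex_of_real (\<xi> $ i) * fourier \<phi> \<xi>"
    by (simp only:) (intro tendsto_mult tendsto_const)
  from LIMSEQ_unique[OF lim1 lim2] show ?thesis .
qed

lemma schwartz_operator_partial_deriv: "schwartz_operator (partial_deriv (i :: 'n::finite))"
proof (rule schwartz_operatorI)
  fix k and js :: "'n list"
  let ?m = "max k (Suc (length js))"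
  show "\<exists>C\<ge>0. \<exists>m. \<forall>\<phi>\<in>schwartz_space. \<forall>x.
      (1 + norm x) ^ k * norm (iter_deriv js (partial_deriv i \<phi>) x) \<le> C * schwartz_norm m \<phi>"
    by (intro exI[of _ "1::real"] conjI exI[of _ ?m])
      (auto simp: iter_deriv_partial_deriv intro!: schwartz_norm_upper)
next
  show "partial_deriv i (\<lambda>x. c * \<phi> x) = (\<lambda>x. c * partial_deriv i \<phi> x)" if "\<phi> \<in> schwartz_space" for c \<phi>
    using iter_deriv_cmult[OF schwartz_space_smooth[OF that], of "[i]"] by (simp add: iter_deriv_Cons)
qed (auto intro!: partial_deriv_add smooth_partial_deriv dest: schwartz_space_smooth smooth_differentiable)

text \<open>Each factor \<open>1 + \<bar>\<xi>\<bar>\<close> is estimated by \<open>1 + \<Sum> \<bar>\<xi>\<^sub>i\<bar>\<close>, and a factor \<open>\<xi>\<^sub>i\<close> is traded for a derivative of \<open>\<phi>\<close>.\<close>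

lemma fourier_decay:
  "\<exists>C\<ge>0. \<exists>m. \<forall>\<phi>\<in>schwartz_space. \<forall>\<xi> :: real^'n::finite.
    (1 + norm \<xi>) ^ k * norm (fourier \<phi> \<xi>) \<le> C * schwartz_norm m \<phi>"
proof (induction k)
  case 0
  obtain C m where "0 \<le> C" "\<And>\<phi> :: real^'n \<Rightarrow> complex. \<phi> \<in> schwartz_space \<Longrightarrow>
      (LINT x|lborel. norm (\<phi> x)) \<le> C * schwartz_norm m \<phi>"
    using schwartz_norm_L1 by blast
  then have "norm (fourier \<phi> \<xi>) \<le> C * schwartz_norm m \<phi>"
    if "\<phi> \<in> schwartz_space" for \<phi> and \<xi> :: "real^'n"
    using norm_fourier_le[OF schwartz_integrable[OF that], of \<xi>] that by (meson order_trans)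
  with \<open>0 \<le> C\<close> show ?case by auto
next
  case (Suc k)
  then obtain C m where C: "0 \<le> C" "\<And>\<phi> \<xi> :: real^'n. \<phi> \<in> schwartz_space \<Longrightarrow>
      (1 + norm \<xi>) ^ k * norm (fourier \<phi> \<xi>) \<le> C * schwartz_norm m \<phi>" by blast
  have "\<forall>i :: 'n. \<exists>D m'. 0 \<le> D \<and> (\<forall>\<phi>\<in>schwartz_space. schwartz_norm m (partial_deriv i \<phi>) \<le> D * schwartz_norm m' \<phi>)"
    using schwartz_operator_bound[OF schwartz_operator_partial_deriv] by metis
  then obtain D M where D: "\<And>i :: 'n. 0 \<le> D i"
    "\<And>(i :: 'n) \<phi>. \<phi> \<in> schwartz_space \<Longrightarrow> schwartz_norm m (partial_deriv i \<phi>) \<le> D i * schwartz_norm (M i) \<phi>"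
    by metis
  define m' where "m' = max m (Max (range M))"
  have M: "M i \<le> m'" for i by (simp add: m'_def le_max_iff_disj)
  have "(1 + norm \<xi>) ^ Suc k * norm (fourier \<phi> \<xi>) \<le> (C + (\<Sum>i\<in>UNIV. C * D i)) * schwartz_norm m' \<phi>"
    if \<phi>: "\<phi> \<in> schwartz_space" for \<phi> and \<xi> :: "real^'n"
  proof -
    let ?w = "(1 + norm \<xi>) ^ k"
    have "norm \<xi> * norm (fourier \<phi> \<xi>) \<le> (\<Sum>i\<in>UNIV. \<bar>\<xi> $ i\<bar>) * norm (fourier \<phi> \<xi>)"
      by (intro mult_right_mono norm_le_l1_cart) auto
    also have "\<dots> \<le> (\<Sum>i\<in>UNIV. norm (fourier (partial_deriv i \<phi>) \<xi>))"
      unfolding sum_distrib_right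
    proof (rule sum_mono)
      fix i
      have "1 * (\<bar>\<xi> $ i\<bar> * norm (fourier \<phi> \<xi>)) \<le> (2 * pi) * (\<bar>\<xi> $ i\<bar> * norm (fourier \<phi> \<xi>))"
        using pi_gt3 by (intro mult_right_mono) auto
      then show "\<bar>\<xi> $ i\<bar> * norm (fourier \<phi> \<xi>) \<le> norm (fourier (partial_deriv i \<phi>) \<xi>)"
        by (simp add: fourier_partial_deriv[OF \<phi>] norm_mult mult_ac)
    qed
    finally have "(1 + norm \<xi>) * norm (fourier \<phi> \<xi>)
        \<le> norm (fourier \<phi> \<xi>) + (\<Sum>i\<in>UNIV. norm (fourier (partial_deriv i \<phi>) \<xi>))"
      by (simp add: distrib_right)
    then have "?w * ((1 + norm \<xi>) * norm (fourier \<phi> \<xi>))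
        \<le> ?w * (norm (fourier \<phi> \<xi>) + (\<Sum>i\<in>UNIV. norm (fourier (partial_deriv i \<phi>) \<xi>)))"
      by (intro mult_left_mono) auto
    also have "\<dots> = ?w * norm (fourier \<phi> \<xi>) + (\<Sum>i\<in>UNIV. ?w * norm (fourier (partial_deriv i \<phi>) \<xi>))"
      by (simp add: distrib_left sum_distrib_left)
    also have "\<dots> \<le> C * schwartz_norm m' \<phi> + (\<Sum>i\<in>UNIV. C * (D i * schwartz_norm m' \<phi>))"
    proof (intro add_mono sum_mono)
      have "C * schwartz_norm m \<phi> \<le> C * schwartz_norm m' \<phi>"
        by (intro mult_left_mono schwartz_norm_mono \<phi> C) (simp add: m'_def)
      with C(2)[OF \<phi>] show "?w * norm (fourier \<phi> \<xi>) \<le> C * schwartz_norm m' \<phi>" by (rule order_trans)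
      fix i :: 'n
      have "schwartz_norm m (partial_deriv i \<phi>) \<le> D i * schwartz_norm m' \<phi>"
        by (rule order_trans[OF D(2)[OF \<phi>]]) (intro mult_left_mono schwartz_norm_mono \<phi> D M)
      then have "C * schwartz_norm m (partial_deriv i \<phi>) \<le> C * (D i * schwartz_norm m' \<phi>)"
        by (intro mult_left_mono C)
      then show "?w * norm (fourier (partial_deriv i \<phi>) \<xi>) \<le> C * (D i * schwartz_norm m' \<phi>)"
        using C(2)[OF schwartz_operator_closed[OF schwartz_operator_partial_deriv \<phi>]] by (rule order_trans[rotated])
    qed
    finally show ?thesis by (simp add: algebra_simps sum_distrib_left sum_distrib_right)
  qed
  moreover have "0 \<le> C + (\<Sum>i\<in>UNIV. C * D i)" using C(1) D(1) by (intro add_nonneg_nonneg sum_nonneg) auto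
  ultimately show ?case by blast
qed

theorem schwartz_operator_fourier: "schwartz_operator (fourier :: (real^'n::finite \<Rightarrow> complex) \<Rightarrow> _)"
proof (rule schwartz_operatorI)
  fix k and js :: "'n list"
  obtain W where W: "schwartz_operator W"
    "\<And>\<phi> :: real^'n \<Rightarrow> complex. \<phi> \<in> schwartz_space \<Longrightarrow> iter_deriv js (fourier \<phi>) = fourier (W \<phi>)"
    using iter_deriv_fourier by blast
  obtain C m where C: "0 \<le> C" "\<And>\<phi> \<xi> :: real^'n. \<phi> \<in> schwartz_space \<Longrightarrow>
      (1 + norm \<xi>) ^ k * norm (fourier \<phi> \<xi>) \<le> C * schwartz_norm m \<phi>"
    using fourier_decay by metis
  obtain D m' where D: "0 \<le> D" "\<And>\<phi>. \<phi> \<in> schwartz_space \<Longrightarrow> schwartz_norm m (W \<phi>) \<le> D * schwartz_norm m' \<phi>"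
    using schwartz_operator_bound[OF W(1)] by blast
  have "(1 + norm \<xi>) ^ k * norm (iter_deriv js (fourier \<phi>) \<xi>) \<le> (C * D) * schwartz_norm m' \<phi>"
    if "\<phi> \<in> schwartz_space" for \<phi> and \<xi> :: "real^'n"
    using C(2)[OF schwartz_operator_closed[OF W(1) that], of \<xi>] mult_left_mono[OF D(2)[OF that] C(1)]
    by (simp add: W(2)[OF that] mult.assoc)
  then show "\<exists>C\<ge>0. \<exists>m. \<forall>\<phi>\<in>schwartz_space. \<forall>\<xi>.
      (1 + norm \<xi>) ^ k * norm (iter_deriv js (fourier \<phi>) \<xi>) \<le> C * schwartz_norm m \<phi>"
    using C(1) D(1) by (intro exI[of _ "C * D"]) auto
qed (auto simp: fourier_add fourier_cmult schwartz_integrable smooth_fourier)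

section \<open>Fourier inversion and multipliers on tempered distributions\<close>

lemma fourier_measurable [measurable]:
  fixes f :: "real^'n::finite \<Rightarrow> complex"
  assumes "f \<in> borel_measurable borel"
  shows "fourier f \<in> borel_measurable borel"
proof -
  note [measurable] = assms
  have "(\<lambda>\<xi>. LINT x|lborel. f x * fourier_char x \<xi>) \<in> borel_measurable borel" by measurable
  then show ?thesis by (simp add: fourier_lborel[OF assms, symmetric])
qed

lemma fourier_multiplication_formula:
  fixes f g :: "real^'n::finite \<Rightarrow> complex"
  assumes f: "integrable lborel f" and g: "integrable lborel g"
  shows "(LINT x|lborel. fourier f x * g x) = (LINT x|lborel. f x * fourier g x)"
proof -
  note [measurable] = borel_measurable_integrable[OF f, simplified] borel_measurable_integrable[OF g, simplified]
  have int: "integrable (lborel \<Otimes>\<^sub>M lborel) (\<lambda>(x, y). f x * g y * fourier_char x y)"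
  proof (rule lborel_pair.Fubini_integrable)
    show "integrable lborel (\<lambda>x. LINT y|lborel. norm (case (x, y) of (x, y) \<Rightarrow> f x * g y * fourier_char x y))"
      using f by (simp add: norm_mult)
    show "AE x in lborel. integrable lborel (\<lambda>y. case (x, y) of (x, y) \<Rightarrow> f x * g y * fourier_char x y)"
    proof (rule AE_I2)
      fix x :: "real^'n"
      have "integrable lborel (\<lambda>y. f x * (g y * fourier_char y x))"
        by (intro integrable_mult_right integrable_mult_fourier_char g)
      then show "integrable lborel (\<lambda>y. case (x, y) of (x, y) \<Rightarrow> f x * g y * fourier_char x y)"
        by (simp add: fourier_char_commute mult.assoc)
    qed
  qed measurable
  have "(LINT y|lborel. fourier f y * g y) = (LINT y|lborel. LINT x|lborel. f x * g y * fourier_char x y)"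
    by (simp add: fourier_lborel mult_ac flip: integral_mult_right_zero)
  also have "\<dots> = (LINT x|lborel. LINT y|lborel. f x * g y * fourier_char x y)"
    by (rule lborel_pair.Fubini_integral[OF int])
  also have "\<dots> = (LINT x|lborel. f x * fourier g x)"
    by (simp add: fourier_lborel mult.assoc fourier_char_commute)
  finally show ?thesis .
qed

text \<open>The inversion integral is tested against Gaussians of increasing width: the multiplication
  formula turns it into an average of \<open>\<phi>\<close> over shrinking Gaussians.\<close>

lemma fourier_inversion:
  fixes \<phi> :: "real^'n::finite \<Rightarrow> complex"
  assumes \<phi>: "\<phi> \<in> schwartz_space"
  shows "fourier (fourier \<phi>) (- x) = \<phi> x"
proof -
  let ?n = "DIM(real^'n)"
  define c where "c k = inverse (real (Suc k))" for k
  have c: "0 < c k" for k by (simp add: c_def)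
  \<comment> \<open>the Gaussian factor has parameter \<open>c\<^sup>2\<close>, so its transform is a Gaussian of width proportional to \<open>c\<close>\<close>
  have c_lim: "c \<longlonglongrightarrow> 0" unfolding c_def by (rule LIMSEQ_inverse_real_of_nat)
  define \<gamma> where "\<gamma> k \<xi> = complex_of_real (exp (- (c k)\<^sup>2 * (norm \<xi>)\<^sup>2)) * fourier_char \<xi> (- x)" for k and \<xi> :: "real^'n"
  note S = schwartz_operator_closed[OF schwartz_operator_fourier]
  note [measurable] = schwartz_borel_measurable[OF \<phi>]
  have [measurable]: "\<gamma> k \<in> borel_measurable borel" for k
    unfolding \<gamma>_def [abs_def] by measurable
  have \<gamma>_int: "integrable lborel (\<gamma> k)" for k
    unfolding \<gamma>_def using c[of k] by (intro integrable_fourier_gaussian) simp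
  have lim1: "(\<lambda>k. LINT \<xi>|lborel. fourier \<phi> \<xi> * \<gamma> k \<xi>) \<longlonglongrightarrow> fourier (fourier \<phi>) (- x)"
    unfolding fourier_lborel[OF schwartz_borel_measurable[OF S[OF \<phi>]]]
  proof (rule integral_dominated_convergence)
    show "integrable lborel (\<lambda>\<xi>. norm (fourier \<phi> \<xi>))"
      by (intro integrable_norm schwartz_integrable S \<phi>)
    show "AE \<xi> in lborel. norm (fourier \<phi> \<xi> * \<gamma> k \<xi>) \<le> norm (fourier \<phi> \<xi>)" for k
      by (intro AE_I2) (auto simp: \<gamma>_def norm_mult intro!: mult_left_le)
    show "AE \<xi> in lborel. (\<lambda>k. fourier \<phi> \<xi> * \<gamma> k \<xi>) \<longlonglongrightarrow> fourier \<phi> \<xi> * fourier_char \<xi> (- x)"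
    proof (rule AE_I2)
      fix \<xi> :: "real^'n"
      have "(\<lambda>k. fourier \<phi> \<xi> * \<gamma> k \<xi>) \<longlonglongrightarrow>
          fourier \<phi> \<xi> * (complex_of_real (exp (- 0\<^sup>2 * (norm \<xi>)\<^sup>2)) * fourier_char \<xi> (- x))"
        unfolding \<gamma>_def by (intro tendsto_intros c_lim)
      then show "(\<lambda>k. fourier \<phi> \<xi> * \<gamma> k \<xi>) \<longlonglongrightarrow> fourier \<phi> \<xi> * fourier_char \<xi> (- x)" by simp
    qed
  qed measurable
  have "(LINT \<xi>|lborel. fourier \<phi> \<xi> * \<gamma> k \<xi>)
      = (LINT z|lborel. complex_of_real (sqrt pi ^ ?n * exp (- pi\<^sup>2 * (norm z)\<^sup>2)) * \<phi> (x + c k *\<^sub>R z))" for k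
  proof -
    have fourier_\<gamma>: "fourier (\<gamma> k) y
        = complex_of_real (sqrt (pi / (c k)\<^sup>2) ^ ?n * exp (- pi\<^sup>2 * (norm (y - x))\<^sup>2 / (c k)\<^sup>2))" for y
    proof -
      have "fourier_char \<xi> (- x) * fourier_char \<xi> y = fourier_char \<xi> (y - x)" for \<xi> :: "real^'n"
        by (simp add: fourier_char_commute[of \<xi>] flip: fourier_char_add)
      then have "fourier (\<gamma> k) y
          = (LINT \<xi>|lborel. complex_of_real (exp (- (c k)\<^sup>2 * (norm \<xi>)\<^sup>2)) * fourier_char \<xi> (y - x))"
        by (simp add: fourier_lborel, simp add: \<gamma>_def mult.assoc)
      also have "\<dots> = complex_of_real (sqrt (pi / (c k)\<^sup>2) ^ ?n * exp (- pi\<^sup>2 * (norm (y - x))\<^sup>2 / (c k)\<^sup>2))"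
        using c[of k] by (intro fourier_gaussian) simp
      finally show ?thesis .
    qed
    have "(LINT \<xi>|lborel. fourier \<phi> \<xi> * \<gamma> k \<xi>) = (LINT y|lborel. \<phi> y * fourier (\<gamma> k) y)"
      by (intro fourier_multiplication_formula schwartz_integrable \<phi> \<gamma>_int)
    also have "\<dots> = \<bar>c k\<bar> ^ ?n *\<^sub>R (LINT z|lborel. \<phi> (x + c k *\<^sub>R z) * fourier (\<gamma> k) (x + c k *\<^sub>R z))"
      using c[of k] by (intro integral_lborel_affine) auto
    also have "\<dots> = (LINT z|lborel. \<bar>c k\<bar> ^ ?n *\<^sub>R (\<phi> (x + c k *\<^sub>R z) * fourier (\<gamma> k) (x + c k *\<^sub>R z)))"
      by (rule integral_scaleR_right[symmetric])
    also have "\<dots> = (LINT z|lborel. complex_of_real (sqrt pi ^ ?n * exp (- pi\<^sup>2 * (norm z)\<^sup>2)) * \<phi> (x + c k *\<^sub>R z))"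
    proof (rule Bochner_Integration.integral_cong[OF refl])
      fix z :: "real^'n"
      have e1: "\<bar>c k\<bar> ^ ?n * sqrt (pi / (c k)\<^sup>2) ^ ?n = sqrt pi ^ ?n"
        using c[of k] by (simp add: real_sqrt_divide flip: power_mult_distrib)
      have e2: "- pi\<^sup>2 * (norm (c k *\<^sub>R z))\<^sup>2 / (c k)\<^sup>2 = - pi\<^sup>2 * (norm z)\<^sup>2"
        using c[of k] by (simp add: power_mult_distrib)
      have gen: "a *\<^sub>R (w * complex_of_real (b * e)) = complex_of_real ((a * b) * e) * w" for a b e and w :: complex
        by (simp add: scaleR_conv_of_real)
      show "\<bar>c k\<bar> ^ ?n *\<^sub>R (\<phi> (x + c k *\<^sub>R z) * fourier (\<gamma> k) (x + c k *\<^sub>R z))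
          = complex_of_real (sqrt pi ^ ?n * exp (- pi\<^sup>2 * (norm z)\<^sup>2)) * \<phi> (x + c k *\<^sub>R z)"
        unfolding fourier_\<gamma> gen e1 add_diff_cancel_left' e2 ..
    qed
    finally show ?thesis .
  qed
  moreover have "(\<lambda>k. LINT z|lborel. complex_of_real (sqrt pi ^ ?n * exp (- pi\<^sup>2 * (norm z)\<^sup>2)) * \<phi> (x + c k *\<^sub>R z))
      \<longlonglongrightarrow> (LINT z|lborel. complex_of_real (sqrt pi ^ ?n * exp (- pi\<^sup>2 * (norm (z :: real^'n))\<^sup>2)) * \<phi> x)"
  proof (rule integral_dominated_convergence)
    show "integrable lborel (\<lambda>z :: real^'n. (sqrt pi ^ ?n * exp (- pi\<^sup>2 * (norm z)\<^sup>2)) * schwartz_norm 0 \<phi>)"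
      by (intro integrable_mult_left integrable_mult_right integrable_gaussian) simp
    show "AE z in lborel. norm (complex_of_real (sqrt pi ^ ?n * exp (- pi\<^sup>2 * (norm z)\<^sup>2)) * \<phi> (x + c k *\<^sub>R z))
        \<le> (sqrt pi ^ ?n * exp (- pi\<^sup>2 * (norm z)\<^sup>2)) * schwartz_norm 0 \<phi>" for k
    proof (rule AE_I2)
      fix z :: "real^'n"
      have "norm (\<phi> (x + c k *\<^sub>R z)) \<le> schwartz_norm 0 \<phi>"
        using schwartz_norm_decay[OF \<phi>, of "[]" 0] by simp
      then show "norm (complex_of_real (sqrt pi ^ ?n * exp (- pi\<^sup>2 * (norm z)\<^sup>2)) * \<phi> (x + c k *\<^sub>R z))
        \<le> (sqrt pi ^ ?n * exp (- pi\<^sup>2 * (norm z)\<^sup>2)) * schwartz_norm 0 \<phi>"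
        unfolding norm_mult norm_of_real by (simp add: mult_left_mono)
    qed
    show "AE z in lborel. (\<lambda>k. complex_of_real (sqrt pi ^ ?n * exp (- pi\<^sup>2 * (norm z)\<^sup>2)) * \<phi> (x + c k *\<^sub>R z))
      \<longlonglongrightarrow> complex_of_real (sqrt pi ^ ?n * exp (- pi\<^sup>2 * (norm (z :: real^'n))\<^sup>2)) * \<phi> x"
    proof (intro AE_I2 tendsto_mult tendsto_const)
      fix z :: "real^'n"
      have "(\<lambda>k. x + c k *\<^sub>R z) \<longlonglongrightarrow> x + 0 *\<^sub>R z" by (intro tendsto_intros c_lim)
      then have "(\<lambda>k. x + c k *\<^sub>R z) \<longlonglongrightarrow> x" by simp
      moreover have "isCont \<phi> x"
        using smooth_continuous_on[OF schwartz_space_smooth[OF \<phi>], of UNIV]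
        by (simp add: continuous_on_eq_continuous_at)
      ultimately show "(\<lambda>k. \<phi> (x + c k *\<^sub>R z)) \<longlonglongrightarrow> \<phi> x" by (rule isCont_tendsto_compose[rotated])
    qed
  qed measurable
  moreover have "(LINT z|lborel. complex_of_real (sqrt pi ^ ?n * exp (- pi\<^sup>2 * (norm (z :: real^'n))\<^sup>2)) * \<phi> x) = \<phi> x"
  proof -
    have "(LINT z|lborel. complex_of_real (sqrt pi ^ ?n * exp (- pi\<^sup>2 * (norm (z :: real^'n))\<^sup>2)))
        = complex_of_real (sqrt pi ^ ?n * sqrt (pi / pi\<^sup>2) ^ ?n)"
      unfolding integral_complex_of_real integral_mult_right_zero
      by (subst integral_gaussian) auto
    also have "sqrt pi ^ ?n * sqrt (pi / pi\<^sup>2) ^ ?n = 1"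
      by (simp add: power2_eq_square flip: power_mult_distrib real_sqrt_mult)
    finally show ?thesis by (simp only: integral_mult_left_zero) simp
  qed
  ultimately show ?thesis using LIMSEQ_unique[OF lim1] by simp
qed

lemma fourier_fourth_power:
  fixes \<phi> :: "real^'n::finite \<Rightarrow> complex"
  assumes \<phi>: "\<phi> \<in> schwartz_space"
  shows "fourier (fourier (fourier (fourier \<phi>))) = \<phi>"
proof
  fix x
  note S = schwartz_operator_closed[OF schwartz_operator_fourier]
  have "fourier (fourier (fourier (fourier \<phi>))) (- (- x)) = fourier (fourier \<phi>) (- x)"
    by (intro fourier_inversion S \<phi>)
  then show "fourier (fourier (fourier (fourier \<phi>))) x = \<phi> x" by (simp add: fourier_inversion[OF \<phi>])
qed

text \<open>Because the fourth power of the transform is the identity, its cube is the inverse.\<close>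

definition inv_fourier :: "(real^'n \<Rightarrow> complex) \<Rightarrow> real^'n \<Rightarrow> complex" where
  "inv_fourier \<phi> = fourier (fourier (fourier \<phi>))"

lemma schwartz_operator_inv_fourier: "schwartz_operator (inv_fourier :: (real^'n::finite \<Rightarrow> complex) \<Rightarrow> _)"
  unfolding inv_fourier_def [abs_def]
  by (rule schwartz_operator_comp[OF schwartz_operator_fourier
        schwartz_operator_comp[OF schwartz_operator_fourier schwartz_operator_fourier]])

lemma fourier_inv_fourier:
  fixes \<phi> :: "real^'n::finite \<Rightarrow> complex"
  assumes "\<phi> \<in> schwartz_space"
  shows "fourier (inv_fourier \<phi>) = \<phi>" "inv_fourier (fourier \<phi>) = \<phi>"
  unfolding inv_fourier_def using assms by (rule fourier_fourth_power)+

lemma fourier_dist_apply: "\<phi> \<in> schwartz_space \<Longrightarrow> fourier_dist T \<phi> = T (fourier \<phi>)"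
  by (simp add: fourier_dist_def)

lemma tempered_distribution_extensional: "T \<in> tempered_distributions \<Longrightarrow> T \<in> extensional schwartz_space"
  by (simp add: tempered_distributions_def)

text \<open>The Fourier transform maps the Schwartz space onto itself, so transformed test functions detect a
  distribution.\<close>

lemma distribution_eqI:
  fixes u v :: "('n::finite) functional"
  assumes "u \<in> extensional schwartz_space" "v \<in> extensional schwartz_space"
    and eq: "\<And>\<phi>. \<phi> \<in> schwartz_space \<Longrightarrow> u (fourier \<phi>) = v (fourier \<phi>)"
  shows "u = v"
proof (rule extensionalityI[OF assms(1,2)])
  fix \<phi> :: "real^'n \<Rightarrow> complex" assume \<phi>: "\<phi> \<in> schwartz_space"
  then have "inv_fourier \<phi> \<in> schwartz_space"
    by (rule schwartz_operator_closed[OF schwartz_operator_inv_fourier])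
  from eq[OF this] show "u \<phi> = v \<phi>" by (simp add: fourier_inv_fourier[OF \<phi>])
qed

lemma fourier_dist_inj:
  fixes u v :: "('n::finite) functional"
  assumes "u \<in> tempered_distributions" "v \<in> tempered_distributions" and eq: "fourier_dist u = fourier_dist v"
  shows "u = v"
  using assms(1,2)[THEN tempered_distribution_extensional]
  by (rule distribution_eqI) (metis eq fourier_dist_apply)

lemma fourier_multiplier_eqI:
  fixes T v :: "('n::finite) functional"
  assumes "v \<in> tempered_distributions" "fourier_dist v = mult_dist a (fourier_dist T)"
  shows "fourier_multiplier a T = v"
  unfolding fourier_multiplier_def
proof (rule the_equality)
  fix w assume "w \<in> tempered_distributions \<and> fourier_dist w = mult_dist a (fourier_dist T)"
  then show "w = v" using assms(2) by (simp add: fourier_dist_inj[OF _ assms(1)])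
qed (use assms in blast)

text \<open>The candidate is the transpose of \<open>\<phi> \<mapsto> F (a \<cdot> F\<^sup>-\<^sup>1 \<phi>)\<close>; it shows that the description by \<open>THE\<close> in the
  definition of multipliers has a solution.\<close>

lemma fourier_dist_fourier_multiplier:
  fixes T :: "('n::finite) functional"
  assumes T: "T \<in> tempered_distributions" and a: "slowly_increasing (\<lambda>\<xi>. complex_of_real (a \<xi>))"
  shows "fourier_dist (fourier_multiplier a T) = mult_dist a (fourier_dist T)"
proof -
  let ?L = "\<lambda>\<phi>. fourier (\<lambda>\<xi>. complex_of_real (a \<xi>) * inv_fourier \<phi> \<xi>)"
  define v where "v = (\<lambda>\<phi>\<in>schwartz_space. T (?L \<phi>))"
  note M = schwartz_operator_mult[OF a]
  have "schwartz_operator ?L"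
    by (rule schwartz_operator_comp[OF schwartz_operator_fourier
          schwartz_operator_comp[OF M schwartz_operator_inv_fourier]])
  then have v: "v \<in> tempered_distributions"
    unfolding v_def by (rule tempered_distribution_transpose[OF T])
  have eq: "fourier_dist v = mult_dist a (fourier_dist T)"
    unfolding fourier_dist_def mult_dist_def v_def
    using schwartz_operator_closed[OF schwartz_operator_fourier, where 'a='n] schwartz_operator_closed[OF M]
    by (intro restrict_ext) (simp add: fourier_inv_fourier)
  show ?thesis unfolding fourier_multiplier_eqI[OF v eq] by (rule eq)
qed

section \<open>Functions as distributions\<close>

lemma lebesgue_borel_representative:
  fixes f :: "real^'n \<Rightarrow> complex"
  assumes "f \<in> borel_measurable lebesgue"
  obtains g where "g \<in> borel_measurable borel" "AE x in lborel. f x = g x"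
proof -
  have "(\<lambda>x. Re (f x)) \<in> borel_measurable lebesgue" "(\<lambda>x. Im (f x)) \<in> borel_measurable lebesgue"
    using assms by measurable
  from this[THEN completion_ex_borel_measurable_real] obtain a b where
    ab: "a \<in> borel_measurable lborel" "b \<in> borel_measurable lborel"
      "AE x in lborel. Re (f x) = a x" "AE x in lborel. Im (f x) = b x" by blast
  note [measurable] = ab(1,2)[simplified]
  have "AE x in lborel. f x = Complex (a x) (b x)"
    using ab(3,4) by eventually_elim (simp add: complex_eq_iff)
  moreover have "(\<lambda>x. Complex (a x) (b x)) \<in> borel_measurable borel"
    unfolding Complex_eq by measurable
  ultimately show thesis using that by blast
qed

lemma integral_lebesgue_representative:
  fixes f g \<phi> :: "real^'n \<Rightarrow> complex"
  assumes "AE x in lborel. f x = g x" and f: "f \<in> borel_measurable lebesgue"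
    and [measurable]: "g \<in> borel_measurable borel" "\<phi> \<in> borel_measurable borel"
  shows "(LINT x|lebesgue. f x * \<phi> x) = (LINT x|lborel. g x * \<phi> x)"
proof -
  have m: "(\<lambda>x. g x * \<phi> x) \<in> borel_measurable lborel" by measurable
  have "(LINT x|lebesgue. f x * \<phi> x) = (LINT x|lebesgue. g x * \<phi> x)"
  proof (rule integral_cong_AE)
    have "\<phi> \<in> borel_measurable lebesgue" by (intro measurable_completion) simp
    with f show "(\<lambda>x. f x * \<phi> x) \<in> borel_measurable lebesgue" by (rule borel_measurable_times)
    show "(\<lambda>x. g x * \<phi> x) \<in> borel_measurable lebesgue" using m by (rule measurable_completion)
    show "AE x in lebesgue. f x * \<phi> x = g x * \<phi> x"
      unfolding AE_completion_iff using assms(1) by eventually_elim simp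
  qed
  also have "\<dots> = (LINT x|lborel. g x * \<phi> x)" by (rule integral_completion[OF m])
  finally show ?thesis .
qed

text \<open>Every Lebesgue space is contained in \<open>L\<^sup>1 + L\<^sup>\<infinity>\<close>, because \<open>\<bar>f\<bar> \<le> 1 + \<bar>f\<bar>\<^sup>p\<close>
  for finite \<open>p \<ge> 1\<close>.  Against a function that is both integrable and bounded, the two parts are integrable
  for obvious reasons, and this treats all exponents at once.\<close>

definition L1_plus_Linfty :: "(real^'n \<Rightarrow> complex) set" where
  "L1_plus_Linfty = {f \<in> borel_measurable borel. \<exists>M\<ge>0. \<exists>g :: real^'n \<Rightarrow> real. integrable lborel g \<and>
     (\<forall>x. 0 \<le> g x) \<and> (AE x in lborel. norm (f x) \<le> M + g x)}"

lemma L1_plus_LinftyE: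
  assumes "f \<in> L1_plus_Linfty"
  obtains M g where "f \<in> borel_measurable borel" "0 \<le> M" "integrable lborel g" "\<forall>x. 0 \<le> g x"
    "AE x in lborel. norm (f x) \<le> M + g x"
  using assms unfolding L1_plus_Linfty_def by blast

lemma L1_plus_Linfty_diff:
  assumes "f \<in> L1_plus_Linfty" "h \<in> L1_plus_Linfty"
  shows "(\<lambda>x. f x - h x) \<in> L1_plus_Linfty"
proof -
  obtain M g where f: "f \<in> borel_measurable borel" "0 \<le> M" "integrable lborel g" "\<forall>x. 0 \<le> g x"
    "AE x in lborel. norm (f x) \<le> M + g x" using assms(1) by (rule L1_plus_LinftyE)
  obtain M' g' where h: "h \<in> borel_measurable borel" "0 \<le> M'" "integrable lborel g'" "\<forall>x. 0 \<le> g' x"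
    "AE x in lborel. norm (h x) \<le> M' + g' x" using assms(2) by (rule L1_plus_LinftyE)
  have "AE x in lborel. norm (f x - h x) \<le> (M + M') + (g x + g' x)"
    using f(5) h(5)
  proof eventually_elim
    case (elim x)
    then show ?case using norm_triangle_ineq4[of "f x" "h x"] by linarith
  qed
  then show ?thesis
    unfolding L1_plus_Linfty_def
    using f h by (intro CollectI conjI exI[of _ "M + M'"] exI[of _ "\<lambda>x. g x + g' x"]) auto
qed

lemma Lp_space_representative:
  fixes f :: "real^'n \<Rightarrow> complex"
  assumes f: "f \<in> Lp_space p" and p: "1 \<le> p"
  obtains g where "g \<in> L1_plus_Linfty" "AE x in lborel. f x = g x"
proof -
  have fm: "f \<in> borel_measurable lebesgue" using f by (simp add: Lp_space_def)
  obtain g where g: "g \<in> borel_measurable borel" "AE x in lborel. f x = g x"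
    using lebesgue_borel_representative[OF fm] .
  note [measurable] = g(1)
  have "\<exists>M\<ge>0. \<exists>h :: real^'n \<Rightarrow> real. integrable lborel h \<and> (\<forall>x. 0 \<le> h x) \<and> (AE x in lborel. norm (g x) \<le> M + h x)"
  proof (cases "p = \<infinity>")
    case True
    let ?E = "esssup lebesgue (\<lambda>x. ennreal (norm (f x)))"
    have E: "?E < \<infinity>" using f True by (simp add: Lp_space_def)
    have "AE x in lborel. ennreal (norm (f x)) \<le> ?E"
      using esssup_AE[of "\<lambda>x. ennreal (norm (f x))" lebesgue] by (simp only: AE_completion_iff)
    then have "AE x in lborel. norm (g x) \<le> enn2real ?E + 0"
      using g(2)
    proof eventually_elim
      case (elim x)
      then have "enn2real (ennreal (norm (f x))) \<le> enn2real ?E" using E by (intro enn2real_mono) auto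
      then show ?case using elim by simp
    qed
    then show ?thesis by (intro exI[of _ "enn2real ?E"] conjI exI[of _ "\<lambda>_. 0"]) auto
  next
    case False
    let ?q = "enn2real p"
    have q: "1 \<le> ?q"
      using p False enn2real_mono[of 1 p] by (simp add: less_top)
    have int: "integrable lebesgue (\<lambda>x. norm (f x) powr ?q)" using f False by (simp add: Lp_space_def)
    have "integrable lebesgue (\<lambda>x. norm (g x) powr ?q)"
    proof (subst integrable_cong_AE)
      show "AE x in lebesgue. norm (g x) powr ?q = norm (f x) powr ?q"
        unfolding AE_completion_iff using g(2) by eventually_elim simp
    qed (use int in \<open>auto intro!: measurable_completion\<close>)
    then have "integrable lborel (\<lambda>x. norm (g x) powr ?q)" by (subst (asm) integrable_completion) auto
    moreover have "norm (g x) \<le> 1 + norm (g x) powr ?q" for x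
    proof (cases "norm (g x) \<le> 1")
      case True
      then show ?thesis by (simp add: add_increasing2)
    next
      case False
      then have "norm (g x) powr 1 \<le> norm (g x) powr ?q" using q by (intro powr_mono) auto
      then show ?thesis using False by simp
    qed
    ultimately show ?thesis
      by (intro exI[of _ "1::real"] conjI exI[of _ "\<lambda>x. norm (g x) powr ?q"]) auto
  qed
  then have "g \<in> L1_plus_Linfty" using g(1) by (simp add: L1_plus_Linfty_def)
  then show thesis using that g(2) by blast
qed

lemma integrable_L1_plus_Linfty_mult:
  fixes f \<phi> :: "real^'n::finite \<Rightarrow> complex"
  assumes f: "f \<in> L1_plus_Linfty" and \<phi>: "integrable lborel \<phi>" and B: "\<And>x. norm (\<phi> x) \<le> B"
  shows "integrable lborel (\<lambda>x. f x * \<phi> x)"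
proof -
  obtain M g where g: "f \<in> borel_measurable borel" "0 \<le> M" "integrable lborel g" "\<forall>x. 0 \<le> g x"
    "AE x in lborel. norm (f x) \<le> M + g x" using f by (rule L1_plus_LinftyE)
  note [measurable] = g(1) borel_measurable_integrable[OF \<phi>, simplified]
  show ?thesis
  proof (rule Bochner_Integration.integrable_bound)
    show "integrable lborel (\<lambda>x. M * norm (\<phi> x) + g x * B)" using g(3) \<phi> by auto
    show "AE x in lborel. norm (f x * \<phi> x) \<le> norm (M * norm (\<phi> x) + g x * B)"
      using g(5)
    proof eventually_elim
      case (elim x)
      have "norm (f x) * norm (\<phi> x) \<le> (M + g x) * norm (\<phi> x)" using elim by (intro mult_right_mono) auto
      also have "\<dots> \<le> M * norm (\<phi> x) + g x * B"
        using mult_left_mono[OF B g(4)[rule_format]] by (simp add: distrib_right)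
      finally show ?case by (simp add: norm_mult)
    qed
  qed measurable
qed

lemma regular_dist_representative:
  fixes f g \<phi> :: "real^'n \<Rightarrow> complex"
  assumes "AE x in lborel. f x = g x" "f \<in> borel_measurable lebesgue" "g \<in> borel_measurable borel"
    and \<phi>: "\<phi> \<in> schwartz_space"
  shows "regular_dist f \<phi> = (LINT x|lborel. g x * \<phi> x)"
  unfolding regular_dist_def using integral_lebesgue_representative[OF assms(1-3) schwartz_borel_measurable[OF \<phi>]] \<phi>
  by simp

subsection \<open>A function is determined by its distribution\<close>

text \<open>The positive and the negative part of \<open>f\<close> define finite measures that agree on all boxes, an
  intersection-stable generator of the Borel sets.\<close>

lemma AE_zero_of_box_integrals:
  fixes f :: "'a::euclidean_space \<Rightarrow> real"
  assumes f: "integrable lborel f" and box: "\<And>a b. (LINT x|lborel. indicator (box a b) x * f x) = 0"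
  shows "AE x in lborel. f x = 0"
proof -
  note [measurable] = borel_measurable_integrable[OF f, simplified]
  let ?p = "\<lambda>x. ennreal (max (f x) 0)" and ?n = "\<lambda>x. ennreal (max (- f x) 0)"
  have int: "integrable lborel (\<lambda>x. max (f x) 0)" "integrable lborel (\<lambda>x. max (- f x) 0)"
    using f by (auto intro!: integrable_max)
  have fin: "(\<integral>\<^sup>+x. ?p x \<partial>lborel) \<noteq> \<infinity>"
    using int(1) by (subst nn_integral_eq_integral) auto
  have "density lborel ?p = density lborel ?n"
  proof (rule measure_eqI_generator_eq)
    let ?E = "range (\<lambda>(a, b). box a b :: 'a set)"
    show "Int_stable ?E" by (auto simp: Int_stable_def box_Int_box)
    show "?E \<subseteq> Pow UNIV" "sets (density lborel ?p) = sigma_sets UNIV ?E" "sets (density lborel ?n) = sigma_sets UNIV ?E"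
      by (simp_all add: borel_eq_box)
    let ?A = "\<lambda>n::nat. box (- (real n *\<^sub>R One)) (real n *\<^sub>R One) :: 'a set"
    show "range ?A \<subseteq> ?E" "(\<Union>i. ?A i) = UNIV" unfolding UN_box_eq_UNIV by auto
    show "emeasure (density lborel ?p) (?A i) \<noteq> \<infinity>" for i
    proof -
      have "emeasure (density lborel ?p) (?A i) \<le> (\<integral>\<^sup>+x. ?p x \<partial>lborel)"
        by (auto simp: emeasure_density intro!: nn_integral_mono split: split_indicator)
      then show ?thesis using fin by (auto simp: top_unique)
    qed
    fix X :: "'a set" assume "X \<in> ?E"
    then obtain a b where X: "X = box a b" by auto
    have ip: "integrable lborel (\<lambda>x. indicator X x * max (f x) 0)"
      and "in": "integrable lborel (\<lambda>x. indicator X x * max (- f x) 0)"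
      using integrable_mult_indicator[OF _ int(1), of X] integrable_mult_indicator[OF _ int(2), of X]
      by (auto simp: X)
    have "(LINT x|lborel. indicator X x * max (f x) 0) - (LINT x|lborel. indicator X x * max (- f x) 0)
        = (LINT x|lborel. indicator X x * f x)"
      by (subst Bochner_Integration.integral_diff[symmetric, OF ip "in"])
        (auto intro!: Bochner_Integration.integral_cong simp: max_def split: split_indicator)
    then have "(LINT x|lborel. indicator X x * max (f x) 0) = (LINT x|lborel. indicator X x * max (- f x) 0)"
      using box[of a b] by (simp add: X)
    moreover have "emeasure (density lborel ?p) X = ennreal (LINT x|lborel. indicator X x * max (f x) 0)"
      using nn_integral_eq_integral[OF ip]
      by (auto simp: emeasure_density X ennreal_mult' ennreal_indicator mult.commute)
    moreover have "emeasure (density lborel ?n) X = ennreal (LINT x|lborel. indicator X x * max (- f x) 0)"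
      using nn_integral_eq_integral[OF "in"]
      by (auto simp: emeasure_density X ennreal_mult' ennreal_indicator mult.commute)
    ultimately show "emeasure (density lborel ?p) X = emeasure (density lborel ?n) X" by simp
  qed
  then have "AE x in lborel. ?p x = ?n x"
    using fin by (subst (asm) finite_density_unique) auto
  then show ?thesis by eventually_elim (auto simp: max_def split: if_splits)
qed

text \<open>After rescaling the integration variable around \<open>x\<close>, the indicator of the box converges pointwise, since
  it is locally constant off the boundary.\<close>

lemma gaussian_smoothing_box:
  fixes x :: "'a::euclidean_space"
  assumes x: "x \<notin> cbox a b - box a b"
  defines "\<Phi> \<equiv> \<lambda>k. LINT y|lborel. indicator (box a b) y * ((sqrt (real (Suc k) ^ 2 / pi)) ^ DIM('a) * exp (- (real (Suc k) ^ 2) * (norm (x - y))\<^sup>2))"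
  shows "\<Phi> \<longlonglongrightarrow> indicator (box a b) x"
    and "norm (\<Phi> k) \<le> 1"
proof -
  define c where "c k = inverse (real (Suc k))" for k
  have c: "0 < c k" "real (Suc k) = inverse (c k)" for k by (simp_all add: c_def)
  have c_lim: "c \<longlonglongrightarrow> 0" unfolding c_def by (rule LIMSEQ_inverse_real_of_nat)
  let ?g = "\<lambda>z :: 'a. sqrt (1 / pi) ^ DIM('a) * exp (- 1 * (norm z)\<^sup>2)"
  have g: "integrable lborel ?g" by (intro integrable_mult_right integrable_gaussian) simp
  have g1: "(LINT z|lborel. ?g z) = 1"
    unfolding integral_mult_right_zero
    by (subst integral_gaussian) (simp_all flip: power_mult_distrib real_sqrt_mult)
  have \<Phi>: "\<Phi> k = (LINT z|lborel. indicator (box a b) (x + c k *\<^sub>R z) * ?g z)" for k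
  proof -
    have eq: "c k ^ DIM('a) *\<^sub>R (indicator (box a b) (x + c k *\<^sub>R z) * (sqrt (real (Suc k) ^ 2 / pi) ^ DIM('a)
        * exp (- (real (Suc k) ^ 2) * (norm (x - (x + c k *\<^sub>R z)))\<^sup>2)))
        = indicator (box a b) (x + c k *\<^sub>R z) * ?g z" for z
    proof -
      have e1: "c k ^ DIM('a) * sqrt (real (Suc k) ^ 2 / pi) ^ DIM('a) = sqrt (1 / pi) ^ DIM('a)"
        unfolding c(2) using c(1)[of k] by (simp add: real_sqrt_divide flip: power_mult_distrib)
      have e2: "- (real (Suc k) ^ 2) * (norm (x - (x + c k *\<^sub>R z)))\<^sup>2 = - 1 * (norm z)\<^sup>2"
        unfolding c(2) using c(1)[of k] by (simp add: power_mult_distrib field_simps)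
      have gen: "u *\<^sub>R (i * (v * e)) = i * ((u * v) * e)" for u i v e :: real by simp
      show ?thesis unfolding gen e1 e2 ..
    qed
    let ?f = "\<lambda>y. indicator (box a b) y * ((sqrt (real (Suc k) ^ 2 / pi)) ^ DIM('a) * exp (- (real (Suc k) ^ 2) * (norm (x - y))\<^sup>2))"
    have "c k \<noteq> 0" using c(1)[of k] by simp
    moreover have "?f \<in> borel_measurable borel" by measurable
    ultimately have "\<Phi> k = \<bar>c k\<bar> ^ DIM('a) *\<^sub>R (LINT z|lborel. ?f (x + c k *\<^sub>R z))"
      unfolding \<Phi>_def by (rule integral_lborel_affine[rotated])
    then show ?thesis using c(1)[of k] by (simp only: abs_of_pos integral_scaleR_right[symmetric] eq)
  qed
  show "\<Phi> \<longlonglongrightarrow> indicator (box a b) x"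
  proof -
    have "(\<lambda>k. LINT z|lborel. indicator (box a b) (x + c k *\<^sub>R z) * ?g z)
        \<longlonglongrightarrow> (LINT z|lborel. indicator (box a b) x * ?g z)"
    proof (rule integral_dominated_convergence[OF _ _ g])
      show "AE z in lborel. norm (indicator (box a b) (x + c k *\<^sub>R z) * ?g z) \<le> ?g z" for k
        by (intro AE_I2) (auto split: split_indicator)
      show "AE z in lborel. (\<lambda>k. indicator (box a b) (x + c k *\<^sub>R z) * ?g z) \<longlonglongrightarrow> indicator (box a b) x * ?g z"
      proof (intro AE_I2 tendsto_mult tendsto_const)
        fix z :: 'a
        have "(\<lambda>k. x + c k *\<^sub>R z) \<longlonglongrightarrow> x + 0 *\<^sub>R z" by (intro tendsto_intros c_lim)
        then have lim: "(\<lambda>k. x + c k *\<^sub>R z) \<longlonglongrightarrow> x" by simp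
        have "\<forall>\<^sub>F k in sequentially. (indicator (box a b) (x + c k *\<^sub>R z) :: real) = indicator (box a b) x"
        proof (cases "x \<in> box a b")
          case True
          from topological_tendstoD[OF lim open_box this] show ?thesis
            by eventually_elim (simp add: True)
        next
          case False
          with x have "x \<in> - cbox a b" by blast
          from topological_tendstoD[OF lim open_Compl[OF closed_cbox] this]
          have "\<forall>\<^sub>F k in sequentially. x + c k *\<^sub>R z \<in> - cbox a b" .
          then show ?thesis
            by eventually_elim (use False box_subset_cbox[of a b] in \<open>auto simp: indicator_def\<close>)
        qed
        then show "(\<lambda>k. indicator (box a b) (x + c k *\<^sub>R z) :: real) \<longlonglongrightarrow> indicator (box a b) x"
          by (rule tendsto_eventually)
      qed
    qed measurable
    moreover have "(LINT z|lborel. indicator (box a b) x * ?g z) = indicator (box a b) x"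
      by (subst integral_mult_right_zero, subst g1) simp
    moreover have "\<Phi> = (\<lambda>k. LINT z|lborel. indicator (box a b) (x + c k *\<^sub>R z) * ?g z)"
      by (rule ext) (rule \<Phi>)
    ultimately show ?thesis by (simp only:)
  qed
  have "norm (\<Phi> k) \<le> (LINT z|lborel. norm (indicator (box a b) (x + c k *\<^sub>R z) * ?g z))"
    unfolding \<Phi> by (rule integral_norm_bound)
  also have "\<dots> \<le> (LINT z|lborel. ?g z)"
    by (rule integral_mono_AE'[OF g]) (auto intro!: AE_I2 split: split_indicator)
  finally show "norm (\<Phi> k) \<le> 1" unfolding g1 .
qed

text \<open>The weight \<open>exp (- \<bar>x\<bar>\<^sup>2)\<close> turns \<open>h\<close> into an integrable function \<open>w\<close> whose integrals against all Gaussians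
  vanish.  Integrating the centre of the Gaussian over a box and letting it concentrate shows that \<open>w\<close> has
  integral 0 over the box.\<close>

lemma AE_zero_of_schwartz_integrals:
  fixes h :: "real^'n::finite \<Rightarrow> complex"
  assumes h: "h \<in> L1_plus_Linfty" and zero: "\<And>\<phi>. \<phi> \<in> schwartz_space \<Longrightarrow> (LINT x|lborel. h x * \<phi> x) = 0"
  shows "AE x in lborel. h x = 0"
proof -
  have [measurable]: "h \<in> borel_measurable borel" using h by (simp add: L1_plus_Linfty_def)
  define w where "w x = h x * complex_of_real (exp (- (norm x)\<^sup>2))" for x
  have w: "integrable lborel w"
    unfolding w_def
    by (rule integrable_L1_plus_Linfty_mult[OF h, of _ 1])
      (use integrable_gaussian[of 1, where 'a="real^'n"] in \<open>simp_all add: complex_of_real_integrable_eq\<close>)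
  note [measurable] = borel_measurable_integrable[OF w, simplified]
  have w_gauss: "(LINT x|lborel. w x * complex_of_real (exp (- t * (norm (x - y))\<^sup>2))) = 0" if "0 \<le> t" for t y
    using zero[OF gaussian_schwartz[OF that, of y]]
    by (simp add: w_def exp_diff exp_minus divide_inverse mult.assoc)
  have box: "(LINT x|lborel. w x * indicator (box a b) x) = 0" for a b
  proof -
    define G where "G k x y = indicator (box a b) y * ((sqrt (real (Suc k) ^ 2 / pi)) ^ DIM(real^'n) * exp (- (real (Suc k) ^ 2) * (norm (x - y))\<^sup>2))"
      for k and x y :: "real^'n"
    have [measurable]: "(\<lambda>(x, y). G k x y) \<in> borel_measurable (borel \<Otimes>\<^sub>M borel)" for k
      unfolding G_def by measurable
    have "AE x in lborel. x \<notin> cbox a b - box a b"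
    proof -
      have "cbox a b - box a b \<in> null_sets lebesgue"
        using negligible_frontier_interval negligible_iff_null_sets by blast
      then show ?thesis using AE_not_in AE_completion_iff by blast
    qed
    note off = this
    have "(\<lambda>k. LINT x|lborel. w x * complex_of_real (LINT y|lborel. G k x y))
        \<longlonglongrightarrow> (LINT x|lborel. w x * complex_of_real (indicator (box a b) x))"
    proof (rule integral_dominated_convergence)
      show "integrable lborel (\<lambda>x. norm (w x))" using w by (rule integrable_norm)
      show "AE x in lborel. (\<lambda>k. w x * complex_of_real (LINT y|lborel. G k x y)) \<longlonglongrightarrow> w x * complex_of_real (indicator (box a b) x)"
        using off
      proof eventually_elim
        case (elim x)
        then show ?case
          unfolding G_def by (intro tendsto_mult tendsto_const tendsto_of_real gaussian_smoothing_box)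
      qed
      show "AE x in lborel. norm (w x * complex_of_real (LINT y|lborel. G k x y)) \<le> norm (w x)" for k
        using off
      proof eventually_elim
        case (elim x)
        from gaussian_smoothing_box(2)[OF this, of k] show ?case
          by (simp add: G_def norm_mult mult_left_le)
      qed
    qed measurable
    moreover have "(LINT x|lborel. w x * complex_of_real (LINT y|lborel. G k x y)) = 0" for k
    proof -
      let ?C = "(sqrt (real (Suc k) ^ 2 / pi)) ^ DIM(real^'n)"
      have int: "integrable (lborel \<Otimes>\<^sub>M lborel) (\<lambda>(x, y). w x * complex_of_real (G k x y))"
      proof (rule Bochner_Integration.integrable_bound)
        show "integrable (lborel \<Otimes>\<^sub>M lborel) (\<lambda>(x, y). norm (w x) * (?C * indicator (box a b) y))"
        proof (rule lborel_pair.Fubini_integrable)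
          have "integrable lborel (\<lambda>y. ?C * indicator (box a b) (y :: real^'n) :: real)"
            by (intro integrable_mult_right integrable_real_indicator)
              (auto simp: emeasure_lborel_box_eq)
          then show "AE x in lborel. integrable lborel (\<lambda>y. case (x, y) of (x, y) \<Rightarrow> norm (w x) * (?C * indicator (box a b) y))"
            by auto
          show "integrable lborel (\<lambda>x. LINT y|lborel. norm (case (x, y) of (x, y) \<Rightarrow> norm (w x) * (?C * indicator (box a b) y)))"
            using w by (simp add: abs_mult)
        qed measurable
        show "AE z in lborel \<Otimes>\<^sub>M lborel. norm (case z of (x, y) \<Rightarrow> w x * complex_of_real (G k x y))
            \<le> norm (case z of (x, y) \<Rightarrow> norm (w x) * (?C * indicator (box a b) y))"
        proof (rule AE_I2)
          fix z :: "(real^'n) \<times> (real^'n)"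
          obtain x y where z: "z = (x, y)" by (cases z)
          have "?C * exp (- (real (Suc k) ^ 2) * (norm (x - y))\<^sup>2) \<le> ?C * 1"
            by (intro mult_left_mono) auto
          then have "\<bar>G k x y\<bar> \<le> ?C * indicator (box a b) y"
            unfolding G_def by (cases "y \<in> box a b") (simp_all add: abs_mult)
          then have "norm (w x) * \<bar>G k x y\<bar> \<le> norm (w x) * (?C * indicator (box a b) y)"
            by (intro mult_left_mono) auto
          then show "norm (case z of (x, y) \<Rightarrow> w x * complex_of_real (G k x y))
              \<le> norm (case z of (x, y) \<Rightarrow> norm (w x) * (?C * indicator (box a b) y))"
            unfolding z case_prod_conv norm_mult norm_of_real real_norm_def by (simp add: abs_mult)
        qed
      qed measurable
      have "(LINT x|lborel. w x * complex_of_real (LINT y|lborel. G k x y))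
          = (LINT x|lborel. LINT y|lborel. w x * complex_of_real (G k x y))"
        by (simp flip: integral_complex_of_real)
      also have "\<dots> = (LINT y|lborel. LINT x|lborel. w x * complex_of_real (G k x y))"
        by (rule lborel_pair.Fubini_integral[OF int, symmetric])
      also have "\<dots> = (LINT y :: real^'n|lborel. 0)"
      proof (rule Bochner_Integration.integral_cong[OF refl])
        fix y :: "real^'n"
        have "w x * complex_of_real (G k x y) = complex_of_real (indicator (box a b) y * ?C)
            * (w x * complex_of_real (exp (- (real (Suc k) ^ 2) * (norm (x - y))\<^sup>2)))" for x
          by (simp add: G_def mult_ac)
        then show "(LINT x|lborel. w x * complex_of_real (G k x y)) = 0"
          by (simp only: integral_mult_right_zero w_gauss[OF zero_le_power2] mult_zero_right)
      qed
      finally show ?thesis by simp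
    qed
    ultimately have "(\<lambda>k :: nat. 0) \<longlonglongrightarrow> (LINT x|lborel. w x * complex_of_real (indicator (box a b) x))" by simp
    then have "(LINT x|lborel. w x * complex_of_real (indicator (box a b) x)) = 0"
      using LIMSEQ_unique tendsto_const by blast
    moreover have "complex_of_real (indicator (box a b) x) = indicator (box a b) x" for x :: "real^'n"
      by (simp split: split_indicator)
    ultimately show ?thesis by (simp only:)
  qed
  have ib: "integrable lborel (\<lambda>x. w x * indicator (box a b) x)" for a b
  proof -
    have "indicator (box a b) x *\<^sub>R w x = w x * indicator (box a b) x" for x :: "real^'n"
      by (simp split: split_indicator)
    then show ?thesis using integrable_mult_indicator[of "box a b" lborel, OF _ w] by simp
  qed
  have "AE x in lborel. Re (w x) = 0"
  proof (rule AE_zero_of_box_integrals)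
    show "(LINT x|lborel. indicator (box a b) x * Re (w x)) = 0" for a b
    proof -
      have "indicator (box a b) x * Re (w x) = Re (w x * indicator (box a b) x)" for x
        by (simp split: split_indicator)
      then show ?thesis using integral_Re[OF ib[of a b]] by (simp add: box)
    qed
  qed (use w in simp)
  moreover have "AE x in lborel. Im (w x) = 0"
  proof (rule AE_zero_of_box_integrals)
    show "(LINT x|lborel. indicator (box a b) x * Im (w x)) = 0" for a b
    proof -
      have "indicator (box a b) x * Im (w x) = Im (w x * indicator (box a b) x)" for x
        by (simp split: split_indicator)
      then show ?thesis using integral_Im[OF ib[of a b]] by (simp add: box)
    qed
  qed (use w in simp)
  ultimately show ?thesis
    by eventually_elim (auto simp: w_def complex_eq_iff)
qed

lemma regular_dist_inj_AE:
  fixes f g :: "real^'n::finite \<Rightarrow> complex"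
  assumes p: "1 \<le> p" and f: "f \<in> Lp_space p" and g: "g \<in> Lp_space p" and eq: "regular_dist f = regular_dist g"
  shows "AE x in lborel. f x = g x"
proof -
  obtain f' where f': "f' \<in> L1_plus_Linfty" "AE x in lborel. f x = f' x"
    using Lp_space_representative[OF f p] .
  obtain g' where g': "g' \<in> L1_plus_Linfty" "AE x in lborel. g x = g' x"
    using Lp_space_representative[OF g p] .
  have meas: "f \<in> borel_measurable lebesgue" "g \<in> borel_measurable lebesgue"
    "f' \<in> borel_measurable borel" "g' \<in> borel_measurable borel"
    using f g f' g' by (auto simp: Lp_space_def L1_plus_Linfty_def)
  have "AE x in lborel. f' x - g' x = 0"
  proof (rule AE_zero_of_schwartz_integrals[OF L1_plus_Linfty_diff[OF f'(1) g'(1)]])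
    fix \<phi> :: "real^'n \<Rightarrow> complex" assume \<phi>: "\<phi> \<in> schwartz_space"
    have bound: "norm (\<phi> x) \<le> schwartz_norm 0 \<phi>" for x
      using schwartz_norm_decay[OF \<phi>, of "[]" 0 x] by simp
    have "(LINT x|lborel. f' x * \<phi> x) = (LINT x|lborel. g' x * \<phi> x)"
      using regular_dist_representative[OF f'(2) meas(1,3) \<phi>] regular_dist_representative[OF g'(2) meas(2,4) \<phi>] eq
      by simp
    then show "(LINT x|lborel. (f' x - g' x) * \<phi> x) = 0"
      using integrable_L1_plus_Linfty_mult[OF f'(1) schwartz_integrable[OF \<phi>] bound]
        integrable_L1_plus_Linfty_mult[OF g'(1) schwartz_integrable[OF \<phi>] bound]
      by (simp add: left_diff_distrib)
  qed
  with f'(2) g'(2) show ?thesis by eventually_elim simp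
qed

lemma Lp_norm_cong_AE:
  fixes f g :: "real^'n \<Rightarrow> complex"
  assumes f: "f \<in> borel_measurable lebesgue" and g: "g \<in> borel_measurable lebesgue"
    and ae: "AE x in lborel. f x = g x"
  shows "Lp_norm p f = Lp_norm p g"
proof -
  have ae': "AE x in lebesgue. f x = g x" using ae by (rule AE_completion)
  have meas: "(\<lambda>x. ennreal (norm (f x))) \<in> borel_measurable lebesgue" "(\<lambda>x. ennreal (norm (g x))) \<in> borel_measurable lebesgue"
    using f g by measurable
  have "esssup lebesgue (\<lambda>x. ennreal (norm (f x))) = esssup lebesgue (\<lambda>x. ennreal (norm (g x)))"
  proof (rule antisym)
    show "esssup lebesgue (\<lambda>x. ennreal (norm (f x))) \<le> esssup lebesgue (\<lambda>x. ennreal (norm (g x)))"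
    proof (rule esssup_I)
      show "AE x in lebesgue. ennreal (norm (f x)) \<le> esssup lebesgue (\<lambda>x. ennreal (norm (g x)))"
        using esssup_AE[of "\<lambda>x. ennreal (norm (g x))" lebesgue] ae' by eventually_elim simp
    qed (rule meas)
    show "esssup lebesgue (\<lambda>x. ennreal (norm (g x))) \<le> esssup lebesgue (\<lambda>x. ennreal (norm (f x)))"
    proof (rule esssup_I)
      show "AE x in lebesgue. ennreal (norm (g x)) \<le> esssup lebesgue (\<lambda>x. ennreal (norm (f x)))"
        using esssup_AE[of "\<lambda>x. ennreal (norm (f x))" lebesgue] ae' by eventually_elim simp
    qed (rule meas)
  qed
  moreover have "(LINT x|lebesgue. norm (f x) powr enn2real p) = (LINT x|lebesgue. norm (g x) powr enn2real p)"
    by (rule integral_cong_AE) (use f g ae' in auto)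
  ultimately show ?thesis by (simp add: Lp_norm_def)
qed

lemma Lp_dist_norm_regular_dist:
  fixes f :: "real^'n::finite \<Rightarrow> complex"
  assumes p: "1 \<le> p" and f: "f \<in> Lp_space p"
  shows "Lp_dist_norm p (regular_dist f) = Lp_norm p f"
proof -
  define g where "g = (SOME g. g \<in> Lp_space p \<and> regular_dist g = regular_dist f)"
  have g: "g \<in> Lp_space p \<and> regular_dist g = regular_dist f"
    unfolding g_def by (rule someI[of _ f]) (use f in simp)
  have "Lp_norm p g = Lp_norm p f"
  proof (rule Lp_norm_cong_AE)
    show "AE x in lborel. g x = f x" using regular_dist_inj_AE[OF p _ f] g by blast
  qed (use f g in \<open>simp_all add: Lp_space_def\<close>)
  then show ?thesis by (simp add: Lp_dist_norm_def g_def)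
qed

section \<open>The logarithmic Bessel kernel\<close>

subsection \<open>The reciprocal symbol as a Laplace transform\<close>

text \<open>For \<open>w > 1\<close> integrate \<open>w powr - \<tau> = (\<integral>\<^sub>0\<^sup>\<infinity> t powr (\<tau> - 1) e\<^sup>-\<^sup>t\<^sup>w dt) / \<Gamma>(\<tau>)\<close> over \<open>\<tau> \<ge> s\<close>: the left-hand side
  gives \<open>w powr - s / ln w\<close>, which is therefore the Laplace transform of the following weight.\<close>

definition log_weight :: "real \<Rightarrow> real \<Rightarrow> real" where
  "log_weight s t = enn2real (\<integral>\<^sup>+\<tau>. ennreal (indicator {0..} t * t powr (\<tau> - 1) * (indicator {s..} \<tau> / Gamma \<tau>)) \<partial>lborel)"

lemma log_weight_nonneg: "0 \<le> log_weight s t"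
  by (simp add: log_weight_def)

lemma log_weight_nonpos: "t \<le> 0 \<Longrightarrow> log_weight s t = 0"
  by (cases "t = 0") (simp_all add: log_weight_def)

lemma reciprocal_Gamma_measurable:
  assumes s: "0 < s"
  shows "(\<lambda>\<tau>. indicator {s..} \<tau> / Gamma \<tau> :: real) \<in> borel_measurable borel"
proof -
  have "continuous_on {s..} (\<lambda>\<tau>. inverse (Gamma \<tau>) :: real)"
    using s by (intro continuous_intros)
      (auto simp: Gamma_eq_zero_iff elim!: nonpos_Ints_cases)
  then have "(\<lambda>\<tau>. indicator {s..} \<tau> *\<^sub>R inverse (Gamma \<tau>) :: real) \<in> borel_measurable borel"
    by (intro borel_measurable_continuous_on_indicator) auto
  then show ?thesis by (simp add: divide_inverse)
qed

lemma nn_integral_Gamma_scaled: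
  fixes w \<tau> :: real
  assumes w: "0 < w" and \<tau>: "0 < \<tau>"
  shows "(\<integral>\<^sup>+t. ennreal (indicator {0..} t * t powr (\<tau> - 1) * exp (- w * t)) \<partial>lborel) = ennreal (Gamma \<tau> * w powr - \<tau>)"
proof -
  let ?I = "\<integral>\<^sup>+t. ennreal (indicator {0..} t * t powr (\<tau> - 1) * exp (- w * t)) \<partial>lborel"
  have "ennreal (Gamma \<tau>) = (\<integral>\<^sup>+t. ennreal (indicator {0..} t * t powr (\<tau> - 1) / exp t) \<partial>lborel)"
    by (rule Gamma_conv_nn_integral_real[OF \<tau>])
  also have "\<dots> = ennreal \<bar>w\<bar> * (\<integral>\<^sup>+t. ennreal (indicator {0..} (0 + w * t) * (0 + w * t) powr (\<tau> - 1) / exp (0 + w * t)) \<partial>lborel)"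
    using w by (intro nn_integral_real_affine) auto
  also have "(\<lambda>t. ennreal (indicator {0..} (0 + w * t) * (0 + w * t) powr (\<tau> - 1) / exp (0 + w * t)))
      = (\<lambda>t. ennreal (w powr (\<tau> - 1)) * ennreal (indicator {0..} t * t powr (\<tau> - 1) * exp (- w * t)))"
    using w by (auto simp: fun_eq_iff indicator_def zero_le_mult_iff powr_mult exp_minus divide_inverse mult_ac
        simp flip: ennreal_mult)
  also have "(\<integral>\<^sup>+t. ennreal (w powr (\<tau> - 1)) * ennreal (indicator {0..} t * t powr (\<tau> - 1) * exp (- w * t)) \<partial>lborel)
      = ennreal (w powr (\<tau> - 1)) * ?I"
    by (rule nn_integral_cmult) measurable
  also have "ennreal \<bar>w\<bar> * (ennreal (w powr (\<tau> - 1)) * ?I) = ennreal (w powr \<tau>) * ?I"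
  proof -
    have "w * w powr (\<tau> - 1) = w powr \<tau>" using w by (simp add: powr_diff)
    then have "ennreal \<bar>w\<bar> * ennreal (w powr (\<tau> - 1)) = ennreal (w powr \<tau>)"
      using w by (simp flip: ennreal_mult)
    then show ?thesis by (simp flip: mult.assoc)
  qed
  finally have "ennreal (w powr - \<tau>) * ennreal (Gamma \<tau>) = ennreal (w powr - \<tau>) * (ennreal (w powr \<tau>) * ?I)" by simp
  also have "\<dots> = ennreal (w powr - \<tau> * w powr \<tau>) * ?I" by (simp add: ennreal_mult mult.assoc)
  also have "w powr - \<tau> * w powr \<tau> = 1" using w by (simp flip: powr_add)
  finally show ?thesis using \<tau> by (simp add: mult.commute Gamma_real_pos less_imp_le flip: ennreal_mult)
qed

text \<open>The antiderivative in the exponent is \<open>- w powr - \<tau> / ln w\<close>; this is where the logarithm of the symbol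
  comes from.\<close>

lemma nn_integral_powr_exponent:
  fixes w s :: real
  assumes w: "1 < w"
  shows "(\<integral>\<^sup>+\<tau>. ennreal (w powr - \<tau>) * indicator {s..} \<tau> \<partial>lborel) = ennreal (w powr - s / ln w)"
proof -
  have lnw: "0 < ln w" using w by simp
  have "(\<integral>\<^sup>+\<tau>. ennreal (w powr - \<tau>) * indicator {s..} \<tau> \<partial>lborel) = ennreal (0 - (- (w powr - s) / ln w))"
  proof (rule nn_integral_FTC_atLeast)
    show "((\<lambda>\<tau>. - (w powr - \<tau>) / ln w) has_real_derivative w powr - \<tau>) (at \<tau>)" for \<tau>
      using w lnw by (auto intro!: derivative_eq_intros simp: powr_def)
    have "((\<lambda>\<tau>. - exp (- (ln w * \<tau>)) / ln w) \<longlongrightarrow> - 0 / ln w) at_top"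
    proof (intro tendsto_intros)
      have "filterlim (\<lambda>\<tau>. ln w * \<tau>) at_top at_top"
        using lnw by (intro filterlim_tendsto_pos_mult_at_top[OF tendsto_const]) (auto simp: filterlim_ident)
      then show "((\<lambda>\<tau>. exp (- (ln w * \<tau>))) \<longlongrightarrow> 0) at_top"
        by (intro filterlim_compose[OF exp_at_bot]) (simp add: filterlim_uminus_at_bot)
    qed (use lnw in auto)
    then show "((\<lambda>\<tau>. - (w powr - \<tau>) / ln w) \<longlongrightarrow> 0) at_top"
      using w by (simp add: powr_def mult.commute)
  qed (use w in auto)
  then show ?thesis by simp
qed

lemma log_weight_measurable:
  assumes s: "0 < s"
  shows "(\<lambda>t. \<integral>\<^sup>+\<tau>. ennreal (indicator {0..} t * t powr (\<tau> - 1) * (indicator {s..} \<tau> / Gamma \<tau>)) \<partial>lborel) \<in> borel_measurable borel"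
    and "log_weight s \<in> borel_measurable borel"
proof -
  note [measurable] = reciprocal_Gamma_measurable[OF s]
  show m: "(\<lambda>t. \<integral>\<^sup>+\<tau>. ennreal (indicator {0..} t * t powr (\<tau> - 1) * (indicator {s..} \<tau> / Gamma \<tau>)) \<partial>lborel) \<in> borel_measurable borel"
    by measurable
  show "log_weight s \<in> borel_measurable borel"
    unfolding log_weight_def [abs_def] using m by measurable
qed

text \<open>Tonelli's theorem for the double integral over \<open>t\<close> and \<open>\<tau>\<close>.  Its finiteness also shows that the
  extended real integral that defines the weight is finite for almost every \<open>t\<close>.\<close>

lemma log_weight_laplace:
  fixes s w :: real
  assumes s: "0 < s" and w: "1 < w"
  shows "integrable lborel (\<lambda>t. log_weight s t * exp (- w * t))"
    and "(LINT t|lborel. log_weight s t * exp (- w * t)) = w powr - s / ln w"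
proof -
  note [measurable] = reciprocal_Gamma_measurable[OF s] log_weight_measurable[OF s]
  let ?f = "\<lambda>t \<tau>. ennreal (indicator {0..} t * t powr (\<tau> - 1) * (indicator {s..} \<tau> / Gamma \<tau>))"
  let ?J = "\<lambda>t. \<integral>\<^sup>+\<tau>. ?f t \<tau> \<partial>lborel"
  have "(\<integral>\<^sup>+t. ?J t * ennreal (exp (- w * t)) \<partial>lborel)
      = (\<integral>\<^sup>+t. \<integral>\<^sup>+\<tau>. ?f t \<tau> * ennreal (exp (- w * t)) \<partial>lborel \<partial>lborel)"
    by (intro nn_integral_cong nn_integral_multc[symmetric]) measurable
  also have "\<dots> = (\<integral>\<^sup>+\<tau>. \<integral>\<^sup>+t. ?f t \<tau> * ennreal (exp (- w * t)) \<partial>lborel \<partial>lborel)"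
    by (rule lborel_pair.Fubini') measurable
  also have "\<dots> = (\<integral>\<^sup>+\<tau>. ennreal (w powr - \<tau>) * indicator {s..} \<tau> \<partial>lborel)"
  proof (rule nn_integral_cong)
    fix \<tau> :: real
    show "(\<integral>\<^sup>+t. ?f t \<tau> * ennreal (exp (- w * t)) \<partial>lborel) = ennreal (w powr - \<tau>) * indicator {s..} \<tau>"
    proof (cases "s \<le> \<tau>")
      case True
      with s have \<tau>: "0 < \<tau>" by simp
      then have G: "0 < Gamma \<tau>" by (rule Gamma_real_pos)
      have "(\<integral>\<^sup>+t. ?f t \<tau> * ennreal (exp (- w * t)) \<partial>lborel)
          = (\<integral>\<^sup>+t. ennreal (1 / Gamma \<tau>) * ennreal (indicator {0..} t * t powr (\<tau> - 1) * exp (- w * t)) \<partial>lborel)"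
        using True G by (intro nn_integral_cong) (simp add: mult_ac flip: ennreal_mult)
      also have "\<dots> = ennreal (1 / Gamma \<tau>) * ennreal (Gamma \<tau> * w powr - \<tau>)"
        using w \<tau> nn_integral_Gamma_scaled[of w \<tau>] by (subst nn_integral_cmult) auto
      also have "\<dots> = ennreal (w powr - \<tau>)" using G by (simp flip: ennreal_mult)
      finally show ?thesis using True by simp
    qed simp
  qed
  also have "\<dots> = ennreal (w powr - s / ln w)" by (rule nn_integral_powr_exponent[OF w])
  finally have total: "(\<integral>\<^sup>+t. ?J t * ennreal (exp (- w * t)) \<partial>lborel) = ennreal (w powr - s / ln w)" .
  have "AE t in lborel. ?J t * ennreal (exp (- w * t)) \<noteq> \<infinity>"
  proof (rule nn_integral_noteq_infinite)
    show "(\<lambda>t. ?J t * ennreal (exp (- w * t))) \<in> borel_measurable lborel" by measurable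
    show "(\<integral>\<^sup>+t. ?J t * ennreal (exp (- w * t)) \<partial>lborel) \<noteq> \<infinity>" unfolding total by simp
  qed
  then have "AE t in lborel. ennreal (log_weight s t * exp (- w * t)) = ?J t * ennreal (exp (- w * t))"
  proof eventually_elim
    case (elim t)
    then have "?J t < \<top>" by (auto simp: ennreal_mult_eq_top_iff less_top)
    then have "ennreal (log_weight s t) = ?J t" unfolding log_weight_def by simp
    then show ?case by (simp add: ennreal_mult log_weight_nonneg)
  qed
  then have nn: "(\<integral>\<^sup>+t. ennreal (log_weight s t * exp (- w * t)) \<partial>lborel) = ennreal (w powr - s / ln w)"
    unfolding total[symmetric] by (rule nn_integral_cong_AE)
  show int: "integrable lborel (\<lambda>t. log_weight s t * exp (- w * t))"
  proof (rule integrableI_nonneg)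
    show "(\<integral>\<^sup>+t. ennreal (log_weight s t * exp (- w * t)) \<partial>lborel) < \<infinity>" unfolding nn by simp
  qed (auto simp: log_weight_nonneg)
  have "ennreal (LINT t|lborel. log_weight s t * exp (- w * t)) = ennreal (w powr - s / ln w)"
    unfolding nn[symmetric] by (rule nn_integral_eq_integral[OF int, symmetric]) (simp add: log_weight_nonneg)
  then show "(LINT t|lborel. log_weight s t * exp (- w * t)) = w powr - s / ln w"
    using w by (subst (asm) ennreal_inj) (auto intro!: integral_nonneg_AE simp: log_weight_nonneg)
qed

subsection \<open>Subordination to the heat kernel\<close>

definition heat_kernel :: "real \<Rightarrow> 'a::euclidean_space \<Rightarrow> real" where
  "heat_kernel t x = (1 / sqrt (4 * pi * t)) ^ DIM('a) * exp (- (1 / (4 * t)) * (norm x)\<^sup>2)"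

lemma heat_kernel_nonneg: "0 < t \<Longrightarrow> 0 \<le> heat_kernel t x"
  by (simp add: heat_kernel_def)

lemma heat_kernel_measurable [measurable]:
  assumes [measurable]: "f \<in> borel_measurable M" "g \<in> borel_measurable M"
  shows "(\<lambda>x. heat_kernel (f x) (g x)) \<in> borel_measurable M"
  unfolding heat_kernel_def by measurable

lemma
  fixes \<xi> :: "'a::euclidean_space"
  assumes t: "0 < t"
  shows integrable_heat_kernel: "integrable lborel (heat_kernel t :: 'a \<Rightarrow> real)"
    and integral_heat_kernel: "(LINT x :: 'a|lborel. heat_kernel t x) = 1"
    and fourier_heat_kernel: "(LINT x|lborel. complex_of_real (heat_kernel t x) * fourier_char x \<xi>)
      = complex_of_real (exp (- (4 * pi\<^sup>2 * (norm \<xi>)\<^sup>2) * t))"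
proof -
  have \<alpha>: "0 < 1 / (4 * t)" using t by simp
  have c: "(1 / sqrt (4 * pi * t)) ^ DIM('a) * sqrt (pi / (1 / (4 * t))) ^ DIM('a) = 1"
    using t by (simp add: mult_ac flip: power_mult_distrib)
  show "integrable lborel (heat_kernel t :: 'a \<Rightarrow> real)"
    unfolding heat_kernel_def [abs_def] by (intro integrable_mult_right integrable_gaussian \<alpha>)
  show "(LINT x :: 'a|lborel. heat_kernel t x) = 1"
    unfolding heat_kernel_def integral_mult_right_zero integral_gaussian[OF \<alpha>] by (rule c)
  have "(LINT x|lborel. complex_of_real (heat_kernel t x) * fourier_char x \<xi>)
      = complex_of_real ((1 / sqrt (4 * pi * t)) ^ DIM('a))
        * (LINT x|lborel. complex_of_real (exp (- (1 / (4 * t)) * (norm x)\<^sup>2)) * fourier_char x \<xi>)"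
    unfolding heat_kernel_def of_real_mult mult.assoc by (rule integral_mult_right_zero)
  also have "\<dots> = complex_of_real ((1 / sqrt (4 * pi * t)) ^ DIM('a) *
      (sqrt (pi / (1 / (4 * t))) ^ DIM('a) * exp (- pi\<^sup>2 * (norm \<xi>)\<^sup>2 / (1 / (4 * t)))))"
    unfolding fourier_gaussian[OF \<alpha>] by (simp only: of_real_mult)
  also have "\<dots> = complex_of_real (exp (- pi\<^sup>2 * (norm \<xi>)\<^sup>2 / (1 / (4 * t))))"
    by (simp only: mult.assoc[symmetric] c mult_1_left)
  also have "- pi\<^sup>2 * (norm \<xi>)\<^sup>2 / (1 / (4 * t)) = - (4 * pi\<^sup>2 * (norm \<xi>)\<^sup>2) * t" by simp
  finally show "(LINT x|lborel. complex_of_real (heat_kernel t x) * fourier_char x \<xi>)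
      = complex_of_real (exp (- (4 * pi\<^sup>2 * (norm \<xi>)\<^sup>2) * t))" .
qed

text \<open>The logarithmic Bessel kernel as a function: a mixture of heat kernels.\<close>

definition bessel_density :: "real \<Rightarrow> real \<Rightarrow> real^'n \<Rightarrow> complex" where
  "bessel_density s lam x = (LINT t|lborel. complex_of_real (log_weight s t * exp (- lam * t) * heat_kernel t x))"

context
  fixes s lam :: real
  assumes s: "0 < s" and lam: "1 < lam"
begin

text \<open>Heat kernels have mass 1, so the total mass is the Laplace transform of the weight at \<open>lam\<close>.\<close>

lemma bessel_density_pair_integrable:
  "integrable (lborel \<Otimes>\<^sub>M lborel)
    (\<lambda>(t, x :: real^'n::finite). complex_of_real (log_weight s t * exp (- lam * t) * heat_kernel t x))"
proof (rule lborel_pair.Fubini_integrable)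
  note [measurable] = log_weight_measurable(2)[OF s]
  let ?f = "\<lambda>t (x :: real^'n). complex_of_real (log_weight s t * exp (- lam * t) * heat_kernel t x)"
  show "(\<lambda>(t, x). ?f t x) \<in> borel_measurable (lborel \<Otimes>\<^sub>M lborel)" by measurable
  have ix: "integrable lborel (?f t)" for t
  proof (cases "0 < t")
    case True
    show ?thesis
      unfolding complex_of_real_integrable_eq by (intro integrable_mult_right integrable_heat_kernel True)
  qed (simp add: log_weight_nonpos)
  then show "AE t in lborel. integrable lborel (\<lambda>x. case (t, x) of (t, x) \<Rightarrow> ?f t x)" by simp
  have "(LINT x|lborel. norm (?f t x)) = log_weight s t * exp (- lam * t)" for t
  proof (cases "0 < t")
    case True
    then have "norm (?f t x) = log_weight s t * exp (- lam * t) * heat_kernel t x" for x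
      unfolding norm_of_real by (simp add: log_weight_nonneg heat_kernel_nonneg)
    then show ?thesis by (simp only: integral_mult_right_zero integral_heat_kernel[OF True] mult_1_right)
  qed (simp add: log_weight_nonpos)
  then show "integrable lborel (\<lambda>t. LINT x|lborel. norm (case (t, x) of (t, x) \<Rightarrow> ?f t x))"
    using log_weight_laplace(1)[OF s lam] by simp
qed

lemma bessel_density_integrable: "integrable lborel (bessel_density s lam :: real^'n::finite \<Rightarrow> complex)"
  unfolding bessel_density_def [abs_def]
  using lborel_pair.integrable_snd[OF bessel_density_pair_integrable] by simp

lemma bessel_density_measurable: "(bessel_density s lam :: real^'n::finite \<Rightarrow> complex) \<in> borel_measurable borel"
  using borel_measurable_integrable[OF bessel_density_integrable] by simp

lemma fourier_bessel_density:
  "fourier (bessel_density s lam) (\<xi> :: real^'n::finite) = complex_of_real (inverse (log_bessel_symbol s lam \<xi>))"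
proof -
  note [measurable] = log_weight_measurable(2)[OF s] bessel_density_measurable
  let ?f = "\<lambda>t (x :: real^'n). complex_of_real (log_weight s t * exp (- lam * t) * heat_kernel t x) * fourier_char x \<xi>"
  let ?w = "quad_symbol lam \<xi>"
  have w: "1 < ?w" using less_le_trans[OF lam quad_symbol_ge] .
  have int: "integrable (lborel \<Otimes>\<^sub>M lborel) (\<lambda>(t, x). ?f t x)"
    by (rule Bochner_Integration.integrable_bound[OF bessel_density_pair_integrable])
      (measurable, auto simp: norm_mult)
  have "fourier (bessel_density s lam) \<xi> = (LINT x|lborel. LINT t|lborel. ?f t x)"
    by (simp add: fourier_lborel bessel_density_measurable, simp add: bessel_density_def)
  also have "\<dots> = (LINT t|lborel. LINT x|lborel. ?f t x)"
    by (rule lborel_pair.Fubini_integral[OF int])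
  also have "\<dots> = (LINT t|lborel. complex_of_real (log_weight s t * exp (- ?w * t)))"
  proof (rule Bochner_Integration.integral_cong[OF refl])
    fix t :: real
    show "(LINT x|lborel. ?f t x) = complex_of_real (log_weight s t * exp (- ?w * t))"
    proof (cases "0 < t")
      case True
      have "(LINT x|lborel. ?f t x) = complex_of_real (log_weight s t * exp (- lam * t))
          * complex_of_real (exp (- (4 * pi\<^sup>2 * (norm \<xi>)\<^sup>2) * t))"
        unfolding of_real_mult[of _ "heat_kernel _ _"] mult.assoc[of _ "complex_of_real (heat_kernel _ _)"]
        by (simp only: integral_mult_right_zero fourier_heat_kernel[OF True])
      also have "\<dots> = complex_of_real (log_weight s t * exp (- ?w * t))"
        by (simp add: quad_symbol_def algebra_simps flip: exp_add of_real_mult)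
      finally show ?thesis .
    qed (simp add: log_weight_nonpos)
  qed
  also have "\<dots> = complex_of_real (?w powr - s / ln ?w)"
    unfolding integral_complex_of_real log_weight_laplace(2)[OF s w] ..
  also have "?w powr - s / ln ?w = inverse (log_bessel_symbol s lam \<xi>)"
    by (simp add: log_bessel_symbol_eq powr_minus divide_inverse)
  finally show ?thesis .
qed

end

section \<open>The equation for the logarithmic Bessel operator\<close>

lemma regular_dist_borel:
  fixes k \<phi> :: "real^'n \<Rightarrow> complex"
  assumes "k \<in> borel_measurable borel" "\<phi> \<in> schwartz_space"
  shows "regular_dist k \<phi> = (LINT x|lborel. k x * \<phi> x)"
  using assms by (intro regular_dist_representative measurable_completion) auto

lemma regular_dist_tempered:
  fixes k :: "real^'n::finite \<Rightarrow> complex"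
  assumes k: "integrable lborel k"
  shows "regular_dist k \<in> tempered_distributions"
proof (rule tempered_distributionI)
  have km: "k \<in> borel_measurable borel" using borel_measurable_integrable[OF k] by simp
  note eq = regular_dist_borel[OF km]
  have b: "norm (\<phi> x) \<le> schwartz_norm 0 \<phi>" if "\<phi> \<in> schwartz_space" for \<phi> :: "real^'n \<Rightarrow> complex" and x
    using schwartz_norm_decay[OF that, of "[]" 0 x] by simp
  have int: "integrable lborel (\<lambda>x. k x * \<phi> x)" if "\<phi> \<in> schwartz_space" for \<phi>
  proof (rule Bochner_Integration.integrable_bound)
    show "integrable lborel (\<lambda>x. norm (k x) * schwartz_norm 0 \<phi>)" using k by simp
    show "AE x in lborel. norm (k x * \<phi> x) \<le> norm (norm (k x) * schwartz_norm 0 \<phi>)"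
      using b[OF that] schwartz_norm_nonneg[OF that, of 0] by (intro AE_I2) (simp add: norm_mult mult_left_mono)
  qed (use km schwartz_borel_measurable[OF that] in auto)
  show "regular_dist k \<in> extensional schwartz_space" by (simp add: regular_dist_def)
  show "regular_dist k (\<lambda>x. \<phi> x + \<psi> x) = regular_dist k \<phi> + regular_dist k \<psi>"
    if "\<phi> \<in> schwartz_space" "\<psi> \<in> schwartz_space" for \<phi> \<psi>
    using that int by (simp add: eq schwartz_space_add distrib_left)
  show "regular_dist k (\<lambda>x. c * \<phi> x) = c * regular_dist k \<phi>" if "\<phi> \<in> schwartz_space" for c \<phi>
    using that by (simp add: eq schwartz_space_cmult mult.left_commute[of _ c])
  show "0 \<le> (LINT x|lborel. norm (k x))" by (intro integral_nonneg_AE AE_I2) simp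
  show "norm (regular_dist k \<phi>) \<le> (LINT x|lborel. norm (k x)) * schwartz_norm 0 \<phi>"
    if \<phi>: "\<phi> \<in> schwartz_space" for \<phi>
  proof -
    have "norm (regular_dist k \<phi>) \<le> (LINT x|lborel. norm (k x * \<phi> x))"
      unfolding eq[OF \<phi>] by (rule integral_norm_bound)
    also have "\<dots> \<le> (LINT x|lborel. norm (k x) * schwartz_norm 0 \<phi>)"
      using k b[OF \<phi>] by (intro integral_mono integrable_norm int \<phi>) (auto simp: norm_mult mult_left_mono)
    finally show ?thesis by simp
  qed
qed

lemma fourier_regular_dist:
  fixes k :: "real^'n::finite \<Rightarrow> complex"
  assumes k: "integrable lborel k"
  shows "fourier_dist (regular_dist k) = regular_dist (fourier k)"
proof (rule extensionalityI[of _ schwartz_space])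
  fix \<phi> :: "real^'n \<Rightarrow> complex" assume \<phi>: "\<phi> \<in> schwartz_space"
  have km: "k \<in> borel_measurable borel" using borel_measurable_integrable[OF k] by simp
  have "fourier_dist (regular_dist k) \<phi> = (LINT x|lborel. k x * fourier \<phi> x)"
    by (simp add: fourier_dist_apply \<phi> regular_dist_borel[OF km] schwartz_operator_closed[OF schwartz_operator_fourier])
  also have "\<dots> = (LINT x|lborel. fourier k x * \<phi> x)"
    by (rule fourier_multiplication_formula[OF k schwartz_integrable[OF \<phi>], symmetric])
  also have "\<dots> = regular_dist (fourier k) \<phi>" by (simp add: regular_dist_borel fourier_measurable km \<phi>)
  finally show "fourier_dist (regular_dist k) \<phi> = regular_dist (fourier k) \<phi>" .
qed (simp_all add: fourier_dist_def regular_dist_def)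

lemma log_bessel_kernel_eq:
  assumes "0 < s" "1 < lam"
  shows "log_bessel_kernel s lam = regular_dist (bessel_density s lam :: real^'n::finite \<Rightarrow> complex)"
proof -
  let ?K = "regular_dist (bessel_density s lam :: real^'n \<Rightarrow> complex)"
  note int = bessel_density_integrable[OF assms, where 'n='n]
  have K: "?K \<in> tempered_distributions" by (rule regular_dist_tempered[OF int])
  have FK: "fourier_dist ?K = regular_dist (\<lambda>\<xi>. complex_of_real (inverse (log_bessel_symbol s lam \<xi>)))"
    unfolding fourier_regular_dist[OF int] fourier_bessel_density[OF assms, abs_def] ..
  show ?thesis
    unfolding log_bessel_kernel_def
  proof (rule the_equality)
    fix L :: "'n functional"
    assume "L \<in> tempered_distributions \<and>
      fourier_dist L = regular_dist (\<lambda>\<xi>. complex_of_real (inverse (log_bessel_symbol s lam \<xi>)))"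
    then show "L = ?K" using FK fourier_dist_inj[OF _ K] by simp
  qed (use K FK in blast)
qed

lemma bessel_density_in_L1:
  assumes "0 < s" "1 < lam"
  shows "(bessel_density s lam :: real^'n::finite \<Rightarrow> complex) \<in> Lp_space 1"
proof -
  note [measurable] = bessel_density_measurable[OF assms, where 'n='n]
  have "integrable lborel (\<lambda>x :: real^'n. norm (bessel_density s lam x))"
    by (intro integrable_norm bessel_density_integrable assms)
  then have "integrable lebesgue (\<lambda>x :: real^'n. norm (bessel_density s lam x) powr 1)"
    by (subst integrable_completion) auto
  moreover have "(bessel_density s lam :: real^'n \<Rightarrow> complex) \<in> borel_measurable lebesgue"
    by (intro measurable_completion) simp
  ultimately show ?thesis by (simp add: Lp_space_def)
qed

lemma fourier_translation:
  fixes \<phi> :: "real^'n::finite \<Rightarrow> complex"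
  assumes [measurable]: "\<phi> \<in> borel_measurable borel"
  shows "fourier \<phi> (y + x) = fourier (\<lambda>z. \<phi> z * fourier_char z y) x"
  by (simp add: fourier_lborel fourier_char_commute[of _ "y + x"] fourier_char_add mult.assoc)
    (simp add: fourier_char_commute)

text \<open>Convolution with an integrable kernel against a transformed test function; the splitting of \<open>f\<close>
  in \<open>L\<^sup>1 + L\<^sup>\<infinity>\<close> makes Fubini's theorem applicable.\<close>

lemma convolution_fourier:
  fixes k f \<phi> :: "real^'n::finite \<Rightarrow> complex"
  assumes k: "integrable lborel k" and f: "f \<in> L1_plus_Linfty" and \<phi>: "\<phi> \<in> schwartz_space"
  shows "(LINT x|lborel. (LINT y|lborel. f y * k (x - y)) * fourier \<phi> x)
    = (LINT y|lborel. f y * fourier (\<lambda>\<xi>. fourier k \<xi> * \<phi> \<xi>) y)"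
proof -
  define \<psi> where "\<psi> = fourier \<phi>"
  have \<psi>: "\<psi> \<in> schwartz_space" unfolding \<psi>_def by (rule schwartz_operator_closed[OF schwartz_operator_fourier \<phi>])
  have B: "norm (\<psi> x) \<le> schwartz_norm 0 \<psi>" for x
    using schwartz_norm_decay[OF \<psi>, of "[]" 0 x] by simp
  have B0: "0 \<le> schwartz_norm 0 \<psi>" by (rule schwartz_norm_nonneg[OF \<psi>])
  have km: "k \<in> borel_measurable borel" using borel_measurable_integrable[OF k] by simp
  have fm: "f \<in> borel_measurable borel" using f by (simp add: L1_plus_Linfty_def)
  note [measurable] = km fm schwartz_borel_measurable[OF \<psi>] schwartz_borel_measurable[OF \<phi>]
  have shift: "integrable lborel (\<lambda>x. k (x - y))" for y
    using integrable_lborel_translation[OF km, of "- y"] k by simp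
  have shift': "integrable lborel (\<lambda>y. k (x - y))" for x
    using integrable_lborel_reflection[OF km, of x] k by simp
  have k\<psi>: "integrable lborel (\<lambda>x. k (x - y) * \<psi> x)" for y
  proof (rule Bochner_Integration.integrable_bound)
    show "integrable lborel (\<lambda>x. norm (k (x - y)) * schwartz_norm 0 \<psi>)"
      using shift by (intro integrable_mult_left integrable_norm)
    show "AE x in lborel. norm (k (x - y) * \<psi> x) \<le> norm (norm (k (x - y)) * schwartz_norm 0 \<psi>)"
      using B B0 by (intro AE_I2) (simp add: norm_mult mult_left_mono)
  qed measurable
  \<comment> \<open>the correlation of \<open>\<bar>k\<bar>\<close> and \<open>\<bar>\<psi>\<bar>\<close> is bounded and integrable, hence can be paired with \<open>f\<close>\<close>
  define P where "P y = (LINT x|lborel. norm (k (x - y) * \<psi> x))" for y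
  have P0: "0 \<le> P y" for y unfolding P_def by (intro integral_nonneg_AE AE_I2) simp
  have P_bound: "P y \<le> (LINT x|lborel. norm (k x)) * schwartz_norm 0 \<psi>" for y
  proof -
    have "P y \<le> (LINT x|lborel. norm (k (x - y)) * schwartz_norm 0 \<psi>)"
      unfolding P_def using shift B
      by (intro integral_mono integrable_norm k\<psi> integrable_mult_left) (auto simp: norm_mult mult_left_mono)
    also have "\<dots> = (LINT x|lborel. norm (k (- y + x))) * schwartz_norm 0 \<psi>" by simp
    also have "(LINT x|lborel. norm (k (- y + x))) = (LINT x|lborel. norm (k x))"
      by (rule integral_lborel_translation) measurable
    finally show ?thesis .
  qed
  have P_int: "integrable lborel P"
  proof -
    have "integrable (lborel \<Otimes>\<^sub>M lborel) (\<lambda>(x, y). norm (k (x - y) * \<psi> x))"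
    proof (rule lborel_pair.Fubini_integrable)
      show "AE x in lborel. integrable lborel (\<lambda>y. case (x, y) of (x, y) \<Rightarrow> norm (k (x - y) * \<psi> x))"
        using shift' by (simp add: norm_mult)
      have "(LINT y|lborel. norm (k (x - y) * \<psi> x)) = (LINT y|lborel. norm (k y)) * norm (\<psi> x)" for x
      proof -
        have "(LINT y|lborel. norm (k (x - y))) = (LINT y|lborel. norm (k y))"
          by (rule integral_lborel_reflection) measurable
        then show ?thesis by (simp add: norm_mult)
      qed
      then show "integrable lborel (\<lambda>x. LINT y|lborel. norm (case (x, y) of (x, y) \<Rightarrow> norm (k (x - y) * \<psi> x)))"
        using schwartz_integrable[OF \<psi>] by simp
    qed measurable
    from lborel_pair.integrable_snd[OF this] show ?thesis by (simp add: P_def [abs_def])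
  qed
  have int: "integrable (lborel \<Otimes>\<^sub>M lborel) (\<lambda>(y, x). f y * (k (x - y) * \<psi> x))"
  proof (rule lborel_pair.Fubini_integrable)
    show "AE y in lborel. integrable lborel (\<lambda>x. case (y, x) of (y, x) \<Rightarrow> f y * (k (x - y) * \<psi> x))"
      using k\<psi> by simp
    have "integrable lborel (\<lambda>y. f y * complex_of_real (P y))"
      by (rule integrable_L1_plus_Linfty_mult[OF f, of _ "(LINT x|lborel. norm (k x)) * schwartz_norm 0 \<psi>"])
        (use P_int P0 P_bound in \<open>simp_all add: complex_of_real_integrable_eq\<close>)
    from integrable_norm[OF this] have "integrable lborel (\<lambda>y. norm (f y) * P y)"
      using P0 by (simp add: norm_mult)
    then show "integrable lborel (\<lambda>y. LINT x|lborel. norm (case (y, x) of (y, x) \<Rightarrow> f y * (k (x - y) * \<psi> x)))"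
      by (simp add: norm_mult P_def)
  qed measurable
  have "(LINT x|lborel. (LINT y|lborel. f y * k (x - y)) * \<psi> x)
      = (LINT x|lborel. LINT y|lborel. f y * (k (x - y) * \<psi> x))"
    by (simp add: mult.assoc flip: integral_mult_left_zero)
  also have "\<dots> = (LINT y|lborel. LINT x|lborel. f y * (k (x - y) * \<psi> x))"
    by (rule lborel_pair.Fubini_integral[OF int])
  also have "\<dots> = (LINT y|lborel. f y * fourier (\<lambda>\<xi>. fourier k \<xi> * \<phi> \<xi>) y)"
  proof (rule Bochner_Integration.integral_cong[OF refl])
    fix y :: "real^'n"
    have "(LINT x|lborel. k (x - y) * \<psi> x) = (LINT x|lborel. k ((y + x) - y) * \<psi> (y + x))"
      by (rule integral_lborel_translation[symmetric]) measurable
    also have "\<dots> = (LINT x|lborel. k x * fourier (\<lambda>z. \<phi> z * fourier_char z y) x)"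
      by (simp add: \<psi>_def fourier_translation)
    also have "\<dots> = (LINT x|lborel. fourier k x * (\<phi> x * fourier_char x y))"
      by (rule fourier_multiplication_formula[OF k integrable_mult_fourier_char[OF schwartz_integrable[OF \<phi>]], symmetric])
    also have "\<dots> = fourier (\<lambda>\<xi>. fourier k \<xi> * \<phi> \<xi>) y"
      by (simp add: fourier_lborel fourier_measurable[OF km] mult.assoc)
    finally show "(LINT x|lborel. f y * (k (x - y) * \<psi> x)) = f y * fourier (\<lambda>\<xi>. fourier k \<xi> * \<phi> \<xi>) y"
      by simp
  qed
  finally show ?thesis by (simp only: \<psi>_def)
qed

text \<open>In other words \<open>F (k * f) = F k \<cdot> F f\<close>.  The product is moved onto the test function, which is possible
  whenever \<open>F k\<close> multiplies it into the Schwartz space.\<close>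

lemma regular_dist_convolve_fourier:
  fixes k f \<phi> :: "real^'n::finite \<Rightarrow> complex"
  assumes k: "integrable lborel k" and f: "f \<in> Lp_space p" and p: "1 \<le> p" and \<phi>: "\<phi> \<in> schwartz_space"
    and S: "(\<lambda>\<xi>. fourier k \<xi> * \<phi> \<xi>) \<in> schwartz_space"
  shows "regular_dist (convolve k f) (fourier \<phi>) = fourier_dist (regular_dist f) (\<lambda>\<xi>. fourier k \<xi> * \<phi> \<xi>)"
proof -
  obtain g where g: "g \<in> L1_plus_Linfty" "AE x in lborel. f x = g x"
    using Lp_space_representative[OF f p] .
  have gm: "g \<in> borel_measurable borel" using g(1) by (simp add: L1_plus_Linfty_def)
  have km: "k \<in> borel_measurable borel" using borel_measurable_integrable[OF k] by simp
  have fm: "f \<in> borel_measurable lebesgue" using f by (simp add: Lp_space_def)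
  note [measurable] = gm km
  note F = schwartz_operator_closed[OF schwartz_operator_fourier]
  have conv: "convolve k f = (\<lambda>x. LINT y|lborel. g y * k (x - y))"
  proof
    fix x
    have "(\<lambda>y. k (x - y)) \<in> borel_measurable borel" by measurable
    from integral_lebesgue_representative[OF g(2) fm gm this]
    show "convolve k f x = (LINT y|lborel. g y * k (x - y))" by (simp add: convolve_def mult.commute)
  qed
  have "regular_dist (convolve k f) (fourier \<phi>) = (LINT x|lborel. (LINT y|lborel. g y * k (x - y)) * fourier \<phi> x)"
    unfolding conv by (intro regular_dist_borel F \<phi>) measurable
  also have "\<dots> = (LINT y|lborel. g y * fourier (\<lambda>\<xi>. fourier k \<xi> * \<phi> \<xi>) y)"
    by (rule convolution_fourier[OF k g(1) \<phi>])
  also have "\<dots> = regular_dist f (fourier (\<lambda>\<xi>. fourier k \<xi> * \<phi> \<xi>))"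
    by (rule regular_dist_representative[OF g(2) fm gm F[OF S], symmetric])
  finally show ?thesis by (simp add: fourier_dist_apply S)
qed

theorem theorem1p8:
  fixes s lam :: real and p :: ennreal
    and f :: "real^'n \<Rightarrow> complex" and u :: "('n::finite) functional"
  assumes "s > 0" and "lam > 1" and "1 \<le> p" and "f \<in> Lp_space p"
    and "u \<in> tempered_distributions"
    and "log_bessel_op s lam u = regular_dist f"
  shows "u \<in> log_bessel_space p s lam
    \<and> log_bessel_norm p s lam u = Lp_norm p f
    \<and> (\<forall>v\<in>tempered_distributions. log_bessel_op s lam v = regular_dist f \<longrightarrow> v = u)
    \<and> u = log_bessel_inv_op s lam (regular_dist f)
    \<and> (\<exists>k\<in>Lp_space 1. log_bessel_kernel s lam = regular_dist k
          \<and> u = regular_dist (convolve k f))"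
proof -
  note s = \<open>s > 0\<close> and lam = \<open>lam > 1\<close> and p = \<open>1 \<le> p\<close> and f = \<open>f \<in> Lp_space p\<close>
  let ?a = "log_bessel_symbol s lam :: real^'n \<Rightarrow> real"
  let ?k = "bessel_density s lam :: real^'n \<Rightarrow> complex"
  let ?inv = "\<lambda>\<phi> \<xi>. complex_of_real (inverse (?a \<xi>)) * \<phi> \<xi>"
  have inv_S: "?inv \<phi> \<in> schwartz_space" if "\<phi> \<in> schwartz_space" for \<phi>
    using schwartz_operator_closed[OF schwartz_operator_mult[OF slowly_increasing_inverse_log_bessel_symbol[OF lam]] that] .
  have a_inv: "complex_of_real (?a \<xi>) * (complex_of_real (inverse (?a \<xi>)) * z) = z" for \<xi> z
    using log_bessel_symbol_pos[OF lam, of s \<xi>] by simp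
  \<comment> \<open>the equation on the Fourier side, divided by the symbol\<close>
  have transform: "fourier_dist (regular_dist f) (?inv \<phi>) = fourier_dist v \<phi>"
    if v: "v \<in> tempered_distributions" "log_bessel_op s lam v = regular_dist f" and \<phi>: "\<phi> \<in> schwartz_space" for v \<phi>
  proof -
    have "fourier_dist (regular_dist f) = mult_dist ?a (fourier_dist v)"
      using fourier_dist_fourier_multiplier[OF v(1) slowly_increasing_log_bessel_symbol[OF lam, of s]] v(2)
      by (simp add: log_bessel_op_def)
    then show ?thesis using inv_S[OF \<phi>] by (simp add: mult_dist_def a_inv del: of_real_inverse)
  qed
  have Fu: "fourier_dist u = mult_dist (\<lambda>\<xi>. inverse (?a \<xi>)) (fourier_dist (regular_dist f))"
    if "u \<in> tempered_distributions" "log_bessel_op s lam u = regular_dist f" for u :: "'n functional"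
  proof (rule extensionalityI[of _ schwartz_space])
    show "fourier_dist u \<phi> = mult_dist (\<lambda>\<xi>. inverse (?a \<xi>)) (fourier_dist (regular_dist f)) \<phi>"
      if "\<phi> \<in> schwartz_space" for \<phi>
      using transform[OF \<open>u \<in> _\<close> \<open>log_bessel_op s lam u = _\<close> that] that by (simp add: mult_dist_def)
  qed (simp_all add: fourier_dist_def mult_dist_def)
  have space: "u \<in> log_bessel_space p s lam"
    using assms by (auto simp: log_bessel_space_def Lp_dist_def)
  have norm: "log_bessel_norm p s lam u = Lp_norm p f"
    using assms by (simp add: log_bessel_norm_def Lp_dist_norm_regular_dist)
  have unique: "v = u" if "v \<in> tempered_distributions" "log_bessel_op s lam v = regular_dist f" for v
    using fourier_dist_inj[OF that(1) assms(5)] Fu[OF that] Fu[OF assms(5,6)] by simp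
  have inverse: "u = log_bessel_inv_op s lam (regular_dist f)"
    unfolding log_bessel_inv_op_def by (rule fourier_multiplier_eqI[symmetric, OF assms(5) Fu[OF assms(5,6)]])
  have "u = regular_dist (convolve ?k f)"
  proof (rule distribution_eqI)
    fix \<phi> :: "real^'n \<Rightarrow> complex" assume \<phi>: "\<phi> \<in> schwartz_space"
    have k: "fourier ?k = (\<lambda>\<xi>. complex_of_real (inverse (?a \<xi>)))"
      by (rule ext) (rule fourier_bessel_density[OF s lam])
    have "u (fourier \<phi>) = fourier_dist (regular_dist f) (?inv \<phi>)"
      using transform[OF assms(5,6) \<phi>] \<phi> by (simp add: fourier_dist_apply)
    also have "\<dots> = regular_dist (convolve ?k f) (fourier \<phi>)"
      using regular_dist_convolve_fourier[OF bessel_density_integrable[OF s lam] f p \<phi>] inv_S[OF \<phi>]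
      unfolding k by simp
    finally show "u (fourier \<phi>) = regular_dist (convolve ?k f) (fourier \<phi>)" .
  qed (use assms(5) in \<open>simp_all add: tempered_distribution_extensional regular_dist_def\<close>)
  then have "\<exists>k\<in>Lp_space 1. log_bessel_kernel s lam = regular_dist k \<and> u = regular_dist (convolve k f)"
    using bessel_density_in_L1[OF s lam] log_bessel_kernel_eq[OF s lam] by blast
  with space norm unique inverse show ?thesis by blast
qed

end
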